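(* Let $(X_k)_{k\ge 1}$ be a sequence of centered real-valued random variables in $\mathbb{L}^2(\Omega,\mathcal{A},\mathbb{P})$, and let $(\mathcal{F}_i)_{i\ge 0}$ be a non-decreasing sequence of sub-$\sigma$-algebras of $\mathcal{A}$ such that $X_i$ is $\mathcal{F}_i$-measurable for every $i\ge 1$. Set $S_0=0$, $S_n=\sum_{i=1}^n X_i$, $\mathbb{E}_k(\cdot)=\mathbb{E}(\cdot\mid\mathcal{F}_k)$, and for $k\ge 0$, $m\ge 1$, $$\delta(k)=\sup_{i\ge 0}\|\mathbb{E}(S_{k+i}-S_i\mid\mathcal{F}_i)\|_2,\qquad \theta_k^m=\frac1m\sum_{i=1}^{m-1}\mathbb{E}_k(S_{k+i}-S_k).$$ Assume that (i) $\sup_{n\ge1}\frac1n\sum_{j=1}^n\mathbb{E}(X_j^2)\le C<\infty$ for some constant $C$, and for every $\varepsilon>0$, $\lim_{n\to\infty}\frac1n\sum_{k=1}^n\mathbb{E}\{X_k^2 I(|X_k|>\varepsilon\sqrt n)\}=0$; (ii) $\sum_{k\ge0}2^{-k/2}\delta(2^k)<\infty$; (iii) there exists a constant $c^2$ (with $c\ge0$) such that, for every $t\in[0,1]$ and every $\varepsilon>0$, $$\lim_{m\to\infty}\limsup_{n\to\infty}\mathbb{P}\Big(\Big|\frac1n\sum_{k=1}^{[nt]}\big(X_k^2+2X_k\theta_k^m\big)-tc^2\Big|>\varepsilon\Big)=0.$$ Then $\big\{n^{-1/2}\sum_{k=1}^{[nt]}X_k,\ t\in[0,1]\big\}$ converges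 in distribution in $D([0,1])$ to $cW$, where $W$ is a standard Brownian motion.
   Context: $\|\cdot\|_2$ is the $\mathbb{L}^2(\mathbb{P})$ norm, $I(A)$ is the indicator of $A$, and $[x]$ is the integer part of $x$. $D([0,1])$ is the space of functions on $[0,1]$ that are right continuous with finite left-hand limits, endowed with the uniform topology. *)

theory Defs
  imports "HOL-Probability.Probability"
begin

section \<open>The space D([0,1]) with the uniform metric\<close>

definition cadlag :: "(real \<Rightarrow> real) \<Rightarrow> bool" where
  "cadlag f \<longleftrightarrow>
     (\<forall>t. 0 \<le> t \<and> t < 1 \<longrightarrow> (f \<longlongrightarrow> f t) (at_right t)) \<and>
     (\<forall>t. 0 < t \<and> t \<le> 1 \<longrightarrow> (\<exists>l. (f \<longlongrightarrow> l) (at_left t)))"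

lemma cadlag_cong:
  assumes "\<And>t. 0 \<le> t \<Longrightarrow> t \<le> 1 \<Longrightarrow> f t = g t" and "cadlag f"
  shows "cadlag g"
  unfolding cadlag_def
proof safe
  fix t :: real assume t: "0 \<le> t" "t < 1"
  have "\<forall>\<^sub>F x in at_right t. f x = g x"
    using eventually_at_right_real[OF t(2)] by eventually_elim (use t assms(1) in auto)
  moreover have "(f \<longlongrightarrow> f t) (at_right t)" using assms(2) t by (auto simp: cadlag_def)
  ultimately have "(g \<longlongrightarrow> f t) (at_right t)" using tendsto_cong by blast
  then show "(g \<longlongrightarrow> g t) (at_right t)" using assms(1) t by simp
next
  fix t :: real assume t: "0 < t" "t \<le> 1"
  have "\<forall>\<^sub>F x in at_left t. f x = g x"
    using eventually_at_left_real[OF t(1)] by eventually_elim (use t assms(1) in auto)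
  moreover obtain l where "(f \<longlongrightarrow> l) (at_left t)" using assms(2) t by (auto simp: cadlag_def)
  ultimately show "\<exists>l. (g \<longlongrightarrow> l) (at_left t)" using tendsto_cong by blast
qed

lemma cadlag_bounded:
  assumes f: "cadlag f"
  shows "bounded (f ` {0..1})"
proof -
  define P where "P x b e \<longleftrightarrow> e > 0 \<and> (\<forall>y\<in>{0..1}. dist y x < e \<longrightarrow> \<bar>f y\<bar> \<le> b)" for x b e
  have ex: "\<exists>b e. P x b e" if x: "x \<in> {0..1}" for x
  proof -
    have "\<exists>b e. e > 0 \<and> (\<forall>y\<in>{0..1}. x < y \<longrightarrow> y < x + e \<longrightarrow> \<bar>f y\<bar> \<le> b)"
    proof (cases "x < 1")
      case True
      then have "(f \<longlongrightarrow> f x) (at_right x)" using f x by (auto simp: cadlag_def)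
      then have "\<forall>\<^sub>F y in at_right x. dist (f y) (f x) < 1" by (rule tendstoD) simp
      then obtain u where "u > x" "\<And>y. y > x \<Longrightarrow> y < u \<Longrightarrow> dist (f y) (f x) < 1"
        unfolding eventually_at_right_field by blast
      then show ?thesis
        by (intro exI[of _ "\<bar>f x\<bar> + 1"] exI[of _ "u - x"]) (force simp: dist_real_def)
    next
      case False
      then show ?thesis using x by (intro exI[of _ 0] exI[of _ 1]) auto
    qed
    then obtain b1 e1 where 1: "e1 > 0" "\<And>y. y \<in> {0..1} \<Longrightarrow> x < y \<Longrightarrow> y < x + e1 \<Longrightarrow> \<bar>f y\<bar> \<le> b1"
      by blast
    have "\<exists>b e. e > 0 \<and> (\<forall>y\<in>{0..1}. y < x \<longrightarrow> x - e < y \<longrightarrow> \<bar>f y\<bar> \<le> b)"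
    proof (cases "0 < x")
      case True
      then obtain l where "(f \<longlongrightarrow> l) (at_left x)" using f x by (auto simp: cadlag_def)
      then have "\<forall>\<^sub>F y in at_left x. dist (f y) l < 1" by (rule tendstoD) simp
      then obtain u where "u < x" "\<And>y. y > u \<Longrightarrow> y < x \<Longrightarrow> dist (f y) l < 1"
        unfolding eventually_at_left_field by blast
      then show ?thesis
        by (intro exI[of _ "\<bar>l\<bar> + 1"] exI[of _ "x - u"]) (force simp: dist_real_def)
    next
      case False
      then show ?thesis using x by (intro exI[of _ 0] exI[of _ 1]) auto
    qed
    then obtain b2 e2 where 2: "e2 > 0" "\<And>y. y \<in> {0..1} \<Longrightarrow> y < x \<Longrightarrow> x - e2 < y \<Longrightarrow> \<bar>f y\<bar> \<le> b2"
      by blast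
    have "\<bar>f y\<bar> \<le> max (\<bar>f x\<bar>) (max b1 b2)" if "y \<in> {0..1}" "dist y x < min e1 e2" for y
    proof (cases y x rule: linorder_cases)
      case less
      then show ?thesis using 2(2)[OF that(1)] that by (simp add: dist_real_def)
    next
      case greater
      then show ?thesis using 1(2)[OF that(1)] that by (simp add: dist_real_def)
    qed simp
    then have "P x (max (\<bar>f x\<bar>) (max b1 b2)) (min e1 e2)" using 1(1) 2(1) by (auto simp: P_def)
    then show ?thesis by blast
  qed
  then obtain b e where be: "\<And>x. x \<in> {0..1} \<Longrightarrow> P x (b x) (e x)" by metis
  have "compact {0..1::real}" by simp
  then obtain K where K: "K \<subseteq> {0..1}" "finite K" "{0..1} \<subseteq> (\<Union>x\<in>K. ball x (e x))"
    by (rule compactE_image[of _ "{0..1}" "\<lambda>x. ball x (e x)"]) (use be in \<open>auto simp: P_def\<close>)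
  have "\<bar>f y\<bar> \<le> (\<Sum>x\<in>K. \<bar>b x\<bar>)" if y: "y \<in> {0..1}" for y
  proof -
    obtain x where x: "x \<in> K" "dist y x < e x" using K y by (auto simp: dist_commute)
    then have "\<bar>f y\<bar> \<le> b x" using be[of x] K y by (auto simp: P_def)
    also have "b x \<le> \<bar>b x\<bar>" by simp
    also have "\<dots> \<le> (\<Sum>x\<in>K. \<bar>b x\<bar>)" using x K by (intro member_le_sum) auto
    finally show ?thesis .
  qed
  then show ?thesis unfolding bounded_iff by (intro exI[of _ "\<Sum>x\<in>K. \<bar>b x\<bar>"]) auto
qed

lemma cadlag_continuous_on:
  assumes "continuous_on {0..1} f"
  shows "cadlag f"
  unfolding cadlag_def
proof safe
  fix t :: real assume t: "0 \<le> t" "t < 1"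
  then have "(f \<longlongrightarrow> f t) (at t within {0..1})" using assms by (simp add: continuous_on)
  then have "(f \<longlongrightarrow> f t) (at t within {t<..<1})" by (rule tendsto_within_subset) (use t in auto)
  then show "(f \<longlongrightarrow> f t) (at_right t)"
    using at_within_nhd[of t "{..<1}" "{t<..<1}" "{t<..}"] t by fastforce
next
  fix t :: real assume t: "0 < t" "t \<le> 1"
  then have "(f \<longlongrightarrow> f t) (at t within {0..1})" using assms by (simp add: continuous_on)
  then have "(f \<longlongrightarrow> f t) (at t within {0<..<t})" by (rule tendsto_within_subset) (use t in auto)
  then show "\<exists>l. (f \<longlongrightarrow> l) (at_left t)"
    using at_within_nhd[of t "{0<..}" "{0<..<t}" "{..<t}"] t by fastforce
qed

lemma cadlag_floor:
  fixes g :: "nat \<Rightarrow> real" and n :: nat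
  shows "cadlag (\<lambda>t. g (nat \<lfloor>real n * t\<rfloor>))"
proof (cases "n = 0")
  case True
  then show ?thesis by (auto simp: cadlag_def intro: tendsto_const)
next
  case False
  then have n: "real n > 0" by simp
  show ?thesis
    unfolding cadlag_def
  proof safe
    fix t :: real
    let ?u = "(of_int \<lfloor>real n * t\<rfloor> + 1) / real n"
    have u: "t < ?u"
      using n by (simp add: pos_less_divide_eq) (metis mult.commute real_of_int_floor_add_one_gt)
    have "\<forall>\<^sub>F y in at_right t. g (nat \<lfloor>real n * y\<rfloor>) = g (nat \<lfloor>real n * t\<rfloor>)"
      using eventually_at_right_real[OF u]
    proof eventually_elim
      case (elim y)
      then have "real n * t \<le> real n * y" "real n * y < of_int \<lfloor>real n * t\<rfloor> + 1"
        using n by (auto simp: pos_less_divide_eq mult.commute)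
      then have "\<lfloor>real n * y\<rfloor> = \<lfloor>real n * t\<rfloor>" by linarith
      then show ?case by simp
    qed
    then show "((\<lambda>t. g (nat \<lfloor>real n * t\<rfloor>)) \<longlongrightarrow> g (nat \<lfloor>real n * t\<rfloor>)) (at_right t)"
      by (rule tendsto_eventually)
  next
    fix t :: real
    let ?u = "(of_int \<lceil>real n * t\<rceil> - 1) / real n"
    have u: "?u < t"
      using n by (simp add: pos_divide_less_eq) (smt (verit) ceiling_correct mult.commute)
    have "\<forall>\<^sub>F y in at_left t. g (nat \<lfloor>real n * y\<rfloor>) = g (nat (\<lceil>real n * t\<rceil> - 1))"
      using eventually_at_left_real[OF u]
    proof eventually_elim
      case (elim y)
      then have "real n * y < real n * t" "of_int \<lceil>real n * t\<rceil> - 1 < real n * y"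
        using n by (auto simp: pos_divide_less_eq mult.commute)
      then have "\<lfloor>real n * y\<rfloor> = \<lceil>real n * t\<rceil> - 1" by linarith
      then show ?case by simp
    qed
    then show "\<exists>l. ((\<lambda>t. g (nat \<lfloor>real n * t\<rfloor>)) \<longlongrightarrow> l) (at_left t)"
      by (blast intro: tendsto_eventually)
  qed
qed

text \<open>A function on [0,1] is represented by its extensional version on the real line.\<close>

typedef D01 = "{f :: real \<Rightarrow> real. f \<in> extensional {0..1} \<and> cadlag f}"
  morphisms eval_D01 Abs_D01
proof -
  have "cadlag (restrict (\<lambda>_. 0) {0..1})"
    by (rule cadlag_cong[of "\<lambda>_. 0"]) (auto simp: cadlag_def)
  then show ?thesis by (intro exI[of _ "restrict (\<lambda>_. 0) {0..1}"]) auto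
qed

lemma eval_D01_bounded: "bounded (eval_D01 x ` {0..1})"
  using eval_D01[of x] cadlag_bounded by auto

lemma eval_D01_bdd_above: "bdd_above ((\<lambda>t. \<bar>eval_D01 x t - eval_D01 y t\<bar>) ` {0..1})"
proof -
  obtain a where a: "\<And>t. t \<in> {0..1} \<Longrightarrow> \<bar>eval_D01 x t\<bar> \<le> a"
    using eval_D01_bounded[of x] unfolding bounded_iff by fastforce
  obtain b where b: "\<And>t. t \<in> {0..1} \<Longrightarrow> \<bar>eval_D01 y t\<bar> \<le> b"
    using eval_D01_bounded[of y] unfolding bounded_iff by fastforce
  show ?thesis
  proof (intro bdd_aboveI2[of _ _ "a + b"])
    fix t :: real assume "t \<in> {0..1}"
    then show "\<bar>eval_D01 x t - eval_D01 y t\<bar> \<le> a + b" using a[of t] b[of t] by linarith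
  qed
qed

instantiation D01 :: metric_space
begin

definition dist_D01 :: "D01 \<Rightarrow> D01 \<Rightarrow> real" where
  "dist_D01 x y = (SUP t\<in>{0..1}. \<bar>eval_D01 x t - eval_D01 y t\<bar>)"

definition uniformity_D01 :: "(D01 \<times> D01) filter" where
  "uniformity_D01 = (INF e\<in>{0<..}. principal {(x, y). dist x y < e})"

definition open_D01 :: "D01 set \<Rightarrow> bool" where
  "open_D01 U = (\<forall>x\<in>U. \<forall>\<^sub>F (x', y) in uniformity. x' = x \<longrightarrow> y \<in> U)"

instance
proof
  fix x y z :: D01
  have upper: "\<bar>eval_D01 a t - eval_D01 b t\<bar> \<le> dist a b" if "t \<in> {0..1}" for a b t
    unfolding dist_D01_def by (rule cSUP_upper[OF that eval_D01_bdd_above])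
  show "(dist x y = 0) = (x = y)"
  proof
    assume 0: "dist x y = 0"
    have "eval_D01 x = eval_D01 y"
      by (rule extensionalityI[of _ "{0..1}"]) (use eval_D01[of x] eval_D01[of y] upper[of _ x y] 0 in auto)
    then show "x = y" by (simp add: eval_D01_inject)
  next
    assume "x = y"
    then show "dist x y = 0" by (simp add: dist_D01_def)
  qed
  show "dist x y \<le> dist x z + dist y z"
    unfolding dist_D01_def[of x y]
  proof (rule cSUP_least)
    fix t :: real assume t: "t \<in> {0..1}"
    show "\<bar>eval_D01 x t - eval_D01 y t\<bar> \<le> dist x z + dist y z"
      using upper[OF t, of x z] upper[OF t, of y z] by linarith
  qed simp
qed (simp_all add: uniformity_D01_def open_D01_def)

end

definition to_D01 :: "(real \<Rightarrow> real) \<Rightarrow> D01" where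
  "to_D01 f = Abs_D01 (restrict f {0..1})"

lemma eval_to_D01:
  assumes "cadlag f" "0 \<le> t" "t \<le> 1"
  shows "eval_D01 (to_D01 f) t = f t"
proof -
  have "cadlag (restrict f {0..1})" by (rule cadlag_cong[OF _ assms(1)]) auto
  then show ?thesis using assms by (simp add: to_D01_def Abs_D01_inverse)
qed


section \<open>Convergence in distribution and Brownian motion\<close>

definition converges_in_distribution ::
  "'a measure \<Rightarrow> (nat \<Rightarrow> 'a \<Rightarrow> 'c::topological_space) \<Rightarrow> 'b measure \<Rightarrow> ('b \<Rightarrow> 'c) \<Rightarrow> bool" where
  "converges_in_distribution M Y N Z \<longleftrightarrow>
     (\<forall>n. Y n \<in> borel_measurable M) \<and> Z \<in> borel_measurable N \<and>
     (\<forall>h :: 'c \<Rightarrow> real. continuous_on UNIV h \<and> bounded (range h) \<longrightarrow>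
        (\<lambda>n. LINT \<omega>|M. h (Y n \<omega>)) \<longlonglongrightarrow> (LINT \<omega>|N. h (Z \<omega>)))"

definition standard_brownian_motion :: "'b measure \<Rightarrow> (real \<Rightarrow> 'b \<Rightarrow> real) \<Rightarrow> bool" where
  "standard_brownian_motion N W \<longleftrightarrow>
     prob_space N \<and>
     (\<forall>t\<in>{0..1}. W t \<in> borel_measurable N) \<and>
     (\<forall>\<omega>\<in>space N. W 0 \<omega> = 0 \<and> continuous_on {0..1} (\<lambda>t. W t \<omega>)) \<and>
     (\<forall>s t. 0 \<le> s \<and> s < t \<and> t \<le> 1 \<longrightarrow>
        distributed N lborel (\<lambda>\<omega>. W t \<omega> - W s \<omega>) (normal_density 0 (sqrt (t - s)))) \<and>
     (\<forall>(m::nat) \<tau>. \<tau> \<in> {..m} \<rightarrow> {0..1} \<and> (\<forall>i<m. \<tau> i < \<tau> (Suc i)) \<longrightarrow>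
        prob_space.indep_vars N (\<lambda>_. borel) (\<lambda>i \<omega>. W (\<tau> (Suc i)) \<omega> - W (\<tau> i) \<omega>) {..<m})"


section \<open>Partial sums and the quantities built from them\<close>

definition L2norm :: "'a measure \<Rightarrow> ('a \<Rightarrow> real) \<Rightarrow> real" where
  "L2norm M f = sqrt (LINT \<omega>|M. (f \<omega>)\<^sup>2)"

definition psum :: "(nat \<Rightarrow> 'a \<Rightarrow> real) \<Rightarrow> nat \<Rightarrow> 'a \<Rightarrow> real" where
  "psum X n \<omega> = (\<Sum>i=1..n. X i \<omega>)"

text \<open>The supremum may be infinite, hence the values in \<open>ennreal\<close>; each single norm is finite when
  the \<open>X k\<close> are square-integrable.\<close>

definition delta :: "'a measure \<Rightarrow> (nat \<Rightarrow> 'a measure) \<Rightarrow> (nat \<Rightarrow> 'a \<Rightarrow> real) \<Rightarrow> nat \<Rightarrow> ennreal" where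
  "delta M F X k =
     (SUP i. ennreal (L2norm M (real_cond_exp M (F i) (\<lambda>\<omega>. psum X (k + i) \<omega> - psum X i \<omega>))))"

definition theta ::
  "'a measure \<Rightarrow> (nat \<Rightarrow> 'a measure) \<Rightarrow> (nat \<Rightarrow> 'a \<Rightarrow> real) \<Rightarrow> nat \<Rightarrow> nat \<Rightarrow> 'a \<Rightarrow> real" where
  "theta M F X m k \<omega> =
     1 / real m * (\<Sum>i=1..m - 1. real_cond_exp M (F k) (\<lambda>\<omega>. psum X (k + i) \<omega> - psum X k \<omega>) \<omega>)"

definition partial_sum_process :: "(nat \<Rightarrow> 'a \<Rightarrow> real) \<Rightarrow> nat \<Rightarrow> 'a \<Rightarrow> D01" where
  "partial_sum_process X n \<omega> =
     to_D01 (\<lambda>t. 1 / sqrt (real n) * (\<Sum>k=1..nat \<lfloor>real n * t\<rfloor>. X k \<omega>))"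

definition scaled_process :: "real \<Rightarrow> (real \<Rightarrow> 'b \<Rightarrow> real) \<Rightarrow> 'b \<Rightarrow> D01" where
  "scaled_process c W \<omega> = to_D01 (\<lambda>t. c * W t \<omega>)"

text \<open>Sanity checks: on the relevant paths \<open>to_D01\<close> is applied to genuine elements of D([0,1]).\<close>

lemma eval_partial_sum_process:
  assumes "0 \<le> t" "t \<le> 1"
  shows "eval_D01 (partial_sum_process X n \<omega>) t =
    1 / sqrt (real n) * (\<Sum>k=1..nat \<lfloor>real n * t\<rfloor>. X k \<omega>)"
  unfolding partial_sum_process_def
  by (rule eval_to_D01[OF cadlag_floor[of "\<lambda>j. 1 / sqrt (real n) * (\<Sum>k=1..j. X k \<omega>)" n] assms])

lemma eval_scaled_process:
  assumes "standard_brownian_motion N W" "\<omega> \<in> space N" "0 \<le> t" "t \<le> 1"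
  shows "eval_D01 (scaled_process c W \<omega>) t = c * W t \<omega>"
  unfolding scaled_process_def
  by (rule eval_to_D01[OF cadlag_continuous_on assms(3,4)])
     (use assms(1,2) in \<open>auto simp: standard_brownian_motion_def intro!: continuous_intros\<close>)

end

theory Submission
  imports Defs
begin

text \<open>
The proof approximates the partial sums by martingales and transfers a martingale limit theorem.

For a window length \<open>m = 2 ^ p\<close>, put \<open>th k = \<theta> m k\<close>, the averaged prediction of the sums that follow
time \<open>k\<close>.  With \<open>Y k = E (S (k + m) - S k | F k) / m\<close>, the variables
\<open>D = X (k + 1) + th (k + 1) - th k - Y k\<close> are martingale differences (\<open>D_martingale\<close>).  Hence the sum of
\<open>k\<close> summands differs from a martingale by the boundary terms \<open>th 0 - th k\<close> and by a partial sum of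
\<open>Y\<close>.  The boundary terms are uniformly small on the scale \<open>sqrt n\<close> by the Lindeberg condition
(\<open>negligible_max_th\<close>).  For the sums of \<open>Y\<close> one needs a maximal inequality in mean square, with
predictions of dyadic blocks on the right-hand side.  It is proved by an iterated decomposition into
martingales on coarser and coarser time scales (\<open>dyadic_maximal\<close>).  Applied to \<open>Y\<close>, it has a right-hand
side that is dominated by the Maxwell-Woodroofe series and tends to zero as \<open>m\<close> grows
(\<open>sum_Y_maximal\<close>, \<open>martingale_approximation\<close>).

Squaring the definition of \<open>D\<close> shows that the quadratic variation of the martingale is, up to terms
that vanish when first \<open>n\<close> and then \<open>m\<close> tends to infinity, the sum of the
\<open>X k\<^sup>2 + 2 * X k * \<theta> m k\<close> (\<open>quadratic_variation\<close>).  By hypothesis this is asymptotically linear.  On a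
grid with \<open>K\<close> cells one can therefore choose windows \<open>m n\<close> depending on \<open>n\<close> so that the
approximation error vanishes and the quadratic variations converge at the grid points
(\<open>good_sequence\<close>).  McLeish's argument, which compares the complex exponential with the product of the
\<open>1 + \<i> * D\<close>, then gives convergence of the characteristic functions of the increments over the cells
(\<open>martingale_array_CLT\<close>).  The Stone-Weierstrass theorem with trigonometric polynomials turns this into
convergence of expectations of bounded continuous functions (\<open>finite_dimensional_convergence\<close>).

Tightness uses the same limit: the excursion of the martingale within a cell has a tail controlled by
the first moment of the excess of the increment (\<open>Doob_weak_type\<close>).  First moments converge because second
moments are bounded, and the fourth moment of the normal law makes the limit of order \<open>1 / K\<^sup>2\<close>, so that
all \<open>K\<close> cells together contribute \<open>1 / K\<close> (\<open>far_prob\<close>).  Consequently the path is uniformly close to a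
step path on the grid, and so is the Brownian path.  For Lipschitz test functions on the path space this
suffices, and Lipschitz functions determine convergence in distribution
(\<open>converges_in_distribution_Lipschitz\<close>).
\<close>

section \<open>Square-integrable functions\<close>

definition square_integrable :: "'a measure \<Rightarrow> ('a \<Rightarrow> real) \<Rightarrow> bool" where
  "square_integrable M f \<longleftrightarrow> f \<in> borel_measurable M \<and> integrable M (\<lambda>\<omega>. (f \<omega>)\<^sup>2)"

lemma square_integrable_measurable:
  "square_integrable M f \<Longrightarrow> f \<in> borel_measurable M"
  by (simp add: square_integrable_def)

lemma square_integrable_integrable_power2:
  "square_integrable M f \<Longrightarrow> integrable M (\<lambda>\<omega>. (f \<omega>)\<^sup>2)"
  by (simp add: square_integrable_def)

lemma square_integrable_bound:
  assumes "square_integrable M g" "f \<in> borel_measurable M" "\<And>\<omega>. \<omega> \<in> space M \<Longrightarrow> \<bar>f \<omega>\<bar> \<le> \<bar>g \<omega>\<bar>"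
  shows "square_integrable M f"
  unfolding square_integrable_def
proof
  show "integrable M (\<lambda>\<omega>. (f \<omega>)\<^sup>2)"
    by (rule Bochner_Integration.integrable_bound[OF square_integrable_integrable_power2[OF assms(1)]])
       (use assms in \<open>auto simp: abs_le_square_iff\<close>)
qed (use assms in simp)

lemma square_integrable_cmult:
  "square_integrable M f \<Longrightarrow> square_integrable M (\<lambda>\<omega>. a * f \<omega>)"
  by (auto simp: square_integrable_def power_mult_distrib)

lemma square_integrable_abs:
  "square_integrable M f \<Longrightarrow> square_integrable M (\<lambda>\<omega>. \<bar>f \<omega>\<bar>)"
  by (auto simp: square_integrable_def)

lemma square_integrable_uminus:
  "square_integrable M f \<Longrightarrow> square_integrable M (\<lambda>\<omega>. - f \<omega>)"
  by (auto simp: square_integrable_def)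

lemma square_integrable_add:
  assumes f: "square_integrable M f" and g: "square_integrable M g"
  shows "square_integrable M (\<lambda>\<omega>. f \<omega> + g \<omega>)"
  unfolding square_integrable_def
proof
  note [measurable] = square_integrable_measurable[OF f] square_integrable_measurable[OF g]
  show "(\<lambda>\<omega>. f \<omega> + g \<omega>) \<in> borel_measurable M" by measurable
  have "integrable M (\<lambda>\<omega>. 2 * (f \<omega>)\<^sup>2 + 2 * (g \<omega>)\<^sup>2)"
    using f g by (auto simp: square_integrable_def)
  then show "integrable M (\<lambda>\<omega>. (f \<omega> + g \<omega>)\<^sup>2)"
  proof (rule Bochner_Integration.integrable_bound)
    show "AE \<omega> in M. norm ((f \<omega> + g \<omega>)\<^sup>2) \<le> norm (2 * (f \<omega>)\<^sup>2 + 2 * (g \<omega>)\<^sup>2)"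
    proof (rule AE_I2)
      fix \<omega>
      have "(f \<omega> + g \<omega>)\<^sup>2 \<le> 2 * (f \<omega>)\<^sup>2 + 2 * (g \<omega>)\<^sup>2"
        using sum_squares_bound[of "f \<omega>" "g \<omega>"] by (simp add: power2_sum)
      then show "norm ((f \<omega> + g \<omega>)\<^sup>2) \<le> norm (2 * (f \<omega>)\<^sup>2 + 2 * (g \<omega>)\<^sup>2)" by simp
    qed
  qed measurable
qed

lemma square_integrable_diff:
  assumes f: "square_integrable M f" and g: "square_integrable M g"
  shows "square_integrable M (\<lambda>\<omega>. f \<omega> - g \<omega>)"
  using square_integrable_add[OF f square_integrable_uminus[OF g]] by simp

lemma square_integrable_zero [simp]: "square_integrable M (\<lambda>_. 0)"
  by (simp add: square_integrable_def)

lemma square_integrable_sum: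
  assumes "\<And>i. i \<in> I \<Longrightarrow> square_integrable M (f i)"
  shows "square_integrable M (\<lambda>\<omega>. \<Sum>i\<in>I. f i \<omega>)"
proof (cases "finite I")
  case True
  then show ?thesis using assms
    by (induction I) (auto intro: square_integrable_add)
qed simp

lemma square_integrable_mult:
  assumes f: "square_integrable M f" and g: "square_integrable M g"
  shows "integrable M (\<lambda>\<omega>. f \<omega> * g \<omega>)"
proof -
  note [measurable] = square_integrable_measurable[OF f] square_integrable_measurable[OF g]
  have "integrable M (\<lambda>\<omega>. (f \<omega>)\<^sup>2 + (g \<omega>)\<^sup>2)"
    using f g by (auto simp: square_integrable_def)
  then show ?thesis
  proof (rule Bochner_Integration.integrable_bound)
    show "AE \<omega> in M. norm (f \<omega> * g \<omega>) \<le> norm ((f \<omega>)\<^sup>2 + (g \<omega>)\<^sup>2)"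
    proof (rule AE_I2)
      fix \<omega>
      have "2 * \<bar>f \<omega>\<bar> * \<bar>g \<omega>\<bar> \<le> (f \<omega>)\<^sup>2 + (g \<omega>)\<^sup>2"
        using sum_squares_bound[of "\<bar>f \<omega>\<bar>" "\<bar>g \<omega>\<bar>"] by simp
      moreover have "0 \<le> \<bar>f \<omega>\<bar> * \<bar>g \<omega>\<bar>" by simp
      ultimately have "\<bar>f \<omega>\<bar> * \<bar>g \<omega>\<bar> \<le> (f \<omega>)\<^sup>2 + (g \<omega>)\<^sup>2" by linarith
      then show "norm (f \<omega> * g \<omega>) \<le> norm ((f \<omega>)\<^sup>2 + (g \<omega>)\<^sup>2)"
        by (simp add: abs_mult)
    qed
  qed measurable
qed

text \<open>A predictable weight that is bounded keeps a martingale difference in mean square; this is how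
  stopping and truncation enter later.\<close>

lemma square_integrable_mult_bounded:
  assumes f: "square_integrable M f" and g: "g \<in> borel_measurable M" "\<And>\<omega>. \<bar>g \<omega>\<bar> \<le> B"
  shows "square_integrable M (\<lambda>\<omega>. g \<omega> * f \<omega>)"
proof (rule square_integrable_bound[OF square_integrable_cmult[OF f, of B]])
  show "(\<lambda>\<omega>. g \<omega> * f \<omega>) \<in> borel_measurable M"
    using g square_integrable_measurable[OF f] by measurable
  fix \<omega>
  have "\<bar>g \<omega>\<bar> \<le> \<bar>B\<bar>" using g(2)[of \<omega>] by linarith
  then show "\<bar>g \<omega> * f \<omega>\<bar> \<le> \<bar>B * f \<omega>\<bar>" by (simp add: abs_mult mult_right_mono)
qed

lemma square_integrable_max:
  assumes f: "square_integrable M f" and g: "square_integrable M g"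
  shows "square_integrable M (\<lambda>\<omega>. max (f \<omega>) (g \<omega>))"
proof (rule square_integrable_bound[OF square_integrable_add[OF square_integrable_abs[OF f] square_integrable_abs[OF g]]])
  show "(\<lambda>\<omega>. max (f \<omega>) (g \<omega>)) \<in> borel_measurable M"
    using f g by (auto simp: square_integrable_def)
  show "\<bar>max (f \<omega>) (g \<omega>)\<bar> \<le> \<bar>\<bar>f \<omega>\<bar> + \<bar>g \<omega>\<bar>\<bar>" for \<omega> by linarith
qed

lemma (in prob_space) square_integrable_const: "square_integrable M (\<lambda>_. a)"
  by (simp add: square_integrable_def)

lemma (in prob_space) square_integrable_integrable:
  assumes f: "square_integrable M f" shows "integrable M f"
  using square_integrable_mult[OF f square_integrable_const[of 1]] by simp

lemma L2norm_nonneg [simp]: "0 \<le> L2norm M f"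
  by (simp add: L2norm_def)

lemma L2norm_power2: "(L2norm M f)\<^sup>2 = (LINT \<omega>|M. (f \<omega>)\<^sup>2)"
  by (simp add: L2norm_def)

lemma L2norm_zero [simp]: "L2norm M (\<lambda>_. 0) = 0"
  by (simp add: L2norm_def)

lemma L2norm_cmult: "L2norm M (\<lambda>\<omega>. a * f \<omega>) = \<bar>a\<bar> * L2norm M f"
  by (simp add: L2norm_def power_mult_distrib real_sqrt_mult)

lemma L2norm_uminus: "L2norm M (\<lambda>\<omega>. - f \<omega>) = L2norm M f"
  by (simp add: L2norm_def)

lemma L2norm_abs: "L2norm M (\<lambda>\<omega>. \<bar>f \<omega>\<bar>) = L2norm M f"
  by (simp add: L2norm_def)

lemma L2norm_cong_AE:
  assumes "AE \<omega> in M. f \<omega> = g \<omega>" "f \<in> borel_measurable M" "g \<in> borel_measurable M"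
  shows "L2norm M f = L2norm M g"
  unfolding L2norm_def using assms
  by (subst integral_cong_AE[of _ _ "\<lambda>\<omega>. (g \<omega>)\<^sup>2"]) (auto elim: eventually_mono)

lemma L2norm_mono:
  assumes "square_integrable M g" "f \<in> borel_measurable M" "\<And>\<omega>. \<omega> \<in> space M \<Longrightarrow> \<bar>f \<omega>\<bar> \<le> \<bar>g \<omega>\<bar>"
  shows "L2norm M f \<le> L2norm M g"
  unfolding L2norm_def
proof (rule real_sqrt_le_mono, rule integral_mono)
  show "integrable M (\<lambda>\<omega>. (f \<omega>)\<^sup>2)"
    by (rule square_integrable_integrable_power2[OF square_integrable_bound[OF assms]])
  show "(f \<omega>)\<^sup>2 \<le> (g \<omega>)\<^sup>2" if "\<omega> \<in> space M" for \<omega>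
    using assms(3)[OF that] by (simp add: abs_le_square_iff)
qed (rule square_integrable_integrable_power2[OF assms(1)])

lemma L2norm_mono_AE:
  assumes "square_integrable M g" "square_integrable M f" "AE \<omega> in M. \<bar>f \<omega>\<bar> \<le> \<bar>g \<omega>\<bar>"
  shows "L2norm M f \<le> L2norm M g"
  unfolding L2norm_def
proof (rule real_sqrt_le_mono, rule integral_mono_AE)
  show "AE \<omega> in M. (f \<omega>)\<^sup>2 \<le> (g \<omega>)\<^sup>2"
    using assms(3) by eventually_elim (simp add: abs_le_square_iff)
qed (rule square_integrable_integrable_power2[OF assms(2)], rule square_integrable_integrable_power2[OF assms(1)])

text \<open>The inequality is transferred from nonnegative extended integrals, where no integrability of
  the product has to be known beforehand.\<close>

lemma L2norm_Cauchy_Schwarz: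
  assumes f: "square_integrable M f" and g: "square_integrable M g"
  shows "(LINT \<omega>|M. \<bar>f \<omega> * g \<omega>\<bar>) \<le> L2norm M f * L2norm M g"
proof -
  note [measurable] = square_integrable_measurable[OF f] square_integrable_measurable[OF g]
  have "ennreal (LINT \<omega>|M. \<bar>f \<omega> * g \<omega>\<bar>) = (\<integral>\<^sup>+\<omega>. ennreal \<bar>f \<omega> * g \<omega>\<bar> \<partial>M)"
    using square_integrable_mult[OF f g] by (subst nn_integral_eq_integral) auto
  also have "\<dots> = (\<integral>\<^sup>+\<omega>. ennreal \<bar>f \<omega>\<bar> * ennreal \<bar>g \<omega>\<bar> \<partial>M)"
    by (simp add: ennreal_mult abs_mult)
  finally have "ennreal ((LINT \<omega>|M. \<bar>f \<omega> * g \<omega>\<bar>)\<^sup>2) = (\<integral>\<^sup>+\<omega>. ennreal \<bar>f \<omega>\<bar> * ennreal \<bar>g \<omega>\<bar> \<partial>M)\<^sup>2"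
    by (simp add: ennreal_power[symmetric])
  also have "\<dots> \<le> (\<integral>\<^sup>+\<omega>. (ennreal \<bar>f \<omega>\<bar>)\<^sup>2 \<partial>M) * (\<integral>\<^sup>+\<omega>. (ennreal \<bar>g \<omega>\<bar>)\<^sup>2 \<partial>M)"
    by (rule Cauchy_Schwarz_nn_integral) auto
  also have "\<dots> = ennreal (L2norm M f)^2 * ennreal (L2norm M g)^2"
    using f g by (simp add: ennreal_power nn_integral_eq_integral L2norm_power2 square_integrable_def)
  also have "\<dots> = ennreal ((L2norm M f * L2norm M g)\<^sup>2)"
    by (simp add: ennreal_power power_mult_distrib ennreal_mult)
  finally have "(LINT \<omega>|M. \<bar>f \<omega> * g \<omega>\<bar>)\<^sup>2 \<le> (L2norm M f * L2norm M g)\<^sup>2"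
    by (simp add: ennreal_le_iff)
  then show ?thesis by (rule power2_le_imp_le) simp
qed

lemma L2norm_triangle:
  assumes f: "square_integrable M f" and g: "square_integrable M g"
  shows "L2norm M (\<lambda>\<omega>. f \<omega> + g \<omega>) \<le> L2norm M f + L2norm M g"
proof (rule power2_le_imp_le)
  note int = square_integrable_integrable_power2[OF f] square_integrable_integrable_power2[OF g]
    square_integrable_mult[OF f g]
  have "(L2norm M (\<lambda>\<omega>. f \<omega> + g \<omega>))\<^sup>2 = (LINT \<omega>|M. (f \<omega>)\<^sup>2 + (g \<omega>)\<^sup>2 + 2 * (f \<omega> * g \<omega>))"
    by (simp add: L2norm_power2 power2_sum mult.assoc)
  also have "\<dots> = (L2norm M f)\<^sup>2 + (L2norm M g)\<^sup>2 + 2 * (LINT \<omega>|M. f \<omega> * g \<omega>)"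
    using int by (simp add: L2norm_power2)
  also have "(LINT \<omega>|M. f \<omega> * g \<omega>) \<le> L2norm M f * L2norm M g"
    using L2norm_Cauchy_Schwarz[OF f g] integral_abs_bound[of M "\<lambda>\<omega>. f \<omega> * g \<omega>"] by linarith
  finally show "(L2norm M (\<lambda>\<omega>. f \<omega> + g \<omega>))\<^sup>2 \<le> (L2norm M f + L2norm M g)\<^sup>2"
    by (simp add: power2_sum)
qed simp

lemma L2norm_triangle_diff:
  assumes f: "square_integrable M f" and g: "square_integrable M g"
  shows "L2norm M (\<lambda>\<omega>. f \<omega> - g \<omega>) \<le> L2norm M f + L2norm M g"
  using L2norm_triangle[OF f square_integrable_uminus[OF g]] by (simp add: L2norm_uminus)

lemma L2norm_sum:
  assumes "\<And>i. i \<in> I \<Longrightarrow> square_integrable M (f i)"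
  shows "L2norm M (\<lambda>\<omega>. \<Sum>i\<in>I. f i \<omega>) \<le> (\<Sum>i\<in>I. L2norm M (f i))"
proof (cases "finite I")
  case True
  then show ?thesis using assms
  proof (induction I)
    case (insert i I)
    have "L2norm M (\<lambda>\<omega>. f i \<omega> + (\<Sum>i\<in>I. f i \<omega>)) \<le> L2norm M (f i) + L2norm M (\<lambda>\<omega>. \<Sum>i\<in>I. f i \<omega>)"
      by (intro L2norm_triangle square_integrable_sum) (use insert in auto)
    then show ?case using insert by force
  qed simp
qed simp

lemma (in prob_space) integral_abs_le_L2norm:
  assumes f: "square_integrable M f"
  shows "(LINT \<omega>|M. \<bar>f \<omega>\<bar>) \<le> L2norm M f"
  using L2norm_Cauchy_Schwarz[OF f square_integrable_const[of 1]] by (simp add: L2norm_def prob_space)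

lemma L2norm_Markov:
  assumes "finite_measure M" "square_integrable M f" "a > 0"
  shows "measure M {\<omega>\<in>space M. \<bar>f \<omega>\<bar> \<ge> a} \<le> (L2norm M f)\<^sup>2 / a\<^sup>2"
proof -
  interpret finite_measure M by fact
  note [measurable] = square_integrable_measurable[OF assms(2)]
  have "measure M {\<omega>\<in>space M. \<bar>f \<omega>\<bar> \<ge> a} = measure M {\<omega>\<in>space M. (f \<omega>)\<^sup>2 \<ge> a\<^sup>2}"
    using assms(3) by (intro arg_cong[of _ _ "measure M"]) (auto simp: abs_le_square_iff[symmetric])
  also have "\<dots> \<le> (LINT \<omega>|M. (f \<omega>)\<^sup>2) / a\<^sup>2"
    by (rule integral_Markov_inequality_measure[where A="{}"])
       (use assms(3) in \<open>auto simp: square_integrable_integrable_power2[OF assms(2)]\<close>)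
  finally show ?thesis by (simp add: L2norm_power2)
qed

text \<open>Running maxima of absolute values, the quantities that maximal inequalities control.\<close>

definition runmax :: "(nat \<Rightarrow> 'a \<Rightarrow> real) \<Rightarrow> nat \<Rightarrow> 'a \<Rightarrow> real" where
  "runmax f n \<omega> = Max ((\<lambda>k. \<bar>f k \<omega>\<bar>) ` {..n})"

lemma runmax_0: "runmax f 0 \<omega> = \<bar>f 0 \<omega>\<bar>"
  by (simp add: runmax_def)

lemma runmax_Suc: "runmax f (Suc n) \<omega> = max (runmax f n \<omega>) \<bar>f (Suc n) \<omega>\<bar>"
  unfolding runmax_def by (simp add: atMost_Suc max.commute)

lemma runmax_ge: "k \<le> n \<Longrightarrow> \<bar>f k \<omega>\<bar> \<le> runmax f n \<omega>"
  unfolding runmax_def by (rule Max_ge) auto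

lemma runmax_nonneg: "0 \<le> runmax f n \<omega>"
  using runmax_ge[of 0 n f \<omega>] by linarith

lemma runmax_least: "(\<And>k. k \<le> n \<Longrightarrow> \<bar>f k \<omega>\<bar> \<le> b) \<Longrightarrow> runmax f n \<omega> \<le> b"
  unfolding runmax_def by (subst Max_le_iff) auto

lemma runmax_le_iff: "runmax f n \<omega> \<le> b \<longleftrightarrow> (\<forall>k\<le>n. \<bar>f k \<omega>\<bar> \<le> b)"
  unfolding runmax_def by (subst Max_le_iff) auto

lemma runmax_mono: "m \<le> n \<Longrightarrow> runmax f m \<omega> \<le> runmax f n \<omega>"
  by (rule runmax_least) (auto intro: runmax_ge)

lemma runmax_attained: "\<exists>k\<le>n. runmax f n \<omega> = \<bar>f k \<omega>\<bar>"
proof -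
  have "runmax f n \<omega> \<in> (\<lambda>k. \<bar>f k \<omega>\<bar>) ` {..n}" unfolding runmax_def by (rule Max_in) auto
  then show ?thesis by auto
qed

lemma runmax_measurable:
  assumes "\<And>k. k \<le> n \<Longrightarrow> f k \<in> borel_measurable M"
  shows "runmax f n \<in> borel_measurable M"
  using assms
proof (induction n)
  case 0
  then show ?case by (simp add: runmax_0[abs_def])
next
  case (Suc n)
  have [measurable]: "f (Suc n) \<in> borel_measurable M" "runmax f n \<in> borel_measurable M"
    using Suc by auto
  show ?case by (simp add: runmax_Suc[abs_def])
qed

lemma runmax_square_integrable:
  assumes "\<And>k. k \<le> n \<Longrightarrow> square_integrable M (f k)"
  shows "square_integrable M (runmax f n)"
  using assms
proof (induction n)
  case 0
  then show ?case by (simp add: runmax_0[abs_def] square_integrable_abs)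
next
  case (Suc n)
  then show ?case
    by (simp add: runmax_Suc[abs_def] square_integrable_max square_integrable_abs)
qed

lemma runmax_le_sum_power2: "(runmax f n \<omega>)\<^sup>2 \<le> (\<Sum>k\<le>n. (f k \<omega>)\<^sup>2)"
proof -
  obtain k where k: "k \<le> n" "runmax f n \<omega> = \<bar>f k \<omega>\<bar>" using runmax_attained[of n f \<omega>] by blast
  have "(f k \<omega>)\<^sup>2 \<le> (\<Sum>k\<le>n. (f k \<omega>)\<^sup>2)"
    by (rule member_le_sum) (use k(1) in auto)
  then show ?thesis unfolding k(2) by simp
qed

text \<open>Crude, but sharp enough for the single predictions left over at odd times in the dyadic
  recursion.\<close>

lemma L2norm_runmax_le_sum:
  assumes "\<And>k. k \<le> n \<Longrightarrow> square_integrable M (f k)"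
  shows "(L2norm M (runmax f n))\<^sup>2 \<le> (\<Sum>k\<le>n. (L2norm M (f k))\<^sup>2)"
proof -
  have "(L2norm M (runmax f n))\<^sup>2 \<le> (LINT \<omega>|M. (\<Sum>k\<le>n. (f k \<omega>)\<^sup>2))"
    unfolding L2norm_power2
  proof (rule integral_mono)
    show "integrable M (\<lambda>\<omega>. (runmax f n \<omega>)\<^sup>2)"
      by (rule square_integrable_integrable_power2[OF runmax_square_integrable[OF assms]])
    show "integrable M (\<lambda>\<omega>. \<Sum>k\<le>n. (f k \<omega>)\<^sup>2)"
      by (intro Bochner_Integration.integrable_sum square_integrable_integrable_power2 assms) simp
  qed (rule runmax_le_sum_power2)
  also have "\<dots> = (\<Sum>k\<le>n. (L2norm M (f k))\<^sup>2)"
    unfolding L2norm_power2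
    by (rule Bochner_Integration.integral_sum) (simp add: square_integrable_integrable_power2[OF assms])
  finally show ?thesis .
qed

section \<open>Conditional expectations along a filtration\<close>

locale filtration_space = prob_space M for M :: "'a measure" +
  fixes F :: "nat \<Rightarrow> 'a measure"
  assumes subalg: "\<And>i. subalgebra M (F i)"
    and filtration_mono: "\<And>i j. i \<le> j \<Longrightarrow> sets (F i) \<subseteq> sets (F j)"
begin

abbreviation CE :: "nat \<Rightarrow> ('a \<Rightarrow> real) \<Rightarrow> 'a \<Rightarrow> real" where
  "CE k f \<equiv> real_cond_exp M (F k) f"

lemma sigma_finite_subalgebra_F: "sigma_finite_subalgebra M (F k)"
  by (rule finite_measure_subalgebra_is_sigma_finite) (unfold_locales, rule subalg)

lemma subalgebra_F: "i \<le> j \<Longrightarrow> subalgebra (F j) (F i)"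
  using subalg[of i] subalg[of j] filtration_mono[of i j] by (auto simp: subalgebra_def)

lemma measurable_F_mono: "f \<in> borel_measurable (F i) \<Longrightarrow> i \<le> j \<Longrightarrow> f \<in> borel_measurable (F j)"
  by (rule measurable_from_subalg[OF subalgebra_F])

lemma measurable_F_M: "f \<in> borel_measurable (F i) \<Longrightarrow> f \<in> borel_measurable M"
  by (rule measurable_from_subalg[OF subalg])

lemma CE_power2_le:
  assumes f: "square_integrable M f"
  shows "AE \<omega> in M. (CE k f \<omega>)\<^sup>2 \<le> CE k (\<lambda>\<omega>. (f \<omega>)\<^sup>2) \<omega>"
proof -
  interpret S: sigma_finite_subalgebra M "F k" by (rule sigma_finite_subalgebra_F)
  show ?thesis
    by (rule S.real_cond_exp_jensens_inequality(2)[of f UNIV])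
       (simp_all add: f square_integrable_integrable square_integrable_integrable_power2 convex_power2)
qed

lemma CE_square_integrable:
  assumes f: "square_integrable M f"
  shows "square_integrable M (CE k f)"
proof -
  interpret S: sigma_finite_subalgebra M "F k" by (rule sigma_finite_subalgebra_F)
  have "integrable M (\<lambda>\<omega>. (CE k f \<omega>)\<^sup>2)"
    by (rule S.integrable_convex_cond_exp[of f UNIV])
       (simp_all add: f square_integrable_integrable square_integrable_integrable_power2 convex_power2)
  then show ?thesis by (simp add: square_integrable_def)
qed

lemma CE_L2norm_le:
  assumes f: "square_integrable M f"
  shows "L2norm M (CE k f) \<le> L2norm M f"
proof -
  interpret S: sigma_finite_subalgebra M "F k" by (rule sigma_finite_subalgebra_F)
  have i: "integrable M (\<lambda>\<omega>. (f \<omega>)\<^sup>2)" using f by (rule square_integrable_integrable_power2)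
  have "(LINT \<omega>|M. (CE k f \<omega>)\<^sup>2) \<le> (LINT \<omega>|M. CE k (\<lambda>\<omega>. (f \<omega>)\<^sup>2) \<omega>)"
    by (rule integral_mono_AE[OF _ _ CE_power2_le[OF f]])
       (auto intro: square_integrable_integrable_power2 CE_square_integrable f S.real_cond_exp_int(1) i)
  also have "\<dots> = (LINT \<omega>|M. (f \<omega>)\<^sup>2)" by (rule S.real_cond_exp_int(2)[OF i])
  finally show ?thesis by (simp add: L2norm_def)
qed

lemma CE_integrable: "integrable M f \<Longrightarrow> integrable M (CE k f)"
  using sigma_finite_subalgebra.real_cond_exp_int(1)[OF sigma_finite_subalgebra_F] .

lemma CE_integral: "integrable M f \<Longrightarrow> (LINT \<omega>|M. CE k f \<omega>) = (LINT \<omega>|M. f \<omega>)"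
  using sigma_finite_subalgebra.real_cond_exp_int(2)[OF sigma_finite_subalgebra_F] .

lemma CE_add:
  "integrable M f \<Longrightarrow> integrable M g \<Longrightarrow> AE \<omega> in M. CE k (\<lambda>\<omega>. f \<omega> + g \<omega>) \<omega> = CE k f \<omega> + CE k g \<omega>"
  using sigma_finite_subalgebra.real_cond_exp_add[OF sigma_finite_subalgebra_F] .

lemma CE_diff:
  "integrable M f \<Longrightarrow> integrable M g \<Longrightarrow> AE \<omega> in M. CE k (\<lambda>\<omega>. f \<omega> - g \<omega>) \<omega> = CE k f \<omega> - CE k g \<omega>"
  using sigma_finite_subalgebra.real_cond_exp_diff[OF sigma_finite_subalgebra_F] .

lemma CE_cmult:
  "integrable M f \<Longrightarrow> AE \<omega> in M. CE k (\<lambda>\<omega>. a * f \<omega>) \<omega> = a * CE k f \<omega>"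
  using sigma_finite_subalgebra.real_cond_exp_cmult[OF sigma_finite_subalgebra_F] .

lemma CE_sum:
  assumes "\<And>i. i \<in> I \<Longrightarrow> integrable M (f i)"
  shows "AE \<omega> in M. CE k (\<lambda>\<omega>. \<Sum>i\<in>I. f i \<omega>) \<omega> = (\<Sum>i\<in>I. CE k (f i) \<omega>)"
proof -
  have "AE \<omega> in M. CE k (\<lambda>\<omega>. \<Sum>i\<in>I. (if i \<in> I then f i else (\<lambda>_. 0)) \<omega>) \<omega>
      = (\<Sum>i\<in>I. CE k (if i \<in> I then f i else (\<lambda>_. 0)) \<omega>)"
    by (rule sigma_finite_subalgebra.real_cond_exp_sum[OF sigma_finite_subalgebra_F]) (use assms in auto)
  then show ?thesis by (simp cong: sum.cong)
qed

lemma CE_tower: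
  assumes "i \<le> j" "integrable M f"
  shows "AE \<omega> in M. CE i (CE j f) \<omega> = CE i f \<omega>"
  using sigma_finite_subalgebra.real_cond_exp_nested_subalg[OF sigma_finite_subalgebra_F subalg
      subalgebra_F[OF assms(1)] assms(2)] .

lemma CE_F_meas:
  "integrable M f \<Longrightarrow> f \<in> borel_measurable (F i) \<Longrightarrow> AE \<omega> in M. CE i f \<omega> = f \<omega>"
  by (rule sigma_finite_subalgebra.real_cond_exp_F_meas[OF sigma_finite_subalgebra_F])

text \<open>Less information gives a smaller prediction: by the tower property the earlier prediction is
  a projection of the later one.  All comparisons of predictions made at different times rest on this.\<close>

lemma CE_L2norm_antimono:
  assumes "i \<le> j" and f: "square_integrable M f"
  shows "L2norm M (CE i f) \<le> L2norm M (CE j f)"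
proof -
  have "L2norm M (CE i f) = L2norm M (CE i (CE j f))"
    using CE_tower[OF assms(1) square_integrable_integrable[OF f]]
    by (intro L2norm_cong_AE) auto
  also have "\<dots> \<le> L2norm M (CE j f)" by (intro CE_L2norm_le CE_square_integrable f)
  finally show ?thesis .
qed

lemma integral_mult_CE_zero:
  assumes "Z \<in> borel_measurable (F k)" "integrable M (\<lambda>\<omega>. Z \<omega> * f \<omega>)" "f \<in> borel_measurable M"
    and 0: "AE \<omega> in M. CE k f \<omega> = 0"
  shows "(LINT \<omega>|M. Z \<omega> * f \<omega>) = 0"
proof -
  have "(LINT \<omega>|M. Z \<omega> * f \<omega>) = (LINT \<omega>|M. Z \<omega> * CE k f \<omega>)"
    using sigma_finite_subalgebra.real_cond_exp_intg(2)[OF sigma_finite_subalgebra_F assms(2,1,3)] by simp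
  also have "\<dots> = (LINT \<omega>|M. 0)"
    by (rule integral_cong_AE) (use 0 measurable_F_M[OF assms(1)] in auto)
  finally show ?thesis by simp
qed

text \<open>The increment with index \<open>l\<close> is revealed at time \<open>Suc l\<close>, so that its best prediction is the
  conditional expectation at time \<open>l\<close>.\<close>

definition martingale_diff :: "(nat \<Rightarrow> 'a \<Rightarrow> real) \<Rightarrow> bool" where
  "martingale_diff D \<longleftrightarrow> (\<forall>l. D l \<in> borel_measurable (F (Suc l)) \<and> square_integrable M (D l) \<and>
      (AE \<omega> in M. CE l (D l) \<omega> = 0))"

lemma martingale_diffD:
  assumes "martingale_diff D"
  shows "D l \<in> borel_measurable (F (Suc l))" "square_integrable M (D l)" "AE \<omega> in M. CE l (D l) \<omega> = 0"
    "D l \<in> borel_measurable M"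
  using assms by (auto simp: martingale_diff_def square_integrable_def)

lemma martingale_diff_orthogonal:
  assumes D: "martingale_diff D" and Z: "Z \<in> borel_measurable (F l)" "square_integrable M Z"
  shows "(LINT \<omega>|M. Z \<omega> * D l \<omega>) = 0"
  by (rule integral_mult_CE_zero[OF Z(1)])
     (use martingale_diffD[OF D] square_integrable_mult[OF Z(2)] in auto)

text \<open>Predictable bounded weights cover the three uses below: stopping, truncation of an unbounded
  predictable factor, and the deterministic weights of a linear combination of increments.\<close>

lemma martingale_diff_transform:
  assumes D: "martingale_diff D" and Z: "\<And>l. Z l \<in> borel_measurable (F l)"
    and B: "\<And>l \<omega>. \<bar>Z l \<omega>\<bar> \<le> B"
  shows "martingale_diff (\<lambda>l \<omega>. Z l \<omega> * D l \<omega>)"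
  unfolding martingale_diff_def
proof safe
  fix l
  note d = martingale_diffD[OF D, of l]
  show "(\<lambda>\<omega>. Z l \<omega> * D l \<omega>) \<in> borel_measurable (F (Suc l))"
    using d(1) measurable_F_mono[OF Z[of l], of "Suc l"] by measurable
  show sq: "square_integrable M (\<lambda>\<omega>. Z l \<omega> * D l \<omega>)"
    by (rule square_integrable_mult_bounded[OF d(2) measurable_F_M[OF Z] B])
  have "AE \<omega> in M. CE l (\<lambda>\<omega>. Z l \<omega> * D l \<omega>) \<omega> = Z l \<omega> * CE l (D l) \<omega>"
    by (rule sigma_finite_subalgebra.real_cond_exp_mult[OF sigma_finite_subalgebra_F Z d(4)
          square_integrable_integrable[OF sq]])
  then show "AE \<omega> in M. CE l (\<lambda>\<omega>. Z l \<omega> * D l \<omega>) \<omega> = 0" using d(3) by auto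
qed

text \<open>Restarting at time \<open>a\<close> turns an increment of the martingale over a block into a partial sum
  from zero, to which maximal inequalities apply.\<close>

lemma martingale_diff_shift:
  assumes D: "martingale_diff D"
  shows "filtration_space M (\<lambda>l. F (a + l))"
    "filtration_space.martingale_diff M (\<lambda>l. F (a + l)) (\<lambda>l. D (a + l))"
proof -
  interpret G: filtration_space M "\<lambda>l. F (a + l)"
    by unfold_locales (simp_all add: subalg filtration_mono)
  show "filtration_space M (\<lambda>l. F (a + l))" by (rule G.filtration_space_axioms)
  show "G.martingale_diff (\<lambda>l. D (a + l))"
    unfolding G.martingale_diff_def using martingale_diffD[OF D] by simp
qed

lemma martingale_measurable:
  assumes D: "martingale_diff D" and "k \<le> n"
  shows "(\<lambda>\<omega>. \<Sum>l<k. D l \<omega>) \<in> borel_measurable (F n)"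
proof (rule borel_measurable_sum)
  fix l assume "l \<in> {..<k}"
  then show "D l \<in> borel_measurable (F n)"
    using measurable_F_mono[OF martingale_diffD(1)[OF D, of l], of n] assms(2) by auto
qed

lemma martingale_square_integrable:
  "martingale_diff D \<Longrightarrow> square_integrable M (\<lambda>\<omega>. \<Sum>l<k. D l \<omega>)"
  by (intro square_integrable_sum martingale_diffD)

lemma martingale_L2norm:
  assumes D: "martingale_diff D"
  shows "(L2norm M (\<lambda>\<omega>. \<Sum>l<n. D l \<omega>))\<^sup>2 = (\<Sum>l<n. (L2norm M (D l))\<^sup>2)"
proof (induction n)
  case (Suc n)
  let ?S = "\<lambda>\<omega>. \<Sum>l<n. D l \<omega>"
  note sq = martingale_square_integrable[OF D, of n] martingale_diffD(2)[OF D, of n]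
  have "(L2norm M (\<lambda>\<omega>. \<Sum>l<Suc n. D l \<omega>))\<^sup>2 = (LINT \<omega>|M. (?S \<omega>)\<^sup>2 + (D n \<omega>)\<^sup>2 + 2 * (?S \<omega> * D n \<omega>))"
    by (simp add: L2norm_power2 power2_sum mult.assoc)
  also have "\<dots> = (L2norm M ?S)\<^sup>2 + (L2norm M (D n))\<^sup>2 + 2 * (LINT \<omega>|M. ?S \<omega> * D n \<omega>)"
    using square_integrable_mult[OF sq] square_integrable_integrable_power2[OF sq(1)]
      square_integrable_integrable_power2[OF sq(2)]
    by (simp add: L2norm_power2)
  also have "(LINT \<omega>|M. ?S \<omega> * D n \<omega>) = 0"
    by (rule martingale_diff_orthogonal[OF D martingale_measurable[OF D] sq(1)]) simp
  finally show ?case using Suc by simp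
qed simp

end

section \<open>Doob's maximal inequalities\<close>

lemma abs_diff_ge_sgn: "sgn x * (y - x) \<le> \<bar>y\<bar> - \<bar>x\<bar>" for x y :: real
  by (simp add: sgn_if abs_if)

text \<open>The pathwise form of Doob's inequality in mean square: the sum on the right is a martingale
  transform, so that it disappears under the expectation.\<close>

lemma runmax_power2_le:
  fixes m :: "nat \<Rightarrow> 'a \<Rightarrow> real"
  shows "(runmax m n \<omega>)\<^sup>2 / 2 \<le> runmax m n \<omega> * \<bar>m n \<omega>\<bar>
    - (\<Sum>k<n. runmax m k \<omega> * sgn (m k \<omega>) * (m (Suc k) \<omega> - m k \<omega>))"
proof (induction n)
  case 0
  then show ?case by (simp add: runmax_0 power2_eq_square)
next
  case (Suc n)
  let ?s = "\<Sum>k<n. runmax m k \<omega> * sgn (m k \<omega>) * (m (Suc k) \<omega> - m k \<omega>)"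
  let ?S = "runmax m n \<omega>" and ?x = "\<bar>m n \<omega>\<bar>" and ?x' = "\<bar>m (Suc n) \<omega>\<bar>"
  let ?d = "sgn (m n \<omega>) * (m (Suc n) \<omega> - m n \<omega>)"
  have d: "?S * ?d \<le> ?S * (?x' - ?x)"
    by (intro mult_left_mono abs_diff_ge_sgn runmax_nonneg)
  have sum: "(\<Sum>k<Suc n. runmax m k \<omega> * sgn (m k \<omega>) * (m (Suc k) \<omega> - m k \<omega>)) = ?s + ?S * ?d"
    by (simp add: mult.assoc)
  show ?case
  proof (cases "?x' \<le> ?S")
    case True
    then have "runmax m (Suc n) \<omega> = ?S" by (simp add: runmax_Suc)
    then show ?thesis using Suc d unfolding sum by (simp add: algebra_simps)
  next
    case False
    then have S: "runmax m (Suc n) \<omega> = ?x'" by (simp add: runmax_Suc)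
    have "0 \<le> (?x' - ?S)\<^sup>2" by simp
    then have "?x' * ?S \<le> ?x'\<^sup>2 / 2 + ?S\<^sup>2 / 2" by (simp add: power2_diff field_simps)
    then show ?thesis using Suc d unfolding sum S by (simp add: algebra_simps power2_eq_square)
  qed
qed

text \<open>After the first time at which \<open>\<bar>m\<bar>\<close> reaches \<open>2 * \<kappa>\<close> one holds the convex function
  \<open>max (\<bar>x\<bar> - \<kappa>) 0\<close>, which is worth at least \<open>\<kappa>\<close> then, and it changes by at least its subgradient
  times the increment.  The sum is a transform with bounded weights and has mean zero for a martingale.\<close>

lemma weak_maximal_pathwise:
  fixes m :: "nat \<Rightarrow> 'a \<Rightarrow> real" and \<kappa> :: real and \<omega> :: 'a
  assumes "\<kappa> > 0"
  defines "x \<equiv> \<lambda>k. max (\<bar>m k \<omega>\<bar> - \<kappa>) 0"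
  defines "A \<equiv> \<lambda>k. of_bool (runmax m k \<omega> \<ge> 2 * \<kappa>) :: real"
  shows "\<kappa> * A n \<le> x n * A n
    - (\<Sum>k<n. A k * (of_bool (\<bar>m k \<omega>\<bar> > \<kappa>) * sgn (m k \<omega>)) * (m (Suc k) \<omega> - m k \<omega>))"
proof (induction n)
  case 0
  then show ?case using assms by (auto simp: runmax_0)
next
  case (Suc n)
  let ?s = "\<Sum>k<n. A k * (of_bool (\<bar>m k \<omega>\<bar> > \<kappa>) * sgn (m k \<omega>)) * (m (Suc k) \<omega> - m k \<omega>)"
  let ?d = "(of_bool (\<bar>m n \<omega>\<bar> > \<kappa>) * sgn (m n \<omega>)) * (m (Suc n) \<omega> - m n \<omega>)"
  have d: "?d \<le> x (Suc n) - x n"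
    using abs_diff_ge_sgn[of "m n \<omega>" "m (Suc n) \<omega>"] unfolding x_def by (auto simp: max_def)
  show ?case
  proof (cases "runmax m n \<omega> \<ge> 2 * \<kappa>")
    case True
    then have "A n = 1" "A (Suc n) = 1" by (auto simp: A_def runmax_Suc)
    then show ?thesis using Suc d by simp
  next
    case False
    then have A: "A n = 0" by (simp add: A_def)
    then have s: "?s \<le> 0" using Suc by simp
    show ?thesis
    proof (cases "A (Suc n) = 0")
      case True then show ?thesis using s A by simp
    next
      case F2: False
      then have "A (Suc n) = 1" "2 * \<kappa> \<le> \<bar>m (Suc n) \<omega>\<bar>" using False by (auto simp: A_def runmax_Suc)
      then show ?thesis using s A by (simp add: x_def)
    qed
  qed
qed

context filtration_space
begin

lemma runmax_martingale_measurable: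
  assumes D: "martingale_diff D"
  shows "runmax (\<lambda>k \<omega>. \<Sum>l<k. D l \<omega>) n \<in> borel_measurable (F n)"
  by (rule runmax_measurable) (use martingale_measurable[OF D] in auto)

text \<open>Integrating the pathwise bound leaves \<open>s\<^sup>2 / 2 \<le> E (max * \<bar>endpoint\<bar>)\<close>, and Cauchy-Schwarz
  cancels one factor \<open>s\<close>.\<close>

lemma Doob_L2:
  assumes D: "martingale_diff D"
  shows "L2norm M (runmax (\<lambda>k \<omega>. \<Sum>l<k. D l \<omega>) n) \<le> 2 * L2norm M (\<lambda>\<omega>. \<Sum>l<n. D l \<omega>)"
proof -
  let ?m = "\<lambda>k \<omega>. \<Sum>l<k. D l \<omega>"
  have m: "square_integrable M (?m k)" for k by (rule martingale_square_integrable[OF D])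
  have S: "square_integrable M (runmax ?m k)" for k by (rule runmax_square_integrable[OF m])
  have [measurable]: "?m k \<in> borel_measurable (F k)" "runmax ?m k \<in> borel_measurable (F k)" for k
    by (simp_all add: martingale_measurable[OF D] runmax_martingale_measurable[OF D])
  define Z where "Z k \<omega> = runmax ?m k \<omega> * sgn (?m k \<omega>)" for k \<omega>
  have Zm: "Z k \<in> borel_measurable (F k)" for k unfolding Z_def by measurable
  have Z: "square_integrable M (Z k)" for k
  proof (rule square_integrable_bound[OF S measurable_F_M[OF Zm]])
    show "\<bar>Z k \<omega>\<bar> \<le> \<bar>runmax ?m k \<omega>\<bar>" for \<omega> by (simp add: Z_def abs_mult sgn_if)
  qed
  have int: "integrable M (\<lambda>\<omega>. Z k \<omega> * D k \<omega>)" for k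
    by (rule square_integrable_mult[OF Z martingale_diffD(2)[OF D]])
  let ?s = "L2norm M (runmax ?m n)"
  have "?s\<^sup>2 / 2 = (LINT \<omega>|M. (runmax ?m n \<omega>)\<^sup>2 / 2)"
    by (simp add: L2norm_power2)
  also have "\<dots> \<le> (LINT \<omega>|M. runmax ?m n \<omega> * \<bar>?m n \<omega>\<bar> - (\<Sum>k<n. Z k \<omega> * D k \<omega>))"
  proof (rule integral_mono)
    show "integrable M (\<lambda>\<omega>. (runmax ?m n \<omega>)\<^sup>2 / 2)"
      using square_integrable_integrable_power2[OF S] by simp
    show "integrable M (\<lambda>\<omega>. runmax ?m n \<omega> * \<bar>?m n \<omega>\<bar> - (\<Sum>k<n. Z k \<omega> * D k \<omega>))"
      by (intro Bochner_Integration.integrable_diff Bochner_Integration.integrable_sum int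
          square_integrable_mult S square_integrable_abs m)
    show "(runmax ?m n \<omega>)\<^sup>2 / 2 \<le> runmax ?m n \<omega> * \<bar>?m n \<omega>\<bar> - (\<Sum>k<n. Z k \<omega> * D k \<omega>)" for \<omega>
      using runmax_power2_le[of ?m n \<omega>] by (simp add: Z_def)
  qed
  also have "\<dots> = (LINT \<omega>|M. runmax ?m n \<omega> * \<bar>?m n \<omega>\<bar>) - (\<Sum>k<n. LINT \<omega>|M. Z k \<omega> * D k \<omega>)"
    using int square_integrable_mult[OF S[of n] square_integrable_abs[OF m[of n]]]
    by (subst Bochner_Integration.integral_diff) (auto intro!: Bochner_Integration.integrable_sum Bochner_Integration.integral_sum)
  also have "(\<Sum>k<n. LINT \<omega>|M. Z k \<omega> * D k \<omega>) = 0"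
    using martingale_diff_orthogonal[OF D Zm Z] by simp
  also have "(LINT \<omega>|M. runmax ?m n \<omega> * \<bar>?m n \<omega>\<bar>) \<le> (LINT \<omega>|M. \<bar>runmax ?m n \<omega> * ?m n \<omega>\<bar>)"
    by (simp add: abs_mult abs_of_nonneg[OF runmax_nonneg])
  also have "\<dots> \<le> ?s * L2norm M (?m n)" by (rule L2norm_Cauchy_Schwarz[OF S m])
  finally have "?s * ?s \<le> ?s * (2 * L2norm M (?m n))" by (simp add: power2_eq_square)
  then show ?thesis
    by (cases "?s = 0") (use L2norm_nonneg[of M "runmax ?m n"] in \<open>auto simp: mult_le_cancel_left\<close>)
qed

lemma martingale_maximal_L2:
  assumes D: "martingale_diff D"
  shows "L2norm M (runmax (\<lambda>k \<omega>. \<Sum>l<k. D l \<omega>) n) \<le> 2 * sqrt (\<Sum>l<n. (L2norm M (D l))\<^sup>2)"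
  using Doob_L2[OF D, of n] by (simp add: martingale_L2norm[OF D, symmetric])

text \<open>The right-hand side involves only the first moment of the endpoint.  This is what makes the
  bound useful for tightness: first moments are uniformly integrable as soon as second moments
  are bounded.\<close>

lemma Doob_weak_type:
  assumes D: "martingale_diff D" and l: "\<kappa> > 0"
  shows "measure M {\<omega>\<in>space M. runmax (\<lambda>k \<omega>. \<Sum>l<k. D l \<omega>) n \<omega> \<ge> 2 * \<kappa>}
    \<le> (LINT \<omega>|M. max (\<bar>\<Sum>l<n. D l \<omega>\<bar> - \<kappa>) 0) / \<kappa>"
proof -
  let ?m = "\<lambda>k \<omega>. \<Sum>l<k. D l \<omega>"
  let ?x = "\<lambda>\<omega>. max (\<bar>?m n \<omega>\<bar> - \<kappa>) 0"
  define A where "A k \<omega> = (of_bool (runmax ?m k \<omega> \<ge> 2 * \<kappa>) :: real)" for k \<omega>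
  have [measurable]: "?m k \<in> borel_measurable (F k)" "runmax ?m k \<in> borel_measurable (F k)" for k
    by (simp_all add: martingale_measurable[OF D] runmax_martingale_measurable[OF D])
  have [measurable]: "?m k \<in> borel_measurable M" "runmax ?m k \<in> borel_measurable M" for k
    using measurable_F_M[OF martingale_measurable[OF D order_refl], of k]
      measurable_F_M[OF runmax_martingale_measurable[OF D, of k]] by simp_all
  define Z where "Z k \<omega> = A k \<omega> * (of_bool (\<bar>?m k \<omega>\<bar> > \<kappa>) * sgn (?m k \<omega>))" for k \<omega>
  have Zm: "Z k \<in> borel_measurable (F k)" for k unfolding Z_def A_def by measurable
  have Zb: "\<bar>Z k \<omega>\<bar> \<le> 1" for k \<omega> by (simp add: Z_def A_def sgn_if)
  have Z: "square_integrable M (Z k)" for k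
    by (rule square_integrable_bound[OF square_integrable_const[of 1] measurable_F_M[OF Zm]])
       (simp add: Zb)
  have int: "integrable M (\<lambda>\<omega>. Z k \<omega> * D k \<omega>)" for k
    by (rule square_integrable_mult[OF Z martingale_diffD(2)[OF D]])
  have xint: "integrable M ?x"
    by (intro square_integrable_integrable square_integrable_max square_integrable_diff
        square_integrable_abs martingale_square_integrable[OF D] square_integrable_const)
  have "\<kappa> * measure M {\<omega>\<in>space M. runmax ?m n \<omega> \<ge> 2 * \<kappa>}
      = (LINT \<omega>|M. \<kappa> * indicator {\<omega>\<in>space M. runmax ?m n \<omega> \<ge> 2 * \<kappa>} \<omega>)"
    by simp
  also have "\<dots> \<le> (LINT \<omega>|M. ?x \<omega> - (\<Sum>k<n. Z k \<omega> * D k \<omega>))"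
  proof (rule integral_mono)
    show "integrable M (\<lambda>\<omega>. \<kappa> * indicator {\<omega>\<in>space M. runmax ?m n \<omega> \<ge> 2 * \<kappa>} \<omega>)"
      by (intro integrable_mult_right integrable_real_indicator) (auto simp: emeasure_eq_measure)
    show "integrable M (\<lambda>\<omega>. ?x \<omega> - (\<Sum>k<n. Z k \<omega> * D k \<omega>))"
      by (intro Bochner_Integration.integrable_diff Bochner_Integration.integrable_sum int xint)
    fix \<omega> assume \<omega>: "\<omega> \<in> space M"
    have "\<kappa> * A n \<omega> \<le> ?x \<omega> * A n \<omega> - (\<Sum>k<n. Z k \<omega> * D k \<omega>)"
      using weak_maximal_pathwise[OF l, where m="?m" and \<omega>=\<omega> and n=n] by (simp add: A_def Z_def)
    moreover have "?x \<omega> * A n \<omega> \<le> ?x \<omega>" by (simp add: A_def)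
    ultimately show "\<kappa> * indicator {\<omega>\<in>space M. runmax ?m n \<omega> \<ge> 2 * \<kappa>} \<omega>
        \<le> ?x \<omega> - (\<Sum>k<n. Z k \<omega> * D k \<omega>)"
      using \<omega> by (simp add: A_def indicator_def)
  qed
  also have "\<dots> = (LINT \<omega>|M. ?x \<omega>) - (\<Sum>k<n. LINT \<omega>|M. Z k \<omega> * D k \<omega>)"
    using int xint
    by (subst Bochner_Integration.integral_diff) (auto intro!: Bochner_Integration.integrable_sum Bochner_Integration.integral_sum)
  also have "(\<Sum>k<n. LINT \<omega>|M. Z k \<omega> * D k \<omega>) = 0"
    using martingale_diff_orthogonal[OF D Zm Z] by simp
  finally show ?thesis using l by (simp add: field_simps)
qed

end

section \<open>A dyadic maximal inequality\<close>

context filtration_space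
begin

text \<open>The conditional expectation is an orthogonal projection.\<close>

lemma L2norm_diff_CE_le:
  assumes f: "square_integrable M f"
  shows "L2norm M (\<lambda>\<omega>. f \<omega> - CE k f \<omega>) \<le> L2norm M f"
proof (rule power2_le_imp_le)
  let ?g = "CE k f"
  have g: "square_integrable M ?g" by (rule CE_square_integrable[OF f])
  have orth: "(LINT \<omega>|M. ?g \<omega> * f \<omega>) = (LINT \<omega>|M. ?g \<omega> * ?g \<omega>)"
    using sigma_finite_subalgebra.real_cond_exp_intg(2)[OF sigma_finite_subalgebra_F
        square_integrable_mult[OF g f]] f by (simp add: square_integrable_def)
  have "(L2norm M (\<lambda>\<omega>. f \<omega> - ?g \<omega>))\<^sup>2
      = (LINT \<omega>|M. (f \<omega>)\<^sup>2 + (?g \<omega> * ?g \<omega>) - 2 * (?g \<omega> * f \<omega>))"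
    unfolding L2norm_power2
    by (rule Bochner_Integration.integral_cong) (auto simp: power2_eq_square algebra_simps)
  also have "\<dots> = (L2norm M f)\<^sup>2 - (LINT \<omega>|M. ?g \<omega> * ?g \<omega>)"
    using orth square_integrable_integrable_power2[OF f] square_integrable_mult[OF g g]
      square_integrable_mult[OF g f] by (simp add: L2norm_power2)
  also have "\<dots> \<le> (L2norm M f)\<^sup>2" by simp
  finally show "(L2norm M (\<lambda>\<omega>. f \<omega> - ?g \<omega>))\<^sup>2 \<le> (L2norm M f)\<^sup>2" .
qed simp

end

lemma atLeastLessThan_halves:
  "(\<Sum>s\<in>{l * 2 ^ Suc j..<Suc l * 2 ^ Suc j}. z s) =
    (\<Sum>s\<in>{2 * l * 2 ^ j..<Suc (2 * l) * 2 ^ j}. z s) + (\<Sum>s\<in>{Suc (2 * l) * 2 ^ j..<Suc (Suc (2 * l)) * 2 ^ j}. z s)"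
  for z :: "nat \<Rightarrow> real"
proof -
  have "l * 2 ^ Suc j = 2 * l * 2 ^ j" "Suc l * 2 ^ Suc j = Suc (Suc (2 * l)) * 2 ^ j" by simp_all
  then show ?thesis
    by (simp only:) (rule sum.atLeastLessThan_concat[symmetric], simp_all)
qed

text \<open>The number \<open>e j\<close> bounds the prediction that can be made of a block of length \<open>2 ^ j\<close> at its
  start, uniformly over the position of the block.  Other lengths are reached through binary
  expansions.\<close>

locale adapted_process = filtration_space M F for M :: "'a measure" and F +
  fixes Z :: "nat \<Rightarrow> 'a \<Rightarrow> real" and e :: "nat \<Rightarrow> real"
  assumes Z_measurable: "\<And>l. Z l \<in> borel_measurable (F (Suc l))"
    and Z_square_integrable: "\<And>l. square_integrable M (Z l)"
    and Z_predict: "\<And>i j. L2norm M (CE i (\<lambda>\<omega>. \<Sum>l\<in>{i..<i + 2 ^ j}. Z l \<omega>)) \<le> e j"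
begin

abbreviation blk :: "nat \<Rightarrow> nat \<Rightarrow> 'a \<Rightarrow> real" where
  "blk j l \<equiv> \<lambda>\<omega>. \<Sum>s\<in>{l * 2 ^ j..<Suc l * 2 ^ j}. Z s \<omega>"

definition predicted :: "nat \<Rightarrow> nat \<Rightarrow> 'a \<Rightarrow> real" where
  "predicted j l = CE (l * 2 ^ j) (blk j l)"

definition innov :: "nat \<Rightarrow> nat \<Rightarrow> 'a \<Rightarrow> real" where
  "innov j l = (\<lambda>\<omega>. predicted j (Suc (2 * l)) \<omega> - CE (2 * l * 2 ^ j) (predicted j (Suc (2 * l))) \<omega>)"

lemma blk_square_integrable: "square_integrable M (blk j l)"
  by (intro square_integrable_sum Z_square_integrable)

lemma predicted_square_integrable: "square_integrable M (predicted j l)"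
  unfolding predicted_def by (intro CE_square_integrable blk_square_integrable)

lemma innov_square_integrable: "square_integrable M (innov j l)"
  unfolding innov_def by (intro square_integrable_diff CE_square_integrable predicted_square_integrable)

lemma e_nonneg: "0 \<le> e j"
  using Z_predict[of 0 j] L2norm_nonneg order_trans by blast

lemma L2norm_predicted: "L2norm M (predicted j l) \<le> e j"
  using Z_predict[of "l * 2 ^ j" j] by (simp add: predicted_def add.commute)

lemma L2norm_innov: "L2norm M (innov j l) \<le> e j"
  unfolding innov_def using L2norm_diff_CE_le[OF predicted_square_integrable] L2norm_predicted order_trans by blast

lemma innov_martingale:
  "filtration_space M (\<lambda>l. F (l * 2 ^ Suc j))"
  "filtration_space.martingale_diff M (\<lambda>l. F (l * 2 ^ Suc j)) (innov j)"
proof -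
  interpret G: filtration_space M "\<lambda>l. F (l * 2 ^ Suc j)"
    by unfold_locales (simp_all add: subalg filtration_mono)
  show "filtration_space M (\<lambda>l. F (l * 2 ^ Suc j))" by (rule G.filtration_space_axioms)
  show "G.martingale_diff (innov j)"
    unfolding G.martingale_diff_def
  proof (intro allI conjI)
    fix l :: nat
    let ?i = "2 * l * 2 ^ j"
    have i: "?i = l * 2 ^ Suc j" by simp
    have [measurable]: "predicted j (Suc (2 * l)) \<in> borel_measurable (F (Suc l * 2 ^ Suc j))"
      unfolding predicted_def
      by (rule measurable_F_mono[OF borel_measurable_cond_exp]) simp
    have [measurable]: "CE ?i (predicted j (Suc (2 * l))) \<in> borel_measurable (F (Suc l * 2 ^ Suc j))"
      by (rule measurable_F_mono[OF borel_measurable_cond_exp]) simp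
    show "innov j l \<in> borel_measurable (F (Suc l * 2 ^ Suc j))"
      unfolding innov_def by measurable
    show "square_integrable M (innov j l)" by (rule innov_square_integrable)
    have p: "integrable M (predicted j (Suc (2 * l)))" "integrable M (CE ?i (predicted j (Suc (2 * l))))"
      by (intro square_integrable_integrable predicted_square_integrable CE_square_integrable)+
    have "AE \<omega> in M. CE ?i (innov j l) \<omega> =
        CE ?i (predicted j (Suc (2 * l))) \<omega> - CE ?i (CE ?i (predicted j (Suc (2 * l)))) \<omega>"
      unfolding innov_def by (rule CE_diff[OF p])
    moreover have "AE \<omega> in M. CE ?i (CE ?i (predicted j (Suc (2 * l)))) \<omega> = CE ?i (predicted j (Suc (2 * l))) \<omega>"
      by (rule CE_F_meas[OF p(2)]) simp
    ultimately have "AE \<omega> in M. CE ?i (innov j l) \<omega> = 0" by eventually_elim simp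
    then show "AE \<omega> in M. CE (l * 2 ^ Suc j) (innov j l) \<omega> = 0" unfolding i .
  qed
qed

text \<open>Two neighbouring blocks are predicted separately on the left and jointly on the right.  The
  difference is what is learnt about the second block while the first one is revealed, hence a
  martingale difference on the coarser time scale.\<close>

lemma predicted_refine:
  "AE \<omega> in M. predicted j (2 * l) \<omega> + predicted j (Suc (2 * l)) \<omega> = predicted (Suc j) l \<omega> + innov j l \<omega>"
proof -
  let ?i = "2 * l * 2 ^ j" and ?k = "Suc (2 * l) * 2 ^ j"
  have int: "integrable M (blk j l)" for j l
    by (rule square_integrable_integrable[OF blk_square_integrable])
  have i: "l * 2 ^ Suc j = ?i" by simp
  have "blk (Suc j) l = (\<lambda>\<omega>. blk j (2 * l) \<omega> + blk j (Suc (2 * l)) \<omega>)"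
    by (rule ext, rule atLeastLessThan_halves)
  then have "predicted (Suc j) l = CE ?i (\<lambda>\<omega>. blk j (2 * l) \<omega> + blk j (Suc (2 * l)) \<omega>)"
    by (simp only: predicted_def i)
  then have "AE \<omega> in M. predicted (Suc j) l \<omega> = CE ?i (blk j (2 * l)) \<omega> + CE ?i (blk j (Suc (2 * l))) \<omega>"
    by (simp only: CE_add[OF int int])
  moreover have "AE \<omega> in M. CE ?i (CE ?k (blk j (Suc (2 * l)))) \<omega> = CE ?i (blk j (Suc (2 * l))) \<omega>"
    by (rule CE_tower[OF _ int]) simp
  ultimately show ?thesis
    unfolding innov_def predicted_def[of j] by eventually_elim simp
qed

definition psums :: "nat \<Rightarrow> nat \<Rightarrow> 'a \<Rightarrow> real" where
  "psums j k \<omega> = (\<Sum>l<k. predicted j l \<omega>)"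

lemma psums_square_integrable: "square_integrable M (psums j k)"
  unfolding psums_def[abs_def] by (intro square_integrable_sum predicted_square_integrable)

text \<open>At even times the level \<open>j\<close> sums are level \<open>Suc j\<close> sums plus a martingale; an odd time
  costs one more summand.\<close>

lemma psums_step:
  assumes "N \<ge> 1"
  shows "L2norm M (runmax (psums j) (2 * N)) \<le> 3 * sqrt (real N) * e j + L2norm M (runmax (psums (Suc j)) N)"
proof -
  interpret G: filtration_space M "\<lambda>l. F (l * 2 ^ Suc j)" by (rule innov_martingale(1))
  have D: "G.martingale_diff (innov j)" by (rule innov_martingale(2))
  let ?m = "\<lambda>k \<omega>. \<Sum>l<k. innov j l \<omega>"
  let ?e = "\<lambda>l. predicted j (2 * l)"
  have sq: "square_integrable M (runmax ?m N)" "square_integrable M (runmax (psums j) k)"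
    "square_integrable M (runmax ?e (N - 1))" for j k
    by (intro runmax_square_integrable square_integrable_sum innov_square_integrable
      psums_square_integrable predicted_square_integrable)+
  have "AE \<omega> in M. \<forall>l. predicted j (2 * l) \<omega> + predicted j (Suc (2 * l)) \<omega> = predicted (Suc j) l \<omega> + innov j l \<omega>"
    using predicted_refine by (simp add: AE_all_countable)
  then have "AE \<omega> in M. \<bar>runmax (psums j) (2 * N) \<omega>\<bar>
      \<le> \<bar>(runmax ?m N \<omega> + runmax (psums (Suc j)) N \<omega>) + runmax ?e (N - 1) \<omega>\<bar>"
  proof eventually_elim
    case (elim \<omega>)
    have even: "psums j (2 * k) \<omega> = ?m k \<omega> + psums (Suc j) k \<omega>" for k
    proof (induction k)
      case (Suc k)
      then show ?case using elim[rule_format, of k] by (simp add: psums_def)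
    qed (simp add: psums_def)
    have bound: "\<bar>psums j (2 * k) \<omega>\<bar> \<le> runmax ?m N \<omega> + runmax (psums (Suc j)) N \<omega>" if "k \<le> N" for k
      using runmax_ge[OF that, of ?m \<omega>] runmax_ge[OF that, of "psums (Suc j)" \<omega>] unfolding even by linarith
    have "runmax (psums j) (2 * N) \<omega>
      \<le> (runmax ?m N \<omega> + runmax (psums (Suc j)) N \<omega>) + runmax ?e (N - 1) \<omega>"
    proof (rule runmax_least)
      fix k assume k: "k \<le> 2 * N"
      show "\<bar>psums j k \<omega>\<bar> \<le> (runmax ?m N \<omega> + runmax (psums (Suc j)) N \<omega>) + runmax ?e (N - 1) \<omega>"
      proof (cases "even k")
        case True
        then obtain i where "k = 2 * i" by blast
        then show ?thesis using bound[of i] k runmax_nonneg[of ?e "N - 1" \<omega>] by simp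
      next
        case False
        then obtain i where i: "k = Suc (2 * i)" using oddE by fastforce
        then have "psums j k \<omega> = psums j (2 * i) \<omega> + predicted j (2 * i) \<omega>" by (simp add: psums_def)
        moreover have "\<bar>predicted j (2 * i) \<omega>\<bar> \<le> runmax ?e (N - 1) \<omega>"
          by (rule runmax_ge) (use i k in linarith)
        moreover have "i \<le> N" using i k by linarith
        ultimately show ?thesis using bound[of i] by linarith
      qed
    qed
    then show ?case by (simp add: abs_of_nonneg[OF runmax_nonneg])
  qed
  then have "L2norm M (runmax (psums j) (2 * N))
      \<le> L2norm M (\<lambda>\<omega>. (runmax ?m N \<omega> + runmax (psums (Suc j)) N \<omega>) + runmax ?e (N - 1) \<omega>)"
    by (intro L2norm_mono_AE square_integrable_add sq)
  also have "\<dots> \<le> (L2norm M (runmax ?m N) + L2norm M (runmax (psums (Suc j)) N)) + L2norm M (runmax ?e (N - 1))"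
    by (intro order_trans[OF L2norm_triangle] add_mono L2norm_triangle square_integrable_add sq order_refl)
  also have "L2norm M (runmax ?m N) \<le> 2 * (sqrt (real N) * e j)"
  proof -
    have "L2norm M (runmax ?m N) \<le> 2 * sqrt (\<Sum>l<N. (L2norm M (innov j l))\<^sup>2)"
      by (rule G.martingale_maximal_L2[OF D])
    also have "(\<Sum>l<N. (L2norm M (innov j l))\<^sup>2) \<le> (\<Sum>l<N. (e j)\<^sup>2)"
      by (intro sum_mono power_mono L2norm_innov) simp
    finally show ?thesis by (simp add: real_sqrt_mult e_nonneg)
  qed
  also have "L2norm M (runmax ?e (N - 1)) \<le> sqrt (real N) * e j"
  proof (rule power2_le_imp_le)
    have "(L2norm M (runmax ?e (N - 1)))\<^sup>2 \<le> (\<Sum>l\<le>N - 1. (L2norm M (?e l))\<^sup>2)"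
      by (rule L2norm_runmax_le_sum[OF predicted_square_integrable])
    also have "\<dots> \<le> (\<Sum>l\<le>N - 1. (e j)\<^sup>2)"
      by (intro sum_mono power_mono L2norm_predicted) simp
    finally show "(L2norm M (runmax ?e (N - 1)))\<^sup>2 \<le> (sqrt (real N) * e j)\<^sup>2"
      using assms by (simp add: power_mult_distrib)
  qed (simp add: e_nonneg)
  finally show ?thesis by (simp add: algebra_simps)
qed

text \<open>Iterating the step from level \<open>j\<close> upwards ends with a single block.  Level \<open>j + s\<close> has
  \<open>2 ^ (i - s)\<close> summands of norm at most \<open>e (j + s)\<close>, and orthogonality makes them count only with the
  square root of their number.\<close>

lemma psums_maximal:
  "L2norm M (runmax (psums j) (2 ^ i)) \<le> 3 * (\<Sum>s\<le>i. sqrt 2 ^ (i - s) * e (j + s))"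
proof (induction i arbitrary: j)
  case 0
  have "runmax (psums j) 1 = (\<lambda>\<omega>. \<bar>predicted j 0 \<omega>\<bar>)"
    by (rule ext) (simp add: runmax_Suc runmax_0 psums_def)
  then have "L2norm M (runmax (psums j) 1) \<le> e j" using L2norm_predicted by (simp add: L2norm_abs)
  then show ?case using e_nonneg[of j] by simp
next
  case (Suc i)
  have "L2norm M (runmax (psums j) (2 ^ Suc i)) \<le> 3 * sqrt (real (2 ^ i)) * e j + L2norm M (runmax (psums (Suc j)) (2 ^ i))"
    using psums_step[of "2 ^ i" j] by simp
  also have "\<dots> \<le> 3 * sqrt 2 ^ Suc i * e j + 3 * (\<Sum>s\<le>i. sqrt 2 ^ (i - s) * e (Suc j + s))"
  proof (intro add_mono Suc mult_right_mono e_nonneg)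
    have "sqrt 2 ^ i * 1 \<le> sqrt 2 ^ i * sqrt 2" by (intro mult_left_mono) auto
    then show "3 * sqrt (real (2 ^ i)) \<le> 3 * sqrt 2 ^ Suc i" by (simp add: real_sqrt_power mult.commute)
  qed
  also have "\<dots> = 3 * (\<Sum>s\<le>Suc i. sqrt 2 ^ (Suc i - s) * e (j + s))"
    by (subst sum.atMost_Suc_shift) simp
  finally show ?case .
qed

text \<open>Subtracting from each summand its prediction one step before gives a martingale, controlled
  by Doob's inequality, and the level zero sums, controlled by the recursion.  Divided by the square
  root of the length, the second part is a partial sum of the Maxwell-Woodroofe series.\<close>

theorem dyadic_maximal:
  "L2norm M (runmax (\<lambda>k \<omega>. \<Sum>l<k. Z l \<omega>) (2 ^ r))
    \<le> 2 * sqrt (\<Sum>l<2 ^ r. (L2norm M (Z l))\<^sup>2) + 3 * sqrt 2 ^ r * (\<Sum>s\<le>r. e s / sqrt 2 ^ s)"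
proof -
  define D where "D l \<omega> = Z l \<omega> - CE l (Z l) \<omega>" for l \<omega>
  have p0: "predicted 0 l = CE l (Z l)" for l by (simp add: predicted_def)
  have Dsq: "square_integrable M (D l)" for l
    unfolding D_def by (intro square_integrable_diff CE_square_integrable Z_square_integrable)
  have D: "martingale_diff D"
    unfolding martingale_diff_def
  proof (intro allI conjI Dsq)
    fix l
    have [measurable]: "Z l \<in> borel_measurable (F (Suc l))" "CE l (Z l) \<in> borel_measurable (F (Suc l))"
      by (rule Z_measurable, rule measurable_F_mono[OF borel_measurable_cond_exp]) simp
    show "D l \<in> borel_measurable (F (Suc l))" unfolding D_def by measurable
    have p: "integrable M (Z l)" "integrable M (CE l (Z l))"
      by (intro square_integrable_integrable Z_square_integrable CE_square_integrable)+
    have "AE \<omega> in M. CE l (D l) \<omega> = CE l (Z l) \<omega> - CE l (CE l (Z l)) \<omega>"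
      unfolding D_def by (rule CE_diff[OF p])
    moreover have "AE \<omega> in M. CE l (CE l (Z l)) \<omega> = CE l (Z l) \<omega>"
      by (rule CE_F_meas[OF p(2)]) simp
    ultimately show "AE \<omega> in M. CE l (D l) \<omega> = 0" by eventually_elim simp
  qed
  let ?m = "\<lambda>k \<omega>. \<Sum>l<k. D l \<omega>"
  have sq: "square_integrable M (runmax ?m k)" "square_integrable M (runmax (psums j) k)" for j k
    by (intro runmax_square_integrable square_integrable_sum Dsq psums_square_integrable)+
  have "L2norm M (runmax (\<lambda>k \<omega>. \<Sum>l<k. Z l \<omega>) (2 ^ r)) \<le> L2norm M (\<lambda>\<omega>. runmax ?m (2 ^ r) \<omega> + runmax (psums 0) (2 ^ r) \<omega>)"
  proof (rule L2norm_mono)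
    show "square_integrable M (\<lambda>\<omega>. runmax ?m (2 ^ r) \<omega> + runmax (psums 0) (2 ^ r) \<omega>)"
      by (intro square_integrable_add sq)
    show "runmax (\<lambda>k \<omega>. \<Sum>l<k. Z l \<omega>) (2 ^ r) \<in> borel_measurable M"
      by (intro square_integrable_measurable runmax_square_integrable square_integrable_sum Z_square_integrable)
    fix \<omega>
    have "runmax (\<lambda>k \<omega>. \<Sum>l<k. Z l \<omega>) (2 ^ r) \<omega> \<le> runmax ?m (2 ^ r) \<omega> + runmax (psums 0) (2 ^ r) \<omega>"
    proof (rule runmax_least)
      fix k :: nat assume k: "k \<le> 2 ^ r"
      have "(\<Sum>l<k. Z l \<omega>) = ?m k \<omega> + psums 0 k \<omega>"
        by (simp add: psums_def p0 D_def sum_subtractf)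
      then show "\<bar>\<Sum>l<k. Z l \<omega>\<bar> \<le> runmax ?m (2 ^ r) \<omega> + runmax (psums 0) (2 ^ r) \<omega>"
        using runmax_ge[OF k, of ?m \<omega>] runmax_ge[OF k, of "psums 0" \<omega>] by linarith
    qed
    then show "\<bar>runmax (\<lambda>k \<omega>. \<Sum>l<k. Z l \<omega>) (2 ^ r) \<omega>\<bar> \<le> \<bar>runmax ?m (2 ^ r) \<omega> + runmax (psums 0) (2 ^ r) \<omega>\<bar>"
      by (simp add: abs_of_nonneg[OF runmax_nonneg])
  qed
  also have "\<dots> \<le> L2norm M (runmax ?m (2 ^ r)) + L2norm M (runmax (psums 0) (2 ^ r))"
    by (intro L2norm_triangle sq)
  also have "L2norm M (runmax ?m (2 ^ r)) \<le> 2 * sqrt (\<Sum>l<2 ^ r. (L2norm M (Z l))\<^sup>2)"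
  proof -
    have "(\<Sum>l<2 ^ r. (L2norm M (D l))\<^sup>2) \<le> (\<Sum>l<2 ^ r. (L2norm M (Z l))\<^sup>2)"
      using L2norm_diff_CE_le[OF Z_square_integrable] unfolding D_def[abs_def]
      by (intro sum_mono power_mono) auto
    then have "2 * sqrt (\<Sum>l<2 ^ r. (L2norm M (D l))\<^sup>2) \<le> 2 * sqrt (\<Sum>l<2 ^ r. (L2norm M (Z l))\<^sup>2)"
      by simp
    then show ?thesis using martingale_maximal_L2[OF D, of "2 ^ r"] by linarith
  qed
  also have "L2norm M (runmax (psums 0) (2 ^ r)) \<le> 3 * (\<Sum>s\<le>r. sqrt 2 ^ (r - s) * e s)"
    using psums_maximal[of 0 r] by simp
  also have "\<dots> = 3 * sqrt 2 ^ r * (\<Sum>s\<le>r. e s / sqrt 2 ^ s)"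
    by (simp add: sum_distrib_left power_diff mult.assoc)
  finally show ?thesis by simp
qed

end

section \<open>Martingale approximation\<close>

context adapted_process
begin

definition S :: "nat \<Rightarrow> 'a \<Rightarrow> real" where
  "S k \<omega> = (\<Sum>l<k. Z l \<omega>)"

lemma S_0 [simp]: "S 0 \<omega> = 0" and S_Suc: "S (Suc k) \<omega> = S k \<omega> + Z k \<omega>"
  by (simp_all add: S_def)

lemma S_increment: "S (k + i) \<omega> - S k \<omega> = (\<Sum>l\<in>{k..<k + i}. Z l \<omega>)"
  using sum.atLeastLessThan_concat[of 0 k "k + i" "\<lambda>l. Z l \<omega>"]
  by (simp add: S_def atLeast0LessThan)

lemma S_square_integrable: "square_integrable M (S k)"
  unfolding S_def[abs_def] by (intro square_integrable_sum Z_square_integrable)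

lemma S_increment_square_integrable: "square_integrable M (\<lambda>\<omega>. S j \<omega> - S i \<omega>)"
  by (intro square_integrable_diff S_square_integrable)

lemma S_increment_integrable: "integrable M (\<lambda>\<omega>. S j \<omega> - S i \<omega>)"
  by (rule square_integrable_integrable[OF S_increment_square_integrable])

text \<open>A bound for predictions of increments of any length below \<open>2 ^ q\<close>.\<close>

definition ebound :: "nat \<Rightarrow> real" where
  "ebound q = (\<Sum>j<q. e j)"

lemma ebound_nonneg: "0 \<le> ebound q"
  unfolding ebound_def by (intro sum_nonneg e_nonneg)

lemma L2norm_predicted_dyadic: "L2norm M (CE i (\<lambda>\<omega>. S (i + 2 ^ j) \<omega> - S i \<omega>)) \<le> e j"
  unfolding S_increment by (rule Z_predict)

text \<open>The binary expansion of the length reduces general increments to dyadic ones.\<close>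

lemma L2norm_predicted_increment:
  "k < 2 ^ q \<Longrightarrow> L2norm M (CE i (\<lambda>\<omega>. S (i + k) \<omega> - S i \<omega>)) \<le> ebound q"
proof (induction q arbitrary: i k)
  case 0
  have "L2norm M (CE i (\<lambda>\<omega>. 0)) \<le> L2norm M (\<lambda>_. 0)" by (rule CE_L2norm_le) simp
  then show ?case using 0 by (simp add: ebound_def)
next
  case (Suc q)
  show ?case
  proof (cases "k < 2 ^ q")
    case True
    then show ?thesis using Suc.IH[OF True, of i] e_nonneg[of q] by (simp add: ebound_def)
  next
    case False
    define k' where "k' = k - 2 ^ q"
    have k: "k = 2 ^ q + k'" "k' < 2 ^ q" using False Suc.prems by (auto simp: k'_def)
    let ?i = "i + 2 ^ q"
    let ?f = "\<lambda>\<omega>. S ?i \<omega> - S i \<omega>" and ?g = "\<lambda>\<omega>. S (?i + k') \<omega> - S ?i \<omega>"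
    have eq: "(\<lambda>\<omega>. S (i + k) \<omega> - S i \<omega>) = (\<lambda>\<omega>. ?f \<omega> + ?g \<omega>)" by (simp add: k(1) add.assoc)
    have "L2norm M (CE i (\<lambda>\<omega>. S (i + k) \<omega> - S i \<omega>)) = L2norm M (\<lambda>\<omega>. CE i ?f \<omega> + CE i ?g \<omega>)"
      unfolding eq by (rule L2norm_cong_AE[OF CE_add[OF S_increment_integrable S_increment_integrable]]) simp_all
    also have "\<dots> \<le> L2norm M (CE i ?f) + L2norm M (CE i ?g)"
      by (intro L2norm_triangle CE_square_integrable S_increment_square_integrable)
    also have "L2norm M (CE i ?g) \<le> L2norm M (CE ?i ?g)"
      by (rule CE_L2norm_antimono[OF _ S_increment_square_integrable]) simp
    also have "\<dots> \<le> ebound q" by (rule Suc.IH[OF k(2)])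
    also have "L2norm M (CE i ?f) \<le> e q" by (rule L2norm_predicted_dyadic)
    finally show ?thesis by (simp add: ebound_def)
  qed
qed

text \<open>Following Gordin's method with an average in place of an infinite series: \<open>th p k\<close> is the mean
  of the predictions at time \<open>k\<close> of the sums of the next \<open>0, ..., 2 ^ p - 1\<close> summands.  It solves the coboundary
  equation up to the error \<open>Y p\<close>, and \<open>D p\<close> is the resulting martingale difference.\<close>

definition th :: "nat \<Rightarrow> nat \<Rightarrow> 'a \<Rightarrow> real" where
  "th p k \<omega> = 1 / real (2 ^ p) * (\<Sum>i=1..2 ^ p - 1. CE k (\<lambda>\<omega>. S (k + i) \<omega> - S k \<omega>) \<omega>)"

definition Y :: "nat \<Rightarrow> nat \<Rightarrow> 'a \<Rightarrow> real" where
  "Y p k \<omega> = 1 / real (2 ^ p) * CE k (\<lambda>\<omega>. S (k + 2 ^ p) \<omega> - S k \<omega>) \<omega>"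

definition D :: "nat \<Rightarrow> nat \<Rightarrow> 'a \<Rightarrow> real" where
  "D p l \<omega> = Z l \<omega> + th p (Suc l) \<omega> - th p l \<omega> - Y p l \<omega>"

lemma th_measurable: "th p k \<in> borel_measurable (F k)"
  unfolding th_def[abs_def] by measurable

lemma Y_measurable: "Y p k \<in> borel_measurable (F k)"
  unfolding Y_def[abs_def] by measurable

lemma th_square_integrable: "square_integrable M (th p k)"
  unfolding th_def[abs_def]
  by (intro square_integrable_cmult square_integrable_sum CE_square_integrable S_increment_square_integrable)

lemma Y_square_integrable: "square_integrable M (Y p k)"
  unfolding Y_def[abs_def]
  by (intro square_integrable_cmult CE_square_integrable S_increment_square_integrable)

lemma D_square_integrable: "square_integrable M (D p l)"
  unfolding D_def[abs_def]
  by (intro square_integrable_diff square_integrable_add Z_square_integrable th_square_integrable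
      Y_square_integrable)

lemma L2norm_th: "L2norm M (th p k) \<le> ebound p"
proof -
  have "L2norm M (th p k) = 1 / 2 ^ p * L2norm M (\<lambda>\<omega>. \<Sum>i=1..2 ^ p - 1. CE k (\<lambda>\<omega>. S (k + i) \<omega> - S k \<omega>) \<omega>)"
    unfolding th_def[abs_def] L2norm_cmult by simp
  also have "L2norm M (\<lambda>\<omega>. \<Sum>i=1..2 ^ p - 1. CE k (\<lambda>\<omega>. S (k + i) \<omega> - S k \<omega>) \<omega>)
      \<le> (\<Sum>i=1..2 ^ p - 1. L2norm M (CE k (\<lambda>\<omega>. S (k + i) \<omega> - S k \<omega>)))"
    by (intro L2norm_sum CE_square_integrable S_increment_square_integrable)
  also have "\<dots> \<le> (\<Sum>i=1..2 ^ p - (1::nat). ebound p)"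
    by (intro sum_mono L2norm_predicted_increment) auto
  also have "\<dots> \<le> 2 ^ p * ebound p"
    by (simp add: ebound_nonneg mult_right_mono of_nat_diff)
  finally show ?thesis by (simp add: divide_right_mono)
qed

lemma L2norm_Y: "L2norm M (Y p k) \<le> e p / 2 ^ p"
  using L2norm_predicted_dyadic[of k p]
  unfolding Y_def[abs_def] L2norm_cmult by (simp add: divide_right_mono)

text \<open>Both sides are \<open>1 / 2 ^ p\<close> times the sum of the predictions at time \<open>l\<close> of
  \<open>S (l + i) - S l\<close> for \<open>i = 1, ..., 2 ^ p\<close>: adding \<open>Z l\<close> lengthens every window by one.\<close>

lemma CE_th_Suc: "AE \<omega> in M. CE l (\<lambda>\<omega>. Z l \<omega> + th p (Suc l) \<omega>) \<omega> = th p l \<omega> + Y p l \<omega>"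
proof -
  let ?m = "2 ^ p :: nat"
  let ?I = "\<lambda>i \<omega>. S (l + i) \<omega> - S l \<omega>"
  let ?J = "\<lambda>i \<omega>. S (Suc l + i) \<omega> - S (Suc l) \<omega>"
  have int: "integrable M (?I i)" "integrable M (?J i)" "integrable M (CE (Suc l) (?J i))" "integrable M (Z l)" for i
    by (intro S_increment_integrable CE_integrable square_integrable_integrable[OF Z_square_integrable])+
  have th: "integrable M (th p (Suc l))" by (rule square_integrable_integrable[OF th_square_integrable])
  have 1: "AE \<omega> in M. CE l (\<lambda>\<omega>. Z l \<omega> + th p (Suc l) \<omega>) \<omega> = CE l (Z l) \<omega> + CE l (th p (Suc l)) \<omega>"
    by (rule CE_add[OF int(4) th])
  have 2: "AE \<omega> in M. CE l (th p (Suc l)) \<omega> = 1 / real ?m * CE l (\<lambda>\<omega>. \<Sum>i=1..?m - 1. CE (Suc l) (?J i) \<omega>) \<omega>"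
    unfolding th_def[abs_def] by (intro CE_cmult Bochner_Integration.integrable_sum int)
  have 3: "AE \<omega> in M. CE l (\<lambda>\<omega>. \<Sum>i=1..?m - 1. CE (Suc l) (?J i) \<omega>) \<omega>
      = (\<Sum>i=1..?m - 1. CE l (CE (Suc l) (?J i)) \<omega>)"
    by (rule CE_sum[OF int(3)])
  have 4: "AE \<omega> in M. \<forall>i. CE l (CE (Suc l) (?J i)) \<omega> = CE l (?J i) \<omega>"
    unfolding AE_all_countable by (intro allI CE_tower int) simp
  have J: "(\<lambda>\<omega>. Z l \<omega> + ?J i \<omega>) = ?I (Suc i)" for i by (rule ext) (simp add: S_Suc)
  have 5: "AE \<omega> in M. \<forall>i. CE l (?I (Suc i)) \<omega> = CE l (Z l) \<omega> + CE l (?J i) \<omega>"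
    unfolding AE_all_countable J[symmetric] by (intro allI CE_add int)
  show ?thesis using 1 2 3 4 5
  proof eventually_elim
    case (elim \<omega>)
    have m: "Suc (?m - 1) = ?m" by simp
    have z: "CE l (?I 1) \<omega> = CE l (Z l) \<omega>" by (simp add: S_Suc)
    have "(\<Sum>i=1..?m - 1. CE l (?J i) \<omega>) = (\<Sum>i=1..?m - 1. CE l (?I (Suc i)) \<omega> - CE l (Z l) \<omega>)"
      using elim(5) by (intro sum.cong) auto
    also have "\<dots> = (\<Sum>i=1..?m - 1. CE l (?I (Suc i)) \<omega>) - (real ?m - 1) * CE l (Z l) \<omega>"
      by (simp add: sum_subtractf of_nat_diff)
    also have "(\<Sum>i=1..?m - 1. CE l (?I (Suc i)) \<omega>) = (\<Sum>i=Suc 1..Suc (?m - 1). CE l (?I i) \<omega>)"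
      by (rule sum.shift_bounds_cl_Suc_ivl[symmetric])
    also have "\<dots> = (\<Sum>i=1..Suc (?m - 1). CE l (?I i) \<omega>) - CE l (?I 1) \<omega>"
      by (subst (2) sum.atLeast_Suc_atMost) simp_all
    also have "(\<Sum>i=1..Suc (?m - 1). CE l (?I i) \<omega>) = (\<Sum>i=1..?m - 1. CE l (?I i) \<omega>) + CE l (?I ?m) \<omega>"
      by (subst sum.cl_ivl_Suc) (simp add: m)
    finally have "(\<Sum>i=1..?m - 1. CE l (?J i) \<omega>)
        = (\<Sum>i=1..?m - 1. CE l (?I i) \<omega>) + CE l (?I ?m) \<omega> - real ?m * CE l (Z l) \<omega>"
      unfolding z by (simp add: algebra_simps)
    moreover have "CE l (\<lambda>\<omega>. Z l \<omega> + th p (Suc l) \<omega>) \<omega>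
        = CE l (Z l) \<omega> + 1 / real ?m * (\<Sum>i=1..?m - 1. CE l (?J i) \<omega>)"
      using elim(1-4) by simp
    ultimately show ?case
      unfolding th_def Y_def by (simp add: field_simps)
  qed
qed

lemma D_martingale: "martingale_diff (D p)"
  unfolding martingale_diff_def
proof (intro allI conjI D_square_integrable)
  fix l
  have [measurable]: "Z l \<in> borel_measurable (F (Suc l))" "th p (Suc l) \<in> borel_measurable (F (Suc l))"
    "th p l \<in> borel_measurable (F (Suc l))" "Y p l \<in> borel_measurable (F (Suc l))"
    by (rule Z_measurable, rule th_measurable, rule measurable_F_mono[OF th_measurable], simp,
        rule measurable_F_mono[OF Y_measurable], simp)
  show "D p l \<in> borel_measurable (F (Suc l))" unfolding D_def[abs_def] by measurable
  let ?a = "\<lambda>\<omega>. Z l \<omega> + th p (Suc l) \<omega>" and ?b = "\<lambda>\<omega>. th p l \<omega> + Y p l \<omega>"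
  have a: "integrable M ?a" and b: "integrable M ?b"
    by (intro square_integrable_integrable square_integrable_add Z_square_integrable
        th_square_integrable Y_square_integrable)+
  have bm: "?b \<in> borel_measurable (F l)" using th_measurable[of p l] Y_measurable[of p l] by measurable
  have "D p l = (\<lambda>\<omega>. ?a \<omega> - ?b \<omega>)" by (rule ext) (simp add: D_def)
  then have "AE \<omega> in M. CE l (D p l) \<omega> = CE l ?a \<omega> - CE l ?b \<omega>" using CE_diff[OF a b] by simp
  moreover note CE_th_Suc[of l p]
  moreover have "AE \<omega> in M. CE l ?b \<omega> = ?b \<omega>" by (rule CE_F_meas[OF b bm])
  ultimately show "AE \<omega> in M. CE l (D p l) \<omega> = 0" by eventually_elim simp
qed

lemma S_eq_martingale:
  "S k \<omega> = (\<Sum>l<k. D p l \<omega>) + th p 0 \<omega> - th p k \<omega> + (\<Sum>l<k. Y p l \<omega>)"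
  by (induction k) (simp_all add: S_Suc D_def)

text \<open>This compares the quadratic variation of the martingale with the sums in the hypothesis on
  \<open>X k\<^sup>2 + 2 * X k * \<theta>\<close>.  It results from squaring \<open>D + (th + Y) = Z + th\<close> with \<open>th\<close> taken at the later
  time on the right; the squares of \<open>th\<close> telescope.\<close>

lemma sum_D_power2:
  "(\<Sum>l<k. (D p l \<omega>)\<^sup>2) = (\<Sum>l<k. (Z l \<omega>)\<^sup>2 + 2 * Z l \<omega> * th p (Suc l) \<omega>)
    + ((th p k \<omega>)\<^sup>2 - (th p 0 \<omega>)\<^sup>2)
    - 2 * (\<Sum>l<k. (th p l \<omega> + Y p l \<omega>) * D p l \<omega>)
    - (\<Sum>l<k. 2 * (th p l \<omega> * Y p l \<omega>) + (Y p l \<omega>)\<^sup>2)"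
proof (induction k)
  case (Suc k)
  have "(D p k \<omega>)\<^sup>2 = (Z k \<omega>)\<^sup>2 + 2 * Z k \<omega> * th p (Suc k) \<omega> + ((th p (Suc k) \<omega>)\<^sup>2 - (th p k \<omega>)\<^sup>2)
    - 2 * ((th p k \<omega> + Y p k \<omega>) * D p k \<omega>) - (2 * (th p k \<omega> * Y p k \<omega>) + (Y p k \<omega>)\<^sup>2)"
    unfolding D_def by (simp add: power2_eq_square algebra_simps)
  then show ?case using Suc by (simp add: algebra_simps)
qed simp

text \<open>Averaging over shifts, the increments of the remainder are predicted no worse than those of
  the process itself, and short increments are small because each summand is.\<close>

lemma Y_adapted_process:
  "adapted_process M F (Y p) (\<lambda>j. min (e j) (2 ^ j * (e p / 2 ^ p)))"
proof (unfold_locales)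
  fix l show "Y p l \<in> borel_measurable (F (Suc l))"
    by (rule measurable_F_mono[OF Y_measurable]) simp
  show "square_integrable M (Y p l)" by (rule Y_square_integrable)
next
  fix i j
  let ?f = "\<lambda>\<omega>. \<Sum>l\<in>{i..<i + 2 ^ j}. Y p l \<omega>"
  let ?m = "2 ^ p :: nat"
  have "L2norm M (CE i ?f) \<le> L2norm M ?f"
    by (intro CE_L2norm_le square_integrable_sum Y_square_integrable)
  also have "\<dots> \<le> (\<Sum>l\<in>{i..<i + 2 ^ j}. L2norm M (Y p l))"
    by (intro L2norm_sum Y_square_integrable)
  also have "\<dots> \<le> (\<Sum>l\<in>{i..<i + 2 ^ j}. e p / 2 ^ p)" by (intro sum_mono L2norm_Y)
  finally have 1: "L2norm M (CE i ?f) \<le> 2 ^ j * (e p / 2 ^ p)" by simp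
  let ?I = "\<lambda>l \<omega>. S (l + ?m) \<omega> - S l \<omega>"
  let ?J = "\<lambda>s \<omega>. S (i + s + 2 ^ j) \<omega> - S (i + s) \<omega>"
  have int: "integrable M (?I l)" "integrable M (?J s)" for l s by (intro S_increment_integrable)+
  have intY: "integrable M (Y p l)" for l by (rule square_integrable_integrable[OF Y_square_integrable])
  have a: "AE \<omega> in M. CE i ?f \<omega> = (\<Sum>l\<in>{i..<i + 2 ^ j}. CE i (Y p l) \<omega>)"
    by (rule CE_sum[OF intY])
  have b: "AE \<omega> in M. \<forall>l. CE i (Y p l) \<omega> = 1 / real ?m * CE i (CE l (?I l)) \<omega>"
    unfolding AE_all_countable Y_def[abs_def] by (intro allI CE_cmult CE_integrable int)
  have c: "AE \<omega> in M. \<forall>l\<in>{i..<i + 2 ^ j}. CE i (CE l (?I l)) \<omega> = CE i (?I l) \<omega>"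
    by (intro AE_finite_allI) (auto intro!: CE_tower int)
  have swap: "(\<Sum>l\<in>{i..<i + 2 ^ j}. ?I l \<omega>) = (\<Sum>s<?m. ?J s \<omega>)" for \<omega>
  proof -
    have "(\<Sum>l\<in>{i..<i + 2 ^ j}. ?I l \<omega>) = (\<Sum>l<2 ^ j. \<Sum>s<?m. Z (i + l + s) \<omega>)"
      unfolding S_increment
      by (simp add: sum.atLeastLessThan_shift_0[of _ "_ + _"] sum.atLeastLessThan_shift_0[of _ i] atLeast0LessThan add.commute add.left_commute)
    also have "\<dots> = (\<Sum>s<?m. \<Sum>l<2 ^ j. Z (i + l + s) \<omega>)" by (rule sum.swap)
    also have "\<dots> = (\<Sum>s<?m. ?J s \<omega>)"
      unfolding S_increment
      by (simp add: sum.atLeastLessThan_shift_0[of _ "_ + _"] atLeast0LessThan add.commute add.left_commute)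
    finally show ?thesis .
  qed
  have d: "AE \<omega> in M. CE i (\<lambda>\<omega>. \<Sum>s<?m. ?J s \<omega>) \<omega> = (\<Sum>l\<in>{i..<i + 2 ^ j}. CE i (?I l) \<omega>)"
    using CE_sum[of "{i..<i + 2 ^ j}" ?I i, OF int(1)] unfolding swap .
  have f: "AE \<omega> in M. CE i (\<lambda>\<omega>. \<Sum>s<?m. ?J s \<omega>) \<omega> = (\<Sum>s<?m. CE i (?J s) \<omega>)"
    by (rule CE_sum[OF int(2)])
  have "AE \<omega> in M. CE i ?f \<omega> = 1 / real ?m * (\<Sum>s<?m. CE i (?J s) \<omega>)"
    using a b c d f
  proof eventually_elim
    case (elim \<omega>)
    have "CE i ?f \<omega> = (\<Sum>l\<in>{i..<i + 2 ^ j}. 1 / real ?m * CE i (?I l) \<omega>)"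
      unfolding elim(1) using elim(2,3) by (intro sum.cong) auto
    then show ?case using elim(4,5) by (simp add: sum_divide_distrib[symmetric])
  qed
  then have eq: "L2norm M (CE i ?f) = L2norm M (\<lambda>\<omega>. 1 / real ?m * (\<Sum>s<?m. CE i (?J s) \<omega>))"
    by (rule L2norm_cong_AE) simp_all
  have "L2norm M (\<lambda>\<omega>. \<Sum>s<?m. CE i (?J s) \<omega>) \<le> (\<Sum>s<?m. L2norm M (CE i (?J s)))"
    by (rule L2norm_sum) (rule CE_square_integrable[OF S_increment_square_integrable])
  moreover have "(\<Sum>s<?m. L2norm M (CE i (?J s))) \<le> (\<Sum>s<?m. e j)"
  proof (rule sum_mono)
    fix s :: nat
    have "L2norm M (CE i (?J s)) \<le> L2norm M (CE (i + s) (?J s))"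
      by (rule CE_L2norm_antimono[OF _ S_increment_square_integrable]) simp
    then show "L2norm M (CE i (?J s)) \<le> e j"
      using L2norm_predicted_dyadic[of "i + s" j] by (rule order_trans)
  qed
  ultimately have "L2norm M (\<lambda>\<omega>. \<Sum>s<?m. CE i (?J s) \<omega>) \<le> (\<Sum>s<?m. e j)"
    by (rule order_trans)
  then have 2: "L2norm M (CE i ?f) \<le> e j"
    unfolding eq L2norm_cmult by (simp add: field_simps)
  show "L2norm M (CE i ?f) \<le> min (e j) (2 ^ j * (e p / 2 ^ p))" using 1 2 by simp
qed

end

section \<open>Sequences that are uniformly small on the scale of the square root\<close>

text \<open>The class is stable under linear combinations and shifts, so that negligibility has to be
  checked only for single predictions \<open>E (Z (k + s))\<close>, of which all the correction terms are made.\<close>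

definition negligible_max :: "'a measure \<Rightarrow> (nat \<Rightarrow> 'a \<Rightarrow> real) \<Rightarrow> bool" where
  "negligible_max M f \<longleftrightarrow> (\<forall>k. square_integrable M (f k)) \<and>
     (\<lambda>n. L2norm M (runmax f n) / sqrt (real n)) \<longlonglongrightarrow> 0"

lemma negligible_max_square_integrable: "negligible_max M f \<Longrightarrow> square_integrable M (f k)"
  by (simp add: negligible_max_def)

lemma negligible_max_tendsto:
  "negligible_max M f \<Longrightarrow> (\<lambda>n. L2norm M (runmax f n) / sqrt (real n)) \<longlonglongrightarrow> 0"
  by (simp add: negligible_max_def)

lemma L2norm_runmax_add:
  assumes f: "\<And>k. square_integrable M (f k)" and g: "\<And>k. square_integrable M (g k)"
  shows "L2norm M (runmax (\<lambda>k \<omega>. f k \<omega> + g k \<omega>) n) \<le> L2norm M (runmax f n) + L2norm M (runmax g n)"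
proof -
  note sq = runmax_square_integrable[OF f] runmax_square_integrable[OF g]
  have "L2norm M (runmax (\<lambda>k \<omega>. f k \<omega> + g k \<omega>) n) \<le> L2norm M (\<lambda>\<omega>. runmax f n \<omega> + runmax g n \<omega>)"
  proof (rule L2norm_mono[OF square_integrable_add[OF sq]])
    show "runmax (\<lambda>k \<omega>. f k \<omega> + g k \<omega>) n \<in> borel_measurable M"
      by (rule square_integrable_measurable[OF runmax_square_integrable[OF square_integrable_add[OF f g]]])
    fix \<omega>
    have "runmax (\<lambda>k \<omega>. f k \<omega> + g k \<omega>) n \<omega> \<le> runmax f n \<omega> + runmax g n \<omega>"
    proof (rule runmax_least)
      fix k assume k: "k \<le> n"
      show "\<bar>f k \<omega> + g k \<omega>\<bar> \<le> runmax f n \<omega> + runmax g n \<omega>"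
        using runmax_ge[OF k, of f \<omega>] runmax_ge[OF k, of g \<omega>] by linarith
    qed
    then show "\<bar>runmax (\<lambda>k \<omega>. f k \<omega> + g k \<omega>) n \<omega>\<bar> \<le> \<bar>runmax f n \<omega> + runmax g n \<omega>\<bar>"
      by (simp add: abs_of_nonneg[OF runmax_nonneg])
  qed
  moreover have "L2norm M (\<lambda>\<omega>. runmax f n \<omega> + runmax g n \<omega>) \<le> L2norm M (runmax f n) + L2norm M (runmax g n)"
    by (rule L2norm_triangle[OF sq])
  ultimately show ?thesis by (rule order_trans)
qed

lemma runmax_cmult: "runmax (\<lambda>k \<omega>. a * f k \<omega>) n = (\<lambda>\<omega>. \<bar>a\<bar> * runmax f n \<omega>)"
proof
  fix \<omega> show "runmax (\<lambda>k \<omega>. a * f k \<omega>) n \<omega> = \<bar>a\<bar> * runmax f n \<omega>"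
    by (induction n) (simp_all add: runmax_0 runmax_Suc abs_mult max_mult_distrib_left)
qed

lemma negligible_max_add:
  assumes f: "negligible_max M f" and g: "negligible_max M g"
  shows "negligible_max M (\<lambda>k \<omega>. f k \<omega> + g k \<omega>)"
  unfolding negligible_max_def
proof (intro conjI allI)
  note sq = negligible_max_square_integrable[OF f] negligible_max_square_integrable[OF g]
  show "square_integrable M (\<lambda>\<omega>. f k \<omega> + g k \<omega>)" for k by (rule square_integrable_add[OF sq])
  show "(\<lambda>n. L2norm M (runmax (\<lambda>k \<omega>. f k \<omega> + g k \<omega>) n) / sqrt (real n)) \<longlonglongrightarrow> 0"
  proof (rule tendsto_sandwich[OF _ _ tendsto_const])
    show "(\<lambda>n. L2norm M (runmax f n) / sqrt (real n) + L2norm M (runmax g n) / sqrt (real n)) \<longlonglongrightarrow> 0"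
      using tendsto_add[OF negligible_max_tendsto[OF f] negligible_max_tendsto[OF g]] by simp
    show "\<forall>\<^sub>F n in sequentially. L2norm M (runmax (\<lambda>k \<omega>. f k \<omega> + g k \<omega>) n) / sqrt (real n)
        \<le> L2norm M (runmax f n) / sqrt (real n) + L2norm M (runmax g n) / sqrt (real n)"
      using L2norm_runmax_add[OF sq]
      by (intro always_eventually allI) (simp add: add_divide_distrib[symmetric] divide_right_mono)
  qed simp
qed

lemma negligible_max_cmult:
  assumes f: "negligible_max M f" shows "negligible_max M (\<lambda>k \<omega>. a * f k \<omega>)"
  unfolding negligible_max_def
proof (intro conjI allI)
  show "square_integrable M (\<lambda>\<omega>. a * f k \<omega>)" for k
    by (rule square_integrable_cmult[OF negligible_max_square_integrable[OF f]])
  show "(\<lambda>n. L2norm M (runmax (\<lambda>k \<omega>. a * f k \<omega>) n) / sqrt (real n)) \<longlonglongrightarrow> 0"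
    using tendsto_mult_right_zero[OF negligible_max_tendsto[OF f], of "\<bar>a\<bar>"]
    by (simp add: runmax_cmult L2norm_cmult)
qed

lemma negligible_max_zero:
  fixes M :: "'a measure" shows "negligible_max M (\<lambda>k \<omega>. 0)"
proof -
  have "runmax (\<lambda>k (\<omega> :: 'a). 0) n = (\<lambda>_. 0)" for n :: nat
    by (rule ext, induction n) (simp_all add: runmax_0 runmax_Suc)
  then show ?thesis by (simp add: negligible_max_def)
qed

lemma negligible_max_sum:
  assumes "finite I" "\<And>i. i \<in> I \<Longrightarrow> negligible_max M (f i)"
  shows "negligible_max M (\<lambda>k \<omega>. \<Sum>i\<in>I. f i k \<omega>)"
  using assms by (induction I rule: finite_induct) (auto intro: negligible_max_add negligible_max_zero)

lemma negligible_max_diff: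
  assumes f: "negligible_max M f" and g: "negligible_max M g"
  shows "negligible_max M (\<lambda>k \<omega>. f k \<omega> - g k \<omega>)"
  using negligible_max_add[OF f negligible_max_cmult[OF g, of "-1"]] by simp

lemma negligible_max_cong_AE:
  assumes f: "negligible_max M f" and g: "\<And>k. square_integrable M (g k)"
    and eq: "\<And>k. AE \<omega> in M. g k \<omega> = f k \<omega>"
  shows "negligible_max M g"
proof -
  have "AE \<omega> in M. \<forall>k. g k \<omega> = f k \<omega>" using eq by (simp add: AE_all_countable)
  then have "AE \<omega> in M. runmax g n \<omega> = runmax f n \<omega>" for n
    by eventually_elim (simp add: runmax_def)
  then have "L2norm M (runmax g n) = L2norm M (runmax f n)" for n
    by (rule L2norm_cong_AE)
       (intro square_integrable_measurable runmax_square_integrable g negligible_max_square_integrable[OF f])+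
  then show ?thesis using negligible_max_tendsto[OF f] g by (simp add: negligible_max_def)
qed

lemma negligible_max_Suc:
  assumes f: "negligible_max M f" shows "negligible_max M (\<lambda>k. f (Suc k))"
  unfolding negligible_max_def
proof (intro conjI allI)
  note sq = negligible_max_square_integrable[OF f]
  show "square_integrable M (f (Suc k))" for k by (rule sq)
  show "(\<lambda>n. L2norm M (runmax (\<lambda>k. f (Suc k)) n) / sqrt (real n)) \<longlonglongrightarrow> 0"
  proof (rule tendsto_sandwich[OF _ _ tendsto_const])
    have "(\<lambda>n. sqrt 2 * (L2norm M (runmax f (Suc n)) / sqrt (real (Suc n)))) \<longlonglongrightarrow> 0"
      by (intro tendsto_mult_right_zero LIMSEQ_Suc[OF negligible_max_tendsto[OF f]])
    then show "(\<lambda>n. sqrt 2 * (L2norm M (runmax f (Suc n)) / sqrt (real (Suc n)))) \<longlonglongrightarrow> 0" .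
    show "\<forall>\<^sub>F n in sequentially. L2norm M (runmax (\<lambda>k. f (Suc k)) n) / sqrt (real n)
        \<le> sqrt 2 * (L2norm M (runmax f (Suc n)) / sqrt (real (Suc n)))"
      using eventually_ge_at_top[of 1]
    proof eventually_elim
      case (elim n)
      have "L2norm M (runmax (\<lambda>k. f (Suc k)) n) \<le> L2norm M (runmax f (Suc n))"
      proof (rule L2norm_mono[OF runmax_square_integrable[OF sq]])
        show "runmax (\<lambda>k. f (Suc k)) n \<in> borel_measurable M"
          by (rule square_integrable_measurable[OF runmax_square_integrable[OF sq]])
        fix \<omega>
        have "runmax (\<lambda>k. f (Suc k)) n \<omega> \<le> runmax f (Suc n) \<omega>"
          by (rule runmax_least) (rule runmax_ge, simp)
        then show "\<bar>runmax (\<lambda>k. f (Suc k)) n \<omega>\<bar> \<le> \<bar>runmax f (Suc n) \<omega>\<bar>"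
          by (simp add: abs_of_nonneg[OF runmax_nonneg])
      qed
      moreover have "1 / sqrt (real n) \<le> sqrt 2 / sqrt (real (Suc n))"
      proof -
        have "sqrt (real (Suc n)) \<le> sqrt (2 * real n)" using elim by (intro real_sqrt_le_mono) auto
        then show ?thesis using elim by (simp add: field_simps real_sqrt_mult)
      qed
      ultimately have "L2norm M (runmax (\<lambda>k. f (Suc k)) n) * (1 / sqrt (real n))
          \<le> L2norm M (runmax f (Suc n)) * (sqrt 2 / sqrt (real (Suc n)))"
        by (intro mult_mono) auto
      then show ?case by (simp add: mult.commute)
    qed
  qed simp
qed

section \<open>The approximation under the Maxwell-Woodroofe condition\<close>

lemma exists_power_of_two_between: "1 \<le> n \<Longrightarrow> \<exists>r. n \<le> 2 ^ r \<and> 2 ^ r \<le> 2 * n" for n :: nat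
proof (induction n rule: nat_induct_at_least)
  case base
  show ?case by (intro exI[of _ 0]) simp
next
  case (Suc n)
  then obtain r where r: "n \<le> 2 ^ r" "2 ^ r \<le> 2 * n" by blast
  show ?case
  proof (cases "Suc n \<le> 2 ^ r")
    case True
    then show ?thesis using r by (intro exI[of _ r]) simp
  next
    case False
    then have "2 ^ r = n" using r by simp
    then show ?thesis using Suc.hyps by (intro exI[of _ "Suc r"]) simp
  qed
qed

text \<open>Rounding the number of summands up to a power of two costs a factor \<open>sqrt 2\<close> at most.\<close>

lemma exists_dyadic_upper_bound:
  assumes "n \<ge> 1" shows "\<exists>r. n \<le> 2 ^ r \<and> sqrt 2 ^ r \<le> sqrt (2 * real n)"
proof -
  obtain r where r: "n \<le> 2 ^ r" "2 ^ r \<le> 2 * n" using exists_power_of_two_between[OF assms] by blast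
  have "sqrt (2 ^ r) \<le> sqrt (2 * real n)"
    using r(2) by (intro real_sqrt_le_mono) (metis of_nat_le_iff of_nat_mult of_nat_numeral of_nat_power)
  then show ?thesis using r(1) by (auto simp: real_sqrt_power)
qed

lemma (in prob_space) prob_Markov_abs:
  assumes "integrable M f" "a > 0"
  shows "prob {\<omega>\<in>space M. \<bar>f \<omega>\<bar> > a} \<le> (LINT \<omega>|M. \<bar>f \<omega>\<bar>) / a"
proof -
  have [measurable]: "f \<in> borel_measurable M" using assms(1) by simp
  have "prob {\<omega>\<in>space M. \<bar>f \<omega>\<bar> > a} \<le> prob {\<omega>\<in>space M. \<bar>f \<omega>\<bar> \<ge> a}"
    by (rule finite_measure_mono) auto
  also have "\<dots> \<le> (LINT \<omega>|M. \<bar>f \<omega>\<bar>) / a"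
    by (rule integral_Markov_inequality_measure[where A="{}"]) (use assms in auto)
  finally show ?thesis .
qed

lemma (in prob_space) prob_L2_Markov:
  assumes "square_integrable M f" "a > 0"
  shows "prob {\<omega>\<in>space M. \<bar>f \<omega>\<bar> > a} \<le> (L2norm M f)\<^sup>2 / a\<^sup>2"
proof -
  note [measurable] = square_integrable_measurable[OF assms(1)]
  have "prob {\<omega>\<in>space M. \<bar>f \<omega>\<bar> > a} \<le> prob {\<omega>\<in>space M. \<bar>f \<omega>\<bar> \<ge> a}"
    by (rule finite_measure_mono) auto
  also have "\<dots> \<le> (L2norm M f)\<^sup>2 / a\<^sup>2"
    by (rule L2norm_Markov[OF finite_measure_axioms assms])
  finally show ?thesis .
qed

lemma (in prob_space) prob_le_add3:
  fixes f g h :: "'a \<Rightarrow> real"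
  assumes [measurable]: "f \<in> borel_measurable M" "g \<in> borel_measurable M" "h \<in> borel_measurable M"
    and sub: "\<And>\<omega>. \<omega> \<in> space M \<Longrightarrow> P \<omega> \<Longrightarrow> \<bar>f \<omega>\<bar> > a \<or> \<bar>g \<omega>\<bar> > b \<or> \<bar>h \<omega>\<bar> > c"
  shows "prob {\<omega>\<in>space M. P \<omega>} \<le> prob {\<omega>\<in>space M. \<bar>f \<omega>\<bar> > a} + prob {\<omega>\<in>space M. \<bar>g \<omega>\<bar> > b}
    + prob {\<omega>\<in>space M. \<bar>h \<omega>\<bar> > c}"
proof -
  let ?A = "{\<omega>\<in>space M. \<bar>f \<omega>\<bar> > a}" and ?B = "{\<omega>\<in>space M. \<bar>g \<omega>\<bar> > b}" and ?C = "{\<omega>\<in>space M. \<bar>h \<omega>\<bar> > c}"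
  have "prob {\<omega>\<in>space M. P \<omega>} \<le> prob (?A \<union> ?B \<union> ?C)"
  proof (rule finite_measure_mono)
    show "{\<omega>\<in>space M. P \<omega>} \<subseteq> ?A \<union> ?B \<union> ?C" using sub by auto
  qed measurable
  also have "\<dots> \<le> prob (?A \<union> ?B) + prob ?C" by (rule measure_Un_le) auto
  also have "prob (?A \<union> ?B) \<le> prob ?A + prob ?B" by (rule measure_Un_le) auto
  finally show ?thesis by simp
qed

locale maxwell_woodroofe = adapted_process M F Z e for M :: "'a measure" and F Z e +
  fixes C :: real
  assumes e_summable: "summable (\<lambda>j. e j / sqrt 2 ^ j)"
    and second_moment: "\<And>n. n \<ge> 1 \<Longrightarrow> (\<Sum>l<n. (L2norm M (Z l))\<^sup>2) \<le> C * real n"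
    and lindeberg: "\<And>\<epsilon>. \<epsilon> > 0 \<Longrightarrow> (\<lambda>n. 1 / real n *
        (\<Sum>l<n. LINT \<omega>|M. (Z l \<omega>)\<^sup>2 * indicator {\<omega>. \<bar>Z l \<omega>\<bar> > \<epsilon> * sqrt (real n)} \<omega>)) \<longlonglongrightarrow> 0"
begin

definition etotal :: real where "etotal = (\<Sum>j. e j / sqrt 2 ^ j)"

lemma etotal_nonneg: "0 \<le> etotal"
  unfolding etotal_def by (rule suminf_nonneg[OF e_summable]) (simp add: e_nonneg)

lemma C_nonneg: "0 \<le> C"
  using second_moment[of 1] by (simp add: order_trans[OF zero_le_power2])

lemma sqrt2_power: "sqrt 2 ^ j * sqrt 2 ^ j = (2 :: real) ^ j"
  by (simp add: power_mult_distrib[symmetric])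

lemma e_ratio_tendsto_0: "(\<lambda>p. e p / sqrt 2 ^ p) \<longlonglongrightarrow> 0"
  by (rule summable_LIMSEQ_zero[OF e_summable])

lemma e_over_pow_tendsto_0: "(\<lambda>p. e p / 2 ^ p) \<longlonglongrightarrow> 0"
proof (rule tendsto_sandwich[OF _ _ tendsto_const e_ratio_tendsto_0])
  have "sqrt 2 ^ p \<le> (2::real) ^ p" for p by (rule power_mono) (auto simp: sqrt_le_D real_le_lsqrt)
  then show "\<forall>\<^sub>F p in sequentially. e p / 2 ^ p \<le> e p / sqrt 2 ^ p"
    by (intro always_eventually allI divide_left_mono e_nonneg) auto
qed (simp add: e_nonneg)

text \<open>Weighting the terms by \<open>sqrt 2 ^ p\<close> turns the sum into a partial sum of the Maxwell-Woodroofe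
  series.\<close>

lemma ebound_le: "ebound p \<le> sqrt 2 ^ p * etotal"
proof -
  have "ebound p \<le> (\<Sum>j<p. sqrt 2 ^ p * (e j / sqrt 2 ^ j))"
    unfolding ebound_def
  proof (rule sum_mono)
    fix j assume "j \<in> {..<p}"
    then have "sqrt 2 ^ j \<le> (sqrt 2 :: real) ^ p" by (intro power_increasing) auto
    then have "sqrt 2 ^ j * (e j / sqrt 2 ^ j) \<le> sqrt 2 ^ p * (e j / sqrt 2 ^ j)"
      by (intro mult_right_mono) (simp_all add: e_nonneg)
    then show "e j \<le> sqrt 2 ^ p * (e j / sqrt 2 ^ j)" by simp
  qed
  also have "\<dots> = sqrt 2 ^ p * (\<Sum>j<p. e j / sqrt 2 ^ j)" by (simp add: sum_distrib_left)
  also have "\<dots> \<le> sqrt 2 ^ p * etotal"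
    unfolding etotal_def
    by (intro mult_left_mono sum_le_suminf e_summable) (simp_all add: e_nonneg)
  finally show ?thesis .
qed

text \<open>A bound for the mean of \<open>2 * th * Y + Y\<^sup>2\<close>.  The norm of \<open>th p\<close> may grow like \<open>sqrt 2 ^ p\<close>,
  but that of \<open>Y p\<close> is \<open>o (1 / sqrt 2 ^ p)\<close>.\<close>

definition cross_bound :: "nat \<Rightarrow> real" where
  "cross_bound p = 2 * (ebound p * (e p / 2 ^ p)) + (e p / 2 ^ p)\<^sup>2"

lemma cross_bound_tendsto_0: "cross_bound \<longlonglongrightarrow> 0"
proof -
  have "(\<lambda>p. ebound p * (e p / 2 ^ p)) \<longlonglongrightarrow> 0"
  proof (rule tendsto_sandwich[OF _ _ tendsto_const])
    show "(\<lambda>p. etotal * (e p / sqrt 2 ^ p)) \<longlonglongrightarrow> 0"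
      by (rule tendsto_mult_right_zero[OF e_ratio_tendsto_0])
    show "\<forall>\<^sub>F p in sequentially. ebound p * (e p / 2 ^ p) \<le> etotal * (e p / sqrt 2 ^ p)"
    proof (intro always_eventually allI)
      fix p
      have "ebound p * (e p / 2 ^ p) \<le> (sqrt 2 ^ p * etotal) * (e p / 2 ^ p)"
        by (intro mult_right_mono ebound_le) (simp add: e_nonneg)
      also have "\<dots> = etotal * (e p / sqrt 2 ^ p)"
        by (simp add: sqrt2_power[symmetric])
      finally show "ebound p * (e p / 2 ^ p) \<le> etotal * (e p / sqrt 2 ^ p)" .
    qed
  qed (simp add: ebound_nonneg e_nonneg)
  then have "(\<lambda>p. 2 * (ebound p * (e p / 2 ^ p)) + (e p / 2 ^ p)\<^sup>2) \<longlonglongrightarrow> 2 * 0 + 0\<^sup>2"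
    by (intro tendsto_intros e_over_pow_tendsto_0)
  then show ?thesis by (simp add: cross_bound_def[abs_def])
qed

text \<open>The right-hand side of the dyadic maximal inequality for \<open>Y p\<close> per square root of the number
  of summands.  For each scale \<open>s\<close> the minimum tends to zero with \<open>p\<close>, and it is dominated by a
  summable sequence, so that Tannery's theorem applies.\<close>

definition remainder_bound :: "nat \<Rightarrow> real" where
  "remainder_bound p = 2 * (e p / 2 ^ p) + 3 * (\<Sum>s. min (e s) (2 ^ s * (e p / 2 ^ p)) / sqrt 2 ^ s)"

lemma remainder_terms_le: "min (e s) (2 ^ s * (e p / 2 ^ p)) / sqrt 2 ^ s \<le> e s / sqrt 2 ^ s"
  by (rule divide_right_mono) simp_all

lemma remainder_terms_nonneg: "0 \<le> min (e s) (2 ^ s * (e p / 2 ^ p)) / sqrt 2 ^ s"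
  by (simp add: e_nonneg)

lemma remainder_terms_summable: "summable (\<lambda>s. min (e s) (2 ^ s * (e p / 2 ^ p)) / sqrt 2 ^ s)"
  by (rule summable_comparison_test'[OF e_summable, of 0])
     (unfold real_norm_def abs_of_nonneg[OF remainder_terms_nonneg], rule remainder_terms_le)

lemma remainder_bound_nonneg: "0 \<le> remainder_bound p"
  unfolding remainder_bound_def
  by (intro add_nonneg_nonneg mult_nonneg_nonneg suminf_nonneg remainder_terms_summable remainder_terms_nonneg)
     (simp_all add: e_nonneg)

lemma remainder_bound_tendsto_0: "remainder_bound \<longlonglongrightarrow> 0"
proof -
  have "(\<lambda>p. \<Sum>s. min (e s) (2 ^ s * (e p / 2 ^ p)) / sqrt 2 ^ s) \<longlonglongrightarrow> (\<Sum>s. 0)"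
  proof (rule conjunct2[OF conjunct2[OF tannerys_theorem[OF _ _ e_summable]]])
    fix s
    have "(\<lambda>p. 2 ^ s * (e p / 2 ^ p)) \<longlonglongrightarrow> 0" by (rule tendsto_mult_right_zero[OF e_over_pow_tendsto_0])
    from tendsto_min[OF tendsto_const[of "e s"] this]
    have "(\<lambda>p. min (e s) (2 ^ s * (e p / 2 ^ p))) \<longlonglongrightarrow> 0" by (simp only: min_absorb2[OF e_nonneg])
    from tendsto_divide[OF this tendsto_const[of "sqrt 2 ^ s"]]
    show "(\<lambda>p. min (e s) (2 ^ s * (e p / 2 ^ p)) / sqrt 2 ^ s) \<longlonglongrightarrow> 0" by simp
    show "\<forall>\<^sub>F (k, p) in at_top \<times>\<^sub>F sequentially. norm (min (e k) (2 ^ k * (e p / 2 ^ p)) / sqrt 2 ^ k) \<le> e k / sqrt 2 ^ k"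
      unfolding real_norm_def abs_of_nonneg[OF remainder_terms_nonneg]
      by (rule always_eventually, clarify, rule remainder_terms_le)
  qed simp
  then have "(\<lambda>p. 2 * (e p / 2 ^ p) + 3 * (\<Sum>s. min (e s) (2 ^ s * (e p / 2 ^ p)) / sqrt 2 ^ s)) \<longlonglongrightarrow> 2 * 0 + 3 * 0"
    by (intro tendsto_intros e_over_pow_tendsto_0) simp
  then show ?thesis by (simp add: remainder_bound_def[abs_def])
qed

lemma L2norm_runmax_mono_index:
  assumes "m \<le> n" "\<And>k. square_integrable M (f k)"
  shows "L2norm M (runmax f m) \<le> L2norm M (runmax f n)"
proof (rule L2norm_mono)
  show "square_integrable M (runmax f n)" "runmax f m \<in> borel_measurable M"
    by (intro runmax_square_integrable square_integrable_measurable assms(2))+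
  show "\<bar>runmax f m \<omega>\<bar> \<le> \<bar>runmax f n \<omega>\<bar>" for \<omega>
    using runmax_mono[OF assms(1), of f \<omega>] by (simp add: abs_of_nonneg[OF runmax_nonneg])
qed

lemma sum_Y_maximal:
  assumes n: "n \<ge> 1"
  shows "L2norm M (runmax (\<lambda>k \<omega>. \<Sum>l<k. Y p l \<omega>) n) \<le> sqrt (2 * real n) * remainder_bound p"
proof -
  interpret Y: adapted_process M F "Y p" "\<lambda>j. min (e j) (2 ^ j * (e p / 2 ^ p))" by (rule Y_adapted_process)
  obtain r where r: "n \<le> 2 ^ r" and rr: "sqrt 2 ^ r \<le> sqrt (2 * real n)"
    using exists_dyadic_upper_bound[OF n] by blast
  have "L2norm M (runmax (\<lambda>k \<omega>. \<Sum>l<k. Y p l \<omega>) n) \<le> L2norm M (runmax (\<lambda>k \<omega>. \<Sum>l<k. Y p l \<omega>) (2 ^ r))"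
    by (intro L2norm_runmax_mono_index r square_integrable_sum Y_square_integrable)
  also have "\<dots> \<le> 2 * sqrt (\<Sum>l<2 ^ r. (L2norm M (Y p l))\<^sup>2)
      + 3 * sqrt 2 ^ r * (\<Sum>s\<le>r. min (e s) (2 ^ s * (e p / 2 ^ p)) / sqrt 2 ^ s)"
    by (rule Y.dyadic_maximal)
  also have "\<dots> \<le> 2 * (sqrt 2 ^ r * (e p / 2 ^ p))
      + 3 * sqrt 2 ^ r * (\<Sum>s. min (e s) (2 ^ s * (e p / 2 ^ p)) / sqrt 2 ^ s)"
  proof (intro add_mono mult_left_mono)
    have "(\<Sum>l<2 ^ r. (L2norm M (Y p l))\<^sup>2) \<le> (\<Sum>l<2 ^ r::nat. (e p / 2 ^ p)\<^sup>2)"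
      by (intro sum_mono power_mono L2norm_Y) simp
    then have "sqrt (\<Sum>l<2 ^ r. (L2norm M (Y p l))\<^sup>2) \<le> sqrt (2 ^ r * (e p / 2 ^ p)\<^sup>2)" by simp
    also have "\<dots> = sqrt 2 ^ r * (e p / 2 ^ p)"
      unfolding real_sqrt_mult by (simp add: real_sqrt_power e_nonneg)
    finally show "sqrt (\<Sum>l<2 ^ r. (L2norm M (Y p l))\<^sup>2) \<le> sqrt 2 ^ r * (e p / 2 ^ p)" .
    show "(\<Sum>s\<le>r. min (e s) (2 ^ s * (e p / 2 ^ p)) / sqrt 2 ^ s) \<le> (\<Sum>s. min (e s) (2 ^ s * (e p / 2 ^ p)) / sqrt 2 ^ s)"
      by (rule sum_le_suminf[OF remainder_terms_summable]) (simp, rule remainder_terms_nonneg)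
  qed simp_all
  also have "\<dots> = sqrt 2 ^ r * remainder_bound p" by (simp add: remainder_bound_def algebra_simps)
  also have "\<dots> \<le> sqrt (2 * real n) * remainder_bound p" by (rule mult_right_mono[OF rr remainder_bound_nonneg])
  finally show ?thesis .
qed

lemma S_maximal:
  assumes n: "n \<ge> 1"
  shows "L2norm M (runmax S n) \<le> sqrt (2 * real n) * (2 * sqrt C + 3 * etotal)"
proof -
  obtain r where r: "n \<le> 2 ^ r" and rr: "sqrt 2 ^ r \<le> sqrt (2 * real n)"
    using exists_dyadic_upper_bound[OF n] by blast
  have "L2norm M (runmax S n) \<le> L2norm M (runmax S (2 ^ r))"
    by (intro L2norm_runmax_mono_index r S_square_integrable)
  also have "\<dots> \<le> 2 * sqrt (\<Sum>l<2 ^ r. (L2norm M (Z l))\<^sup>2) + 3 * sqrt 2 ^ r * (\<Sum>s\<le>r. e s / sqrt 2 ^ s)"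
    using dyadic_maximal[of r] by (simp add: S_def[abs_def])
  also have "\<dots> \<le> 2 * (sqrt 2 ^ r * sqrt C) + 3 * sqrt 2 ^ r * etotal"
  proof (intro add_mono mult_left_mono)
    have "sqrt (\<Sum>l<2 ^ r. (L2norm M (Z l))\<^sup>2) \<le> sqrt (C * 2 ^ r)"
      using second_moment[of "2 ^ r"] by simp
    then show "sqrt (\<Sum>l<2 ^ r. (L2norm M (Z l))\<^sup>2) \<le> sqrt 2 ^ r * sqrt C"
      by (simp add: real_sqrt_mult real_sqrt_power mult.commute)
    show "(\<Sum>s\<le>r. e s / sqrt 2 ^ s) \<le> etotal"
      unfolding etotal_def by (rule sum_le_suminf[OF e_summable]) (auto simp: e_nonneg)
  qed simp_all
  also have "\<dots> = sqrt 2 ^ r * (2 * sqrt C + 3 * etotal)" by (simp add: algebra_simps)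
  also have "\<dots> \<le> sqrt (2 * real n) * (2 * sqrt C + 3 * etotal)"
    by (rule mult_right_mono[OF rr]) (simp add: C_nonneg etotal_nonneg)
  finally show ?thesis .
qed

end

context maxwell_woodroofe
begin

text \<open>The square of a prediction is at most the prediction of the square, and after removing
  \<open>\<epsilon>\<^sup>2 * n\<close> only large values of the summands remain, whose squares the Lindeberg condition controls in
  the mean.\<close>

lemma negligible_max_predicted:
  "negligible_max M (\<lambda>k. CE (k + a) (Z (k + s)))"
  unfolding negligible_max_def
proof (intro conjI allI)
  let ?f = "\<lambda>k. CE (k + a) (Z (k + s))"
  show sq: "square_integrable M (?f k)" for k by (rule CE_square_integrable[OF Z_square_integrable])
  define L where "L \<epsilon> n = (\<Sum>l<n. LINT \<omega>|M. (Z l \<omega>)\<^sup>2 * indicator {\<omega>. \<bar>Z l \<omega>\<bar> > \<epsilon> * sqrt (real n)} \<omega>)" for \<epsilon> n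
  \<comment> \<open>Conditional Jensen after truncation; only the indices below \<open>2 * n\<close> are involved.\<close>
  have key: "(L2norm M (runmax ?f n))\<^sup>2 \<le> \<epsilon>\<^sup>2 * real n + L (\<epsilon> / sqrt 2) (2 * n)"
    if n: "n \<ge> s + 1" and "\<epsilon> > 0" for n \<epsilon>
  proof -
    let ?c = "\<epsilon> * sqrt (real n)"
    define T where "T l \<omega> = (Z l \<omega>)\<^sup>2 * indicator {\<omega>. \<bar>Z l \<omega>\<bar> > ?c} \<omega>" for l \<omega>
    note [measurable] = square_integrable_measurable[OF Z_square_integrable]
    have Z2: "integrable M (\<lambda>\<omega>. (Z l \<omega>)\<^sup>2)" for l by (rule square_integrable_integrable_power2[OF Z_square_integrable])
    have Tm[measurable]: "T l \<in> borel_measurable M" for l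
    proof -
      have "T l = (\<lambda>\<omega>. if \<bar>Z l \<omega>\<bar> > ?c then (Z l \<omega>)\<^sup>2 else 0)"
        by (rule ext) (simp add: T_def indicator_def)
      then show ?thesis by simp
    qed
    have T0: "0 \<le> T l \<omega>" for l \<omega> by (simp add: T_def)
    have Tint: "integrable M (T l)" for l
      by (rule Bochner_Integration.integrable_bound[OF Z2[of l] Tm]) (simp add: T_def indicator_def)
    have pt: "AE \<omega> in M. (?f k \<omega>)\<^sup>2 \<le> ?c\<^sup>2 + CE (k + a) (T (k + s)) \<omega>" for k
    proof -
      have "AE \<omega> in M. (?f k \<omega>)\<^sup>2 \<le> CE (k + a) (\<lambda>\<omega>. (Z (k + s) \<omega>)\<^sup>2) \<omega>"
        by (rule CE_power2_le[OF Z_square_integrable])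
      moreover have "AE \<omega> in M. CE (k + a) (\<lambda>\<omega>. (Z (k + s) \<omega>)\<^sup>2) \<omega> \<le> CE (k + a) (\<lambda>\<omega>. ?c\<^sup>2 + T (k + s) \<omega>) \<omega>"
      proof (rule sigma_finite_subalgebra.real_cond_exp_mono[OF sigma_finite_subalgebra_F _ Z2])
        show "integrable M (\<lambda>\<omega>. ?c\<^sup>2 + T (k + s) \<omega>)" using Tint by simp
        have "(Z (k + s) \<omega>)\<^sup>2 \<le> ?c\<^sup>2 + T (k + s) \<omega>" for \<omega>
        proof (cases "\<bar>Z (k + s) \<omega>\<bar> > ?c")
          case True
          then have "T (k + s) \<omega> = (Z (k + s) \<omega>)\<^sup>2" by (simp add: T_def)
          then show ?thesis by simp
        next
          case False
          then have "(Z (k + s) \<omega>)\<^sup>2 \<le> ?c\<^sup>2" by (intro abs_le_square_iff[THEN iffD1]) simp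
          then show ?thesis using T0[of "k + s" \<omega>] by linarith
        qed
        then show "AE \<omega> in M. (Z (k + s) \<omega>)\<^sup>2 \<le> ?c\<^sup>2 + T (k + s) \<omega>" by simp
      qed
      moreover have "AE \<omega> in M. CE (k + a) (\<lambda>\<omega>. ?c\<^sup>2 + T (k + s) \<omega>) \<omega> = CE (k + a) (\<lambda>\<omega>. ?c\<^sup>2) \<omega> + CE (k + a) (T (k + s)) \<omega>"
        by (rule CE_add[OF _ Tint]) simp
      moreover have "AE \<omega> in M. CE (k + a) (\<lambda>\<omega>. ?c\<^sup>2) \<omega> = ?c\<^sup>2" by (rule CE_F_meas) simp_all
      ultimately show ?thesis by eventually_elim linarith
    qed
    have pos: "AE \<omega> in M. 0 \<le> CE (k + a) (T (k + s)) \<omega>" for k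
      by (rule sigma_finite_subalgebra.real_cond_exp_pos[OF sigma_finite_subalgebra_F _ Tm]) (simp add: T0)
    have "AE \<omega> in M. \<forall>k. (?f k \<omega>)\<^sup>2 \<le> ?c\<^sup>2 + CE (k + a) (T (k + s)) \<omega> \<and> 0 \<le> CE (k + a) (T (k + s)) \<omega>"
      unfolding AE_all_countable using pt pos by (intro allI AE_conjI)
    then have "AE \<omega> in M. (runmax ?f n \<omega>)\<^sup>2 \<le> ?c\<^sup>2 + (\<Sum>k\<le>n. CE (k + a) (T (k + s)) \<omega>)"
    proof eventually_elim
      case (elim \<omega>)
      obtain k where k: "k \<le> n" "runmax ?f n \<omega> = \<bar>?f k \<omega>\<bar>" using runmax_attained[of n ?f \<omega>] by blast
      have "CE (k + a) (T (k + s)) \<omega> \<le> (\<Sum>k\<le>n. CE (k + a) (T (k + s)) \<omega>)"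
        by (rule member_le_sum) (use k(1) elim in auto)
      then show ?case using elim[rule_format, of k] k(2) by simp
    qed
    then have "(L2norm M (runmax ?f n))\<^sup>2 \<le> (LINT \<omega>|M. ?c\<^sup>2 + (\<Sum>k\<le>n. CE (k + a) (T (k + s)) \<omega>))"
      unfolding L2norm_power2
      by (intro integral_mono_AE square_integrable_integrable_power2 runmax_square_integrable sq
          Bochner_Integration.integrable_add Bochner_Integration.integrable_sum CE_integrable Tint
          square_integrable_const)
    also have "\<dots> = ?c\<^sup>2 + (\<Sum>k\<le>n. LINT \<omega>|M. T (k + s) \<omega>)"
      using CE_integrable[OF Tint] CE_integral[OF Tint] by (simp add: prob_space)
    also have "(\<Sum>k\<le>n. LINT \<omega>|M. T (k + s) \<omega>) = (\<Sum>l\<in>(\<lambda>k. k + s) ` {..n}. LINT \<omega>|M. T l \<omega>)"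
      by (subst sum.reindex) (auto intro: inj_onI)
    also have "\<dots> \<le> (\<Sum>l<2 * n. LINT \<omega>|M. T l \<omega>)"
      by (rule sum_mono2) (use n T0 in auto)
    also have "?c\<^sup>2 = \<epsilon>\<^sup>2 * real n" by (simp add: power_mult_distrib)
    also have "(\<Sum>l<2 * n. LINT \<omega>|M. T l \<omega>) = L (\<epsilon> / sqrt 2) (2 * n)"
      by (simp add: L_def T_def real_sqrt_mult)
    finally show ?thesis by simp
  qed
  show "(\<lambda>n. L2norm M (runmax ?f n) / sqrt (real n)) \<longlonglongrightarrow> 0"
  proof (rule LIMSEQ_I)
    fix r :: real assume r: "r > 0"
    define \<epsilon> where "\<epsilon> = r / 2"
    have \<epsilon>: "\<epsilon> > 0" using r by (simp add: \<epsilon>_def)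
    have "(\<lambda>n. 1 / real n * L (\<epsilon> / sqrt 2) n) \<longlonglongrightarrow> 0"
      unfolding L_def by (rule lindeberg) (use \<epsilon> in simp)
    then have "\<forall>\<^sub>F n in sequentially. 1 / real n * L (\<epsilon> / sqrt 2) n < \<epsilon>\<^sup>2"
      by (rule order_tendstoD) (use \<epsilon> in simp)
    then obtain N0 where N0: "\<And>n. n \<ge> N0 \<Longrightarrow> 1 / real n * L (\<epsilon> / sqrt 2) n < \<epsilon>\<^sup>2"
      by (auto simp: eventually_sequentially)
    show "\<exists>no. \<forall>n\<ge>no. norm (L2norm M (runmax ?f n) / sqrt (real n) - 0) < r"
    proof (intro exI[of _ "N0 + s + 1"] allI impI)
      fix n assume n: "n \<ge> N0 + s + 1"
      then have np: "real n > 0" by simp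
      have "L (\<epsilon> / sqrt 2) (2 * n) < \<epsilon>\<^sup>2 * (2 * real n)"
        using N0[of "2 * n"] n np by (simp add: field_simps)
      then have "(L2norm M (runmax ?f n))\<^sup>2 < 3 * \<epsilon>\<^sup>2 * real n"
        using key[OF _ \<epsilon>, of n] n by simp
      also have "\<dots> \<le> (r * sqrt (real n))\<^sup>2"
        using np by (simp add: \<epsilon>_def power_divide power_mult_distrib)
      finally have "L2norm M (runmax ?f n) < r * sqrt (real n)"
        by (rule power2_less_imp_less) (use r in simp)
      then show "norm (L2norm M (runmax ?f n) / sqrt (real n) - 0) < r"
        using np by (simp add: pos_divide_less_eq)
    qed
  qed
qed

lemma CE_increment:
  "AE \<omega> in M. CE k (\<lambda>\<omega>. S (k + i) \<omega> - S k \<omega>) \<omega> = (\<Sum>s<i. CE k (Z (k + s)) \<omega>)"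
proof -
  have "(\<lambda>\<omega>. S (k + i) \<omega> - S k \<omega>) = (\<lambda>\<omega>. \<Sum>s<i. Z (k + s) \<omega>)"
  proof
    fix \<omega> show "S (k + i) \<omega> - S k \<omega> = (\<Sum>s<i. Z (k + s) \<omega>)"
      by (induction i) (simp_all add: S_Suc)
  qed
  then show ?thesis
    using CE_sum[of "{..<i}" "\<lambda>s. Z (k + s)" k] square_integrable_integrable[OF Z_square_integrable] by simp
qed

lemma negligible_max_CE_increment: "negligible_max M (\<lambda>k. CE k (\<lambda>\<omega>. S (k + i) \<omega> - S k \<omega>))"
proof (rule negligible_max_cong_AE[OF _ _ CE_increment])
  show "negligible_max M (\<lambda>k \<omega>. \<Sum>s<i. CE k (Z (k + s)) \<omega>)"
    using negligible_max_predicted[of 0] by (intro negligible_max_sum) simp_all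
  show "square_integrable M (CE k (\<lambda>\<omega>. S (k + i) \<omega> - S k \<omega>))" for k
    by (rule CE_square_integrable[OF S_increment_square_integrable])
qed

lemma negligible_max_th: "negligible_max M (th p)"
  unfolding th_def[abs_def]
  by (intro negligible_max_cmult negligible_max_sum negligible_max_CE_increment) simp

lemma negligible_max_Y: "negligible_max M (Y p)"
  unfolding Y_def[abs_def] by (intro negligible_max_cmult negligible_max_CE_increment)

lemma negligible_max_Z: "negligible_max M Z"
proof (rule negligible_max_cong_AE)
  show "negligible_max M (\<lambda>k. CE (k + 1) (Z (k + 0)))" by (rule negligible_max_predicted)
  show "AE \<omega> in M. Z k \<omega> = CE (k + 1) (Z (k + 0)) \<omega>" for k
    using CE_F_meas[OF square_integrable_integrable[OF Z_square_integrable], of k "Suc k"] Z_measurable[of k]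
    by auto
qed (rule Z_square_integrable)

lemma negligible_max_D: "negligible_max M (D p)"
  unfolding D_def[abs_def]
  by (intro negligible_max_diff negligible_max_add negligible_max_Z negligible_max_th negligible_max_Y
      negligible_max_Suc[OF negligible_max_th])

text \<open>A bound for the average second moment of \<open>D p\<close>.  It may grow with \<open>p\<close>, so it is used only for
  fixed \<open>p\<close>.\<close>

definition Dbound :: "nat \<Rightarrow> real" where
  "Dbound p = 2 * C + 2 * (2 * ebound p + e p / 2 ^ p)\<^sup>2"

lemma Dbound_nonneg: "0 \<le> Dbound p"
  by (simp add: Dbound_def C_nonneg)

lemma sum_L2norm_D:
  assumes n: "n \<ge> 1" shows "(\<Sum>l<n. (L2norm M (D p l))\<^sup>2) \<le> Dbound p * real n"
proof -
  let ?b = "2 * ebound p + e p / 2 ^ p"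
  have "(L2norm M (D p l))\<^sup>2 \<le> 2 * (L2norm M (Z l))\<^sup>2 + 2 * ?b\<^sup>2" for l
  proof -
    let ?r = "\<lambda>\<omega>. th p (Suc l) \<omega> - th p l \<omega> - Y p l \<omega>"
    have D: "D p l = (\<lambda>\<omega>. Z l \<omega> + ?r \<omega>)" by (rule ext) (simp add: D_def)
    have r: "L2norm M ?r \<le> ?b"
      using L2norm_triangle_diff[OF square_integrable_diff[OF th_square_integrable[of p "Suc l"] th_square_integrable[of p l]] Y_square_integrable[of p l]]
        L2norm_triangle_diff[OF th_square_integrable[of p "Suc l"] th_square_integrable[of p l]]
        L2norm_th[of p "Suc l"] L2norm_th[of p l] L2norm_Y[of p l] by linarith
    have "L2norm M (D p l) \<le> L2norm M (Z l) + L2norm M ?r"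
      unfolding D by (intro L2norm_triangle Z_square_integrable square_integrable_diff th_square_integrable Y_square_integrable)
    then have "L2norm M (D p l) \<le> L2norm M (Z l) + ?b" using r by linarith
    then have "(L2norm M (D p l))\<^sup>2 \<le> (L2norm M (Z l) + ?b)\<^sup>2" by (intro power_mono) auto
    also have "\<dots> \<le> 2 * (L2norm M (Z l))\<^sup>2 + 2 * ?b\<^sup>2"
    proof -
      have "(x + y)\<^sup>2 \<le> 2 * x\<^sup>2 + 2 * y\<^sup>2" for x y :: real
        using sum_squares_bound[of x y] by (simp add: power2_sum)
      then show ?thesis .
    qed
    finally show ?thesis .
  qed
  then have "(\<Sum>l<n. (L2norm M (D p l))\<^sup>2) \<le> (\<Sum>l<n. 2 * (L2norm M (Z l))\<^sup>2 + 2 * ?b\<^sup>2)" by (intro sum_mono)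
  also have "\<dots> = 2 * (\<Sum>l<n. (L2norm M (Z l))\<^sup>2) + real n * (2 * ?b\<^sup>2)"
    by (simp add: sum.distrib sum_distrib_left)
  also have "\<dots> \<le> 2 * (C * real n) + real n * (2 * ?b\<^sup>2)" using second_moment[OF n] by simp
  finally show ?thesis by (simp add: Dbound_def algebra_simps)
qed

text \<open>A predictable factor that is uniformly negligible on the scale of the square root makes the
  martingale transform negligible on the linear scale.\<close>

lemma transform_negligible:
  assumes V: "negligible_max M V" "\<And>l. V l \<in> borel_measurable (F l)" and d: "d > 0" and \<eta>: "\<eta> > 0"
  shows "\<forall>\<^sub>F n in sequentially. \<forall>k\<le>n. prob {\<omega>\<in>space M. \<bar>\<Sum>l<k. V l \<omega> * D p l \<omega>\<bar> > d * real n} \<le> \<eta>"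
proof -
  \<comment> \<open>The factor is cut off at \<open>t * sqrt n\<close>; this \<open>t\<close> makes the bound of the truncated transform
    from Chebyshev's inequality at most \<open>\<eta> / 2\<close>, and the cut is inactive with large probability.\<close>
  define t where "t = d * sqrt (\<eta> / (2 * (Dbound p + 1)))"
  have t: "t > 0" using d \<eta> Dbound_nonneg[of p] by (simp add: t_def)
  have t2: "t\<^sup>2 * Dbound p / d\<^sup>2 \<le> \<eta> / 2"
  proof -
    have "t\<^sup>2 * Dbound p / d\<^sup>2 = \<eta> / 2 * (Dbound p / (Dbound p + 1))"
      using d \<eta> Dbound_nonneg[of p] by (simp add: t_def power_mult_distrib)
    also have "\<dots> \<le> \<eta> / 2 * 1"
      using \<eta> Dbound_nonneg[of p] by (intro mult_left_mono) (auto simp: divide_le_eq_1)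
    finally show ?thesis by simp
  qed
  note Vsq = negligible_max_square_integrable[OF V(1)]
  have "(\<lambda>n. (L2norm M (runmax V n) / sqrt (real n))\<^sup>2 / t\<^sup>2) \<longlonglongrightarrow> 0\<^sup>2 / t\<^sup>2"
    by (intro tendsto_intros negligible_max_tendsto[OF V(1)]) (use t in simp)
  then have "(\<lambda>n. (L2norm M (runmax V n) / sqrt (real n))\<^sup>2 / t\<^sup>2) \<longlonglongrightarrow> 0" by simp
  then have "\<forall>\<^sub>F n in sequentially. (L2norm M (runmax V n) / sqrt (real n))\<^sup>2 / t\<^sup>2 < \<eta> / 2"
    by (rule order_tendstoD) (use \<eta> in simp)
  then show ?thesis using eventually_ge_at_top[of 1]
  proof eventually_elim
    case (elim n)
    then have n: "real n > 0" by simp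
    show ?case
    proof (intro allI impI)
      fix k assume k: "k \<le> n"
      let ?c = "t * sqrt (real n)"
      define V' where "V' l \<omega> = of_bool (\<bar>V l \<omega>\<bar> \<le> ?c) * V l \<omega>" for l \<omega>
      have V'm: "V' l \<in> borel_measurable (F l)" for l using V(2)[of l] unfolding V'_def[abs_def] by measurable
      have V'b: "\<bar>V' l \<omega>\<bar> \<le> ?c" for l \<omega> using t by (simp add: V'_def)
      have md: "martingale_diff (\<lambda>l \<omega>. V' l \<omega> * D p l \<omega>)"
        by (rule martingale_diff_transform[OF D_martingale V'm V'b])
      let ?W = "\<lambda>\<omega>. \<Sum>l<k. V' l \<omega> * D p l \<omega>"
      have Wsq: "square_integrable M ?W" by (rule martingale_square_integrable[OF md])
      have "(L2norm M (\<lambda>\<omega>. V' l \<omega> * D p l \<omega>))\<^sup>2 \<le> ?c\<^sup>2 * (L2norm M (D p l))\<^sup>2" for l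
      proof -
        have "L2norm M (\<lambda>\<omega>. V' l \<omega> * D p l \<omega>) \<le> L2norm M (\<lambda>\<omega>. ?c * D p l \<omega>)"
        proof (rule L2norm_mono)
          show "square_integrable M (\<lambda>\<omega>. ?c * D p l \<omega>)" by (rule square_integrable_cmult[OF D_square_integrable])
          show "(\<lambda>\<omega>. V' l \<omega> * D p l \<omega>) \<in> borel_measurable M" by (rule martingale_diffD(4)[OF md])
          show "\<bar>V' l \<omega> * D p l \<omega>\<bar> \<le> \<bar>?c * D p l \<omega>\<bar>" for \<omega>
            unfolding abs_mult[of _ "D p l \<omega>"]
            by (intro mult_right_mono order_trans[OF V'b abs_ge_self]) simp
        qed
        then have "(L2norm M (\<lambda>\<omega>. V' l \<omega> * D p l \<omega>))\<^sup>2 \<le> (\<bar>?c\<bar> * L2norm M (D p l))\<^sup>2"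
          unfolding L2norm_cmult by (rule power_mono) simp
        then show ?thesis by (simp only: power_mult_distrib power2_abs)
      qed
      then have "(L2norm M ?W)\<^sup>2 \<le> (\<Sum>l<k. ?c\<^sup>2 * (L2norm M (D p l))\<^sup>2)"
        unfolding martingale_L2norm[OF md] by (intro sum_mono)
      also have "\<dots> \<le> (\<Sum>l<n. ?c\<^sup>2 * (L2norm M (D p l))\<^sup>2)"
        by (rule sum_mono2) (use k in auto)
      also have "\<dots> = ?c\<^sup>2 * (\<Sum>l<n. (L2norm M (D p l))\<^sup>2)" by (simp add: sum_distrib_left)
      also have "\<dots> \<le> ?c\<^sup>2 * (Dbound p * real n)"
        by (intro mult_left_mono sum_L2norm_D elim) simp
      finally have W2: "(L2norm M ?W)\<^sup>2 / (d * real n)\<^sup>2 \<le> t\<^sup>2 * Dbound p / d\<^sup>2"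
        using n d by (simp add: power_mult_distrib field_simps power2_eq_square)
      note [measurable] = square_integrable_measurable[OF Wsq]
        square_integrable_measurable[OF runmax_square_integrable[OF Vsq]]
      have "prob {\<omega>\<in>space M. \<bar>\<Sum>l<k. V l \<omega> * D p l \<omega>\<bar> > d * real n}
          \<le> prob {\<omega>\<in>space M. \<bar>?W \<omega>\<bar> > d * real n} + prob {\<omega>\<in>space M. \<bar>runmax V n \<omega>\<bar> > ?c}
            + prob {\<omega>\<in>space M. \<bar>0\<bar> > (0::real)}"
      proof (rule prob_le_add3)
        fix \<omega> assume w: "d * real n < \<bar>\<Sum>l<k. V l \<omega> * D p l \<omega>\<bar>"
        show "d * real n < \<bar>?W \<omega>\<bar> \<or> ?c < \<bar>runmax V n \<omega>\<bar> \<or> 0 < \<bar>0 :: real\<bar>"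
        proof (cases "runmax V n \<omega> \<le> ?c")
          case True
          then have "V' l \<omega> = V l \<omega>" if "l < k" for l
            using that k by (simp add: V'_def runmax_le_iff)
          then have "?W \<omega> = (\<Sum>l<k. V l \<omega> * D p l \<omega>)" by (intro sum.cong) auto
          then show ?thesis using w by simp
        next
          case False
          then have "?c < \<bar>runmax V n \<omega>\<bar>" by linarith
          then show ?thesis by blast
        qed
      qed simp_all
      also have "prob {\<omega>\<in>space M. \<bar>?W \<omega>\<bar> > d * real n} \<le> (L2norm M ?W)\<^sup>2 / (d * real n)\<^sup>2"
        by (rule prob_L2_Markov[OF Wsq]) (use n d in simp)
      also have "\<dots> \<le> \<eta> / 2" using W2 t2 by (rule order_trans)
      also have "prob {\<omega>\<in>space M. \<bar>runmax V n \<omega>\<bar> > ?c} \<le> (L2norm M (runmax V n))\<^sup>2 / ?c\<^sup>2"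
        by (rule prob_L2_Markov[OF runmax_square_integrable[OF Vsq]]) (use n t in simp)
      also have "(L2norm M (runmax V n))\<^sup>2 / ?c\<^sup>2 = (L2norm M (runmax V n) / sqrt (real n))\<^sup>2 / t\<^sup>2"
        using n by (simp add: power_mult_distrib power_divide mult.commute)
      finally have "prob {\<omega>\<in>space M. \<bar>\<Sum>l<k. V l \<omega> * D p l \<omega>\<bar> > d * real n}
          \<le> \<eta> / 2 + (L2norm M (runmax V n) / sqrt (real n))\<^sup>2 / t\<^sup>2" by simp
      then show "prob {\<omega>\<in>space M. \<bar>\<Sum>l<k. V l \<omega> * D p l \<omega>\<bar> > d * real n} \<le> \<eta>"
        using elim(1) by linarith
    qed
  qed
qed

text \<open>Of the three corrections in the formula for the squares, the telescoping one is bounded in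
  mean, the martingale transform is negligible, and the last one has mean at most \<open>n * cross_bound p\<close>.\<close>

lemma quadratic_variation:
  assumes \<epsilon>: "\<epsilon> > 0" and \<eta>: "\<eta> > 0"
  shows "\<forall>\<^sub>F n in sequentially. \<forall>k\<le>n. prob {\<omega>\<in>space M.
      \<bar>(\<Sum>l<k. (D p l \<omega>)\<^sup>2) - (\<Sum>l<k. (Z l \<omega>)\<^sup>2 + 2 * Z l \<omega> * th p (Suc l) \<omega>)\<bar> > 3 * \<epsilon> * real n}
    \<le> cross_bound p / \<epsilon> + \<eta>"
proof -
  let ?V = "\<lambda>l \<omega>. th p l \<omega> + Y p l \<omega>"
  have V: "negligible_max M ?V" by (intro negligible_max_add negligible_max_th negligible_max_Y)
  have Vm: "?V l \<in> borel_measurable (F l)" for l using th_measurable[of p l] Y_measurable[of p l] by measurable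
  have "\<forall>\<^sub>F n in sequentially. \<forall>k\<le>n. prob {\<omega>\<in>space M. \<bar>\<Sum>l<k. ?V l \<omega> * D p l \<omega>\<bar> > (\<epsilon> / 2) * real n} \<le> \<eta> / 2"
    by (rule transform_negligible[OF V Vm]) (use \<epsilon> \<eta> in simp_all)
  moreover have "\<forall>\<^sub>F n in sequentially. 2 * (ebound p)\<^sup>2 / \<epsilon> / real n < \<eta> / 2"
    by (rule order_tendstoD[OF lim_const_over_n]) (use \<eta> in simp)
  ultimately show ?thesis using eventually_ge_at_top[of 1]
  proof eventually_elim
    case (elim n)
    then have n: "real n > 0" by simp
    show ?case
    proof (intro allI impI)
      fix k assume k: "k \<le> n"
      let ?T1 = "\<lambda>\<omega>. (th p k \<omega>)\<^sup>2 - (th p 0 \<omega>)\<^sup>2"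
      let ?T2 = "\<lambda>\<omega>. \<Sum>l<k. ?V l \<omega> * D p l \<omega>"
      let ?T3 = "\<lambda>\<omega>. \<Sum>l<k. 2 * (th p l \<omega> * Y p l \<omega>) + (Y p l \<omega>)\<^sup>2"
      note thi = square_integrable_integrable_power2[OF th_square_integrable]
      note Yi = square_integrable_integrable_power2[OF Y_square_integrable]
      note thY = square_integrable_mult[OF th_square_integrable Y_square_integrable]
      have i1: "integrable M ?T1" using thi by simp
      have i2: "integrable M ?T2"
        by (intro Bochner_Integration.integrable_sum square_integrable_mult square_integrable_add
            th_square_integrable Y_square_integrable D_square_integrable)
      have i3: "integrable M ?T3" using thY Yi by simp
      have "prob {\<omega>\<in>space M. \<bar>(\<Sum>l<k. (D p l \<omega>)\<^sup>2) - (\<Sum>l<k. (Z l \<omega>)\<^sup>2 + 2 * Z l \<omega> * th p (Suc l) \<omega>)\<bar> > 3 * \<epsilon> * real n}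
        \<le> prob {\<omega>\<in>space M. \<bar>?T1 \<omega>\<bar> > \<epsilon> * real n} + prob {\<omega>\<in>space M. \<bar>?T2 \<omega>\<bar> > (\<epsilon> / 2) * real n}
          + prob {\<omega>\<in>space M. \<bar>?T3 \<omega>\<bar> > \<epsilon> * real n}"
        (is "?P \<le> ?P1 + ?P2 + ?P3")
      proof (rule prob_le_add3)
        fix \<omega>
        assume "3 * \<epsilon> * real n < \<bar>(\<Sum>l<k. (D p l \<omega>)\<^sup>2) - (\<Sum>l<k. (Z l \<omega>)\<^sup>2 + 2 * Z l \<omega> * th p (Suc l) \<omega>)\<bar>"
        then have "3 * (\<epsilon> * real n) < \<bar>?T1 \<omega> - 2 * ?T2 \<omega> - ?T3 \<omega>\<bar>"
          unfolding sum_D_power2 by simp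
        then show "\<epsilon> * real n < \<bar>?T1 \<omega>\<bar> \<or> (\<epsilon> / 2) * real n < \<bar>?T2 \<omega>\<bar> \<or> \<epsilon> * real n < \<bar>?T3 \<omega>\<bar>"
          by (simp del: abs_less_iff) linarith
      qed (use i1 i2 i3 in simp_all)
      also have "?P1 \<le> (LINT \<omega>|M. \<bar>?T1 \<omega>\<bar>) / (\<epsilon> * real n)"
        by (rule prob_Markov_abs[OF i1]) (use \<epsilon> n in simp)
      also have "\<dots> \<le> \<eta> / 2"
      proof -
        have "(LINT \<omega>|M. \<bar>?T1 \<omega>\<bar>) \<le> (LINT \<omega>|M. (th p k \<omega>)\<^sup>2 + (th p 0 \<omega>)\<^sup>2)"
        proof (rule integral_mono)
          show "integrable M (\<lambda>\<omega>. \<bar>?T1 \<omega>\<bar>)" using i1 by simp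
          show "integrable M (\<lambda>\<omega>. (th p k \<omega>)\<^sup>2 + (th p 0 \<omega>)\<^sup>2)" using thi by simp
          show "\<bar>?T1 \<omega>\<bar> \<le> (th p k \<omega>)\<^sup>2 + (th p 0 \<omega>)\<^sup>2" for \<omega>
            using zero_le_power2[of "th p k \<omega>"] zero_le_power2[of "th p 0 \<omega>"] by linarith
        qed
        also have "\<dots> = (L2norm M (th p k))\<^sup>2 + (L2norm M (th p 0))\<^sup>2" using thi by (simp add: L2norm_power2)
        also have "\<dots> \<le> (ebound p)\<^sup>2 + (ebound p)\<^sup>2" by (intro add_mono power_mono L2norm_th) simp_all
        finally have "(LINT \<omega>|M. \<bar>?T1 \<omega>\<bar>) / (\<epsilon> * real n) \<le> (2 * (ebound p)\<^sup>2) / (\<epsilon> * real n)"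
          using \<epsilon> n by (intro divide_right_mono) simp_all
        also have "\<dots> = 2 * (ebound p)\<^sup>2 / \<epsilon> / real n" by simp
        finally show ?thesis using elim(2) by linarith
      qed
      also have "?P2 \<le> \<eta> / 2" using elim(1) k by blast
      also have "?P3 \<le> (LINT \<omega>|M. \<bar>?T3 \<omega>\<bar>) / (\<epsilon> * real n)"
        by (rule prob_Markov_abs[OF i3]) (use \<epsilon> n in simp)
      also have "\<dots> \<le> cross_bound p / \<epsilon>"
      proof -
        have "(LINT \<omega>|M. \<bar>?T3 \<omega>\<bar>) \<le> (LINT \<omega>|M. (\<Sum>l<k. 2 * \<bar>th p l \<omega> * Y p l \<omega>\<bar> + (Y p l \<omega>)\<^sup>2))"
        proof (rule integral_mono)
          show "integrable M (\<lambda>\<omega>. \<bar>?T3 \<omega>\<bar>)" using i3 by simp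
          show "integrable M (\<lambda>\<omega>. \<Sum>l<k. 2 * \<bar>th p l \<omega> * Y p l \<omega>\<bar> + (Y p l \<omega>)\<^sup>2)" using thY Yi by simp
          show "\<bar>?T3 \<omega>\<bar> \<le> (\<Sum>l<k. 2 * \<bar>th p l \<omega> * Y p l \<omega>\<bar> + (Y p l \<omega>)\<^sup>2)" for \<omega>
            by (rule order_trans[OF sum_abs sum_mono]) (simp add: abs_mult order_trans[OF abs_triangle_ineq])
        qed
        also have "\<dots> = (\<Sum>l<k. 2 * (LINT \<omega>|M. \<bar>th p l \<omega> * Y p l \<omega>\<bar>) + (L2norm M (Y p l))\<^sup>2)"
          using thY Yi by (simp add: L2norm_power2)
        also have "\<dots> \<le> (\<Sum>l<k. cross_bound p)"
        proof (rule sum_mono)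
          fix l
          have "(LINT \<omega>|M. \<bar>th p l \<omega> * Y p l \<omega>\<bar>) \<le> L2norm M (th p l) * L2norm M (Y p l)"
            by (rule L2norm_Cauchy_Schwarz[OF th_square_integrable Y_square_integrable])
          also have "\<dots> \<le> ebound p * (e p / 2 ^ p)"
            by (intro mult_mono L2norm_th L2norm_Y ebound_nonneg) simp
          finally have "(LINT \<omega>|M. \<bar>th p l \<omega> * Y p l \<omega>\<bar>) \<le> ebound p * (e p / 2 ^ p)" .
          moreover have "(L2norm M (Y p l))\<^sup>2 \<le> (e p / 2 ^ p)\<^sup>2" by (intro power_mono L2norm_Y) simp
          ultimately show "2 * (LINT \<omega>|M. \<bar>th p l \<omega> * Y p l \<omega>\<bar>) + (L2norm M (Y p l))\<^sup>2 \<le> cross_bound p"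
            unfolding cross_bound_def by linarith
        qed
        also have "\<dots> \<le> real n * cross_bound p"
          using k by (simp add: mult_right_mono cross_bound_def ebound_nonneg e_nonneg)
        finally show ?thesis using \<epsilon> n by (simp add: field_simps)
      qed
      finally show "?P \<le> cross_bound p / \<epsilon> + \<eta>" by simp
    qed
  qed
qed

text \<open>The difference consists of the boundary terms of the coboundary, negligible for fixed \<open>p\<close>,
  and of the partial sums of \<open>Y p\<close>, to which the dyadic maximal inequality applies.\<close>

lemma martingale_approximation:
  assumes \<eta>: "\<eta> > 0"
  shows "\<forall>\<^sub>F n in sequentially.
    L2norm M (runmax (\<lambda>k \<omega>. S k \<omega> - (\<Sum>l<k. D p l \<omega>)) n) / sqrt (real n) \<le> 2 * remainder_bound p + \<eta>"
proof -
  let ?T = "\<lambda>k \<omega>. \<Sum>l<k. Y p l \<omega>"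
  let ?U = "\<lambda>k \<omega>. th p 0 \<omega> - th p k \<omega>"
  have th0: "negligible_max M (\<lambda>k. th p 0)"
    unfolding negligible_max_def
  proof (intro conjI allI th_square_integrable)
    have "runmax (\<lambda>k. th p 0) n = (\<lambda>\<omega>. \<bar>th p 0 \<omega>\<bar>)" for n
      by (rule ext, induction n) (simp_all add: runmax_0 runmax_Suc)
    then have "L2norm M (runmax (\<lambda>k. th p 0) n) = L2norm M (th p 0)" for n by (simp add: L2norm_abs)
    then show "(\<lambda>n. L2norm M (runmax (\<lambda>k. th p 0) n) / sqrt (real n)) \<longlonglongrightarrow> 0"
      by (auto intro!: tendsto_divide_0[OF tendsto_const] filterlim_at_top_imp_at_infinity
          filterlim_compose[OF sqrt_at_top filterlim_real_sequentially])
  qed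
  have U: "negligible_max M ?U" by (intro negligible_max_diff th0 negligible_max_th)
  have "\<forall>\<^sub>F n in sequentially. L2norm M (runmax ?U n) / sqrt (real n) < \<eta>"
    by (rule order_tendstoD(2)[OF negligible_max_tendsto[OF U] \<eta>])
  then show ?thesis using eventually_ge_at_top[of 1]
  proof eventually_elim
    case (elim n)
    then have n: "real n > 0" by simp
    have eq: "(\<lambda>k \<omega>. S k \<omega> - (\<Sum>l<k. D p l \<omega>)) = (\<lambda>k \<omega>. ?U k \<omega> + ?T k \<omega>)"
      by (intro ext) (simp add: S_eq_martingale[of _ _ p])
    have "L2norm M (runmax (\<lambda>k \<omega>. ?U k \<omega> + ?T k \<omega>) n) \<le> L2norm M (runmax ?U n) + L2norm M (runmax ?T n)"
      by (rule L2norm_runmax_add[OF negligible_max_square_integrable[OF U]])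
         (intro square_integrable_sum Y_square_integrable)
    also have "L2norm M (runmax ?T n) \<le> sqrt (2 * real n) * remainder_bound p" by (rule sum_Y_maximal) (use elim in simp)
    finally have 1: "L2norm M (runmax (\<lambda>k \<omega>. ?U k \<omega> + ?T k \<omega>) n) / sqrt (real n)
        \<le> L2norm M (runmax ?U n) / sqrt (real n) + sqrt 2 * remainder_bound p"
      using n by (simp add: field_simps real_sqrt_mult)
    have "sqrt (2::real) \<le> 2" by (rule real_le_lsqrt) auto
    then have "sqrt 2 * remainder_bound p \<le> 2 * remainder_bound p" by (rule mult_right_mono[OF _ remainder_bound_nonneg])
    then show ?case using 1 elim(1) unfolding eq by linarith
  qed
qed

end

section \<open>A central limit theorem for martingale arrays\<close>

lemma abs_exp_minus_diff_le:
  fixes a b :: real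
  assumes "0 \<le> a" "0 \<le> b"
  shows "\<bar>exp (- a) - exp (- b)\<bar> \<le> \<bar>a - b\<bar>"
proof -
  have *: "exp (- x) - exp (- y) \<le> y - x" if "0 \<le> x" "x \<le> y" for x y :: real
  proof -
    have "exp (- x) - exp (- y) = exp (- x) * (1 - exp (- (y - x)))"
      by (simp add: right_diff_distrib exp_add[symmetric])
    also have "\<dots> \<le> 1 * (y - x)"
    proof (rule mult_mono)
      show "1 - exp (- (y - x)) \<le> y - x" using exp_ge_add_one_self[of "- (y - x)"] by linarith
    qed (use that in simp_all)
    finally show ?thesis by simp
  qed
  show ?thesis
  proof (cases "a \<le> b")
    case True then show ?thesis using *[of a b] assms by simp
  next
    case False then show ?thesis using *[of b a] assms by simp
  qed
qed

text \<open>Compared with \<open>1 + \<i> * x\<close>, the factor \<open>exp (x\<^sup>2 / 2)\<close> removes the second order term of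
  the exponential series.\<close>

lemma cmod_iexp_exp_approx:
  fixes x :: real
  assumes x: "\<bar>x\<bar> \<le> 1"
  shows "cmod (iexp x * of_real (exp (x\<^sup>2 / 2)) - (1 + \<i> * x)) \<le> 2 * \<bar>x\<bar> ^ 3"
proof -
  define r where "r = iexp x - (1 + \<i> * x - of_real (x\<^sup>2 / 2))"
  define s where "s = exp (x\<^sup>2 / 2) - (1 + x\<^sup>2 / 2)"
  let ?a = "\<bar>x\<bar>"
  have a: "0 \<le> ?a" "?a ^ 4 \<le> ?a ^ 3" "?a ^ 2 \<le> 1" "?a ^ 3 \<le> 1"
    using power_decreasing[of 3 4 ?a] power_le_one[of ?a 2] power_le_one[of ?a 3] x by simp_all
  have "(\<Sum>k\<le>2. (\<i> * complex_of_real x) ^ k / fact k) = 1 + \<i> * x - of_real (x\<^sup>2 / 2)"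
  proof -
    have "(\<Sum>k\<le>2. f k) = f 0 + f 1 + f 2" for f :: "nat \<Rightarrow> complex"
      by (simp add: numeral_2_eq_2)
    then show ?thesis by (simp add: power_mult_distrib fact_2)
  qed
  then have r: "cmod r \<le> ?a ^ 3 / 6"
    using iexp_approx1[of x 2] unfolding r_def by (simp add: eval_nat_numeral fact_numeral)
  have s0: "0 \<le> s" unfolding s_def using exp_ge_add_one_self[of "x\<^sup>2 / 2"] by simp
  have x2: "x\<^sup>2 \<le> 1" using a(3) by simp
  have s: "s \<le> ?a ^ 4 / 4"
    using exp_bound[of "x\<^sup>2 / 2"] x2 unfolding s_def by (simp add: power_divide)
  have "iexp x * of_real (exp (x\<^sup>2 / 2)) - (1 + \<i> * x)
      = (\<i> * of_real (x ^ 3 / 2) - of_real (x ^ 4 / 4)) + (1 + \<i> * x - of_real (x\<^sup>2 / 2)) * of_real s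
        + r * of_real (exp (x\<^sup>2 / 2))"
  proof -
    have e: "exp (x\<^sup>2 / 2) = 1 + x\<^sup>2 / 2 + s" by (simp add: s_def)
    have i: "iexp x = (1 + \<i> * x - of_real (x\<^sup>2 / 2)) + r" by (simp add: r_def)
    have "(1 + \<i> * x - of_real (x\<^sup>2 / 2)) * (of_real (1 + x\<^sup>2 / 2)) - (1 + \<i> * x)
        = (\<i> * of_real (x ^ 3 / 2) - of_real (x ^ 4 / 4) :: complex)"
      by (simp add: complex_eq_iff power2_eq_square power3_eq_cube power4_eq_xxxx field_simps)
    then show ?thesis unfolding i e by (simp add: algebra_simps)
  qed
  also have "cmod \<dots> \<le> (?a ^ 3 / 2 + ?a ^ 4 / 4) + (1 + ?a + ?a\<^sup>2 / 2) * s + (?a ^ 3 / 6) * 2"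
  proof (intro order_trans[OF norm_triangle_ineq] add_mono)
    have "cmod (\<i> * of_real (x ^ 3 / 2) - of_real (x ^ 4 / 4))
        \<le> cmod (\<i> * of_real (x ^ 3 / 2)) + cmod (of_real (x ^ 4 / 4))" by (rule norm_triangle_ineq4)
    also have "\<dots> = ?a ^ 3 / 2 + ?a ^ 4 / 4"
      by (simp only: norm_mult norm_of_real norm_ii abs_divide power_abs abs_numeral mult_1)
    finally show "cmod (\<i> * of_real (x ^ 3 / 2) - of_real (x ^ 4 / 4)) \<le> ?a ^ 3 / 2 + ?a ^ 4 / 4" .
    have "cmod (1 + \<i> * x - of_real (x\<^sup>2 / 2)) \<le> cmod 1 + cmod (\<i> * x) + cmod (of_real (x\<^sup>2 / 2))"
      by (intro order_trans[OF norm_triangle_ineq4] add_mono norm_triangle_ineq order_refl)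
    then have "cmod (1 + \<i> * x - of_real (x\<^sup>2 / 2)) \<le> 1 + ?a + ?a\<^sup>2 / 2"
      by (simp only: norm_mult norm_of_real norm_ii abs_divide power_abs norm_one abs_numeral mult_1)
    then show "cmod ((1 + \<i> * x - of_real (x\<^sup>2 / 2)) * of_real s) \<le> (1 + ?a + ?a\<^sup>2 / 2) * s"
      using s0 by (simp only: norm_mult norm_of_real abs_of_nonneg mult_right_mono)
    have "exp (x\<^sup>2 / 2) \<le> 2" using exp_bound[of "x\<^sup>2 / 2"] x2 power_mono[OF x2, of 2]
      by (simp add: power_divide)
    then show "cmod (r * of_real (exp (x\<^sup>2 / 2))) \<le> (?a ^ 3 / 6) * 2"
      unfolding norm_mult norm_of_real by (intro mult_mono r) auto
  qed
  also have "(1 + ?a + ?a\<^sup>2 / 2) * s \<le> 5 / 2 * (?a ^ 3 / 4)"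
    by (intro mult_mono) (use a x s s0 in auto)
  also have "(?a ^ 3 / 2 + ?a ^ 4 / 4) + 5 / 2 * (?a ^ 3 / 4) + (?a ^ 3 / 6) * 2 \<le> 2 * ?a ^ 3"
    using a zero_le_power[OF a(1), of 3] by linarith
  finally show ?thesis by simp
qed

lemma cmod_one_plus_i: "cmod (1 + \<i> * of_real x) = sqrt (1 + x\<^sup>2)"
  by (simp add: cmod_def)

text \<open>Each factor \<open>iexp x * exp (x\<^sup>2 / 2)\<close> equals \<open>1 + \<i> * x\<close> up to a relative error of third
  order, and the third powers add up to at most \<open>\<kappa>\<close> times the sum of the squares.\<close>

lemma cmod_iexp_sum_minus_prod_le:
  fixes x :: "nat \<Rightarrow> real"
  assumes \<kappa>: "\<kappa> \<le> 1" and x: "\<And>l. l < n \<Longrightarrow> \<bar>x l\<bar> \<le> \<kappa>" and s: "0 \<le> s"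
    and Q: "\<bar>(\<Sum>l<n. (x l)\<^sup>2) - s\<bar> \<le> \<kappa>"
  shows "cmod (iexp (\<Sum>l<n. x l) - (\<Prod>l<n. 1 + \<i> * of_real (x l)) * of_real (exp (- s / 2)))
    \<le> cmod (\<Prod>l<n. 1 + \<i> * of_real (x l)) * (exp (2 * \<kappa> * (s + 1)) - 1 + \<kappa>)"
proof -
  let ?Q = "\<Sum>l<n. (x l)\<^sup>2" and ?P = "\<Prod>l<n. 1 + \<i> * complex_of_real (x l)"
  define z where "z l = (iexp (x l) * of_real (exp ((x l)\<^sup>2 / 2)) - (1 + \<i> * x l)) / (1 + \<i> * x l)" for l
  have nz: "1 + \<i> * complex_of_real (x l) \<noteq> 0" for l by (simp add: complex_eq_iff)
  have \<kappa>0: "0 \<le> \<kappa>" using Q by linarith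
  have z: "cmod (z l) \<le> 2 * \<kappa> * (x l)\<^sup>2" if "l < n" for l
  proof -
    have "cmod (z l) \<le> cmod (iexp (x l) * of_real (exp ((x l)\<^sup>2 / 2)) - (1 + \<i> * x l)) / 1"
      unfolding z_def norm_divide cmod_one_plus_i
      by (intro divide_left_mono) (auto simp: add_pos_nonneg)
    also have "\<dots> \<le> 2 * \<bar>x l\<bar> ^ 3" using cmod_iexp_exp_approx[of "x l"] x[OF that] \<kappa> by simp
    also have "\<dots> = 2 * (\<bar>x l\<bar> * (x l)\<^sup>2)" by (simp add: power3_eq_cube power2_eq_square mult.assoc)
    also have "\<dots> \<le> 2 * (\<kappa> * (x l)\<^sup>2)" by (intro mult_left_mono mult_right_mono x that) auto
    finally show ?thesis by simp
  qed
  define \<rho> where "\<rho> = (\<Prod>l<n. 1 + z l) - 1"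
  have "cmod \<rho> \<le> (\<Prod>l<n. 1 + cmod (z l)) - 1"
    unfolding \<rho>_def by (rule norm_prod_minus1_le_prod_minus1)
  also have "(\<Prod>l<n. 1 + cmod (z l)) \<le> (\<Prod>l<n. exp (cmod (z l)))"
    by (intro prod_mono) auto
  also have "\<dots> = exp (\<Sum>l<n. cmod (z l))" by (simp add: exp_sum)
  also have "(\<Sum>l<n. cmod (z l)) \<le> 2 * \<kappa> * ?Q"
    unfolding sum_distrib_left by (intro sum_mono z) auto
  also have "2 * \<kappa> * ?Q \<le> 2 * \<kappa> * (s + 1)"
    using Q \<kappa> \<kappa>0 by (intro mult_left_mono) auto
  finally have \<rho>: "cmod \<rho> \<le> exp (2 * \<kappa> * (s + 1)) - 1" by simp
  have "iexp (\<Sum>l<n. x l) * of_real (exp (?Q / 2)) = (\<Prod>l<n. iexp (x l) * of_real (exp ((x l)\<^sup>2 / 2)))"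
    by (simp add: prod.distrib exp_sum[symmetric] sum_distrib_left sum_divide_distrib flip: of_real_prod)
  also have "\<dots> = (\<Prod>l<n. (1 + \<i> * of_real (x l)) * (1 + z l))"
    using nz by (intro prod.cong) (auto simp: z_def field_simps)
  also have "\<dots> = ?P * (1 + \<rho>)" by (simp add: prod.distrib \<rho>_def)
  finally have "iexp (\<Sum>l<n. x l) * (of_real (exp (?Q / 2)) * of_real (exp (- ?Q / 2))) = ?P * (1 + \<rho>) * of_real (exp (- ?Q / 2))"
    by (simp add: mult.assoc[symmetric])
  then have "iexp (\<Sum>l<n. x l) = ?P * (1 + \<rho>) * of_real (exp (- ?Q / 2))"
    by (simp add: exp_minus flip: of_real_mult)
  then have "iexp (\<Sum>l<n. x l) - ?P * of_real (exp (- s / 2))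
      = ?P * (\<rho> * of_real (exp (- ?Q / 2)) + of_real (exp (- ?Q / 2) - exp (- s / 2)))"
    by (simp add: algebra_simps)
  also have "cmod \<dots> \<le> cmod ?P * ((exp (2 * \<kappa> * (s + 1)) - 1) + \<kappa>)"
    unfolding norm_mult
  proof (intro mult_left_mono order_trans[OF norm_triangle_ineq] add_mono)
    have Q0: "0 \<le> ?Q" by (intro sum_nonneg) simp
    have "cmod (\<rho> * of_real (exp (- ?Q / 2))) = cmod \<rho> * exp (- ?Q / 2)" by (simp add: norm_mult)
    also have "\<dots> \<le> cmod \<rho> * 1" using Q0 by (intro mult_left_mono) auto
    finally show "cmod (\<rho> * of_real (exp (- ?Q / 2))) \<le> exp (2 * \<kappa> * (s + 1)) - 1" using \<rho> by simp
    have "\<bar>exp (- (?Q / 2)) - exp (- (s / 2))\<bar> \<le> \<bar>?Q / 2 - s / 2\<bar>"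
      by (rule abs_exp_minus_diff_le) (use Q0 s in auto)
    also have "\<dots> \<le> \<kappa>" using Q \<kappa>0 by linarith
    finally show "cmod (of_real (exp (- ?Q / 2) - exp (- s / 2))) \<le> \<kappa>" unfolding norm_of_real by simp
  qed simp
  finally show ?thesis .
qed

text \<open>Once the accumulated squares exceed \<open>s + 1\<close> the stopped factors are trivial, so only the
  factor at the crossing is not controlled by the accumulated squares.\<close>

lemma stopped_product_le:
  fixes x :: "nat \<Rightarrow> real" and m s :: real
  assumes m: "\<And>l. l < n \<Longrightarrow> \<bar>x l\<bar> \<le> m" and s: "0 \<le> s"
  defines "x' \<equiv> \<lambda>l. of_bool ((\<Sum>j<l. (x j)\<^sup>2) \<le> s + 1) * x l"
  shows "(\<Prod>l<n. 1 + (x' l)\<^sup>2) \<le> exp (s + 1) * (1 + m\<^sup>2)"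
proof -
  have "(\<Prod>l<k. 1 + (x' l)\<^sup>2) \<le> (if (\<Sum>j<k. (x j)\<^sup>2) \<le> s + 1 then exp (\<Sum>j<k. (x j)\<^sup>2) else exp (s + 1) * (1 + m\<^sup>2))"
    if "k \<le> n" for k using that
  proof (induction k)
    case (Suc k)
    let ?P = "\<Prod>l<k. 1 + (x' l)\<^sup>2" and ?S = "\<Sum>j<k. (x j)\<^sup>2"
    have P0: "0 \<le> ?P" by (intro prod_nonneg) auto
    show ?case
    proof (cases "?S \<le> s + 1")
      case True
      then have IH: "?P \<le> exp ?S" using Suc by simp
      have x': "x' k = x k" using True by (simp add: x'_def)
      have "1 + (x k)\<^sup>2 \<le> exp ((x k)\<^sup>2)" by (rule exp_ge_add_one_self)
      then have 1: "?P * (1 + (x k)\<^sup>2) \<le> exp ?S * exp ((x k)\<^sup>2)" by (intro mult_mono IH) auto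
      have "(x k)\<^sup>2 \<le> m\<^sup>2" using m[of k] Suc.prems by (simp add: abs_le_square_iff[symmetric])
      moreover have "exp ?S \<le> exp (s + 1)" using True by simp
      ultimately have 2: "?P * (1 + (x k)\<^sup>2) \<le> exp (s + 1) * (1 + m\<^sup>2)"
        using order_trans[OF IH] by (intro mult_mono) auto
      show ?thesis using 1 2 x' by (simp add: exp_add mult.commute)
    next
      case False
      have "?S \<le> ?S + (x k)\<^sup>2" by simp
      then have F2: "\<not> ?S + (x k)\<^sup>2 \<le> s + 1" using False by linarith
      have "x' k = 0" using False by (simp add: x'_def)
      then show ?thesis using Suc False F2 by simp
    qed
  qed (use s in simp)
  from this[of n] have *: "(\<Prod>l<n. 1 + (x' l)\<^sup>2)
      \<le> (if (\<Sum>j<n. (x j)\<^sup>2) \<le> s + 1 then exp (\<Sum>j<n. (x j)\<^sup>2) else exp (s + 1) * (1 + m\<^sup>2))" by simp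
  show ?thesis
  proof (cases "(\<Sum>j<n. (x j)\<^sup>2) \<le> s + 1")
    case True
    then have "exp (\<Sum>j<n. (x j)\<^sup>2) * 1 \<le> exp (s + 1) * (1 + m\<^sup>2)" by (intro mult_mono) auto
    then show ?thesis using * True by simp
  next
    case False then show ?thesis using * by simp
  qed
qed

context filtration_space
begin

text \<open>The square-integrable bound \<open>G\<close> stands in for integrability of \<open>T\<close>, which is only known
  through a bound by the largest increment.\<close>

lemma complex_martingale_diff_orthogonal:
  fixes T :: "'a \<Rightarrow> complex"
  assumes D: "martingale_diff D" and T: "T \<in> borel_measurable (F l)"
    and G: "square_integrable M G" "\<And>\<omega>. cmod (T \<omega>) \<le> \<bar>G \<omega>\<bar>"
  shows "integrable M (\<lambda>\<omega>. T \<omega> * complex_of_real (D l \<omega>))"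
    and "(LINT \<omega>|M. T \<omega> * complex_of_real (D l \<omega>)) = 0"
proof -
  have TM: "T \<in> borel_measurable M" using measurable_from_subalg[OF subalg T] .
  note d = martingale_diffD[OF D, of l]
  have [measurable]: "T \<in> borel_measurable M" "D l \<in> borel_measurable M" using TM d by auto
  show int: "integrable M (\<lambda>\<omega>. T \<omega> * complex_of_real (D l \<omega>))"
  proof (rule Bochner_Integration.integrable_bound[OF square_integrable_mult[OF G(1) d(2)]])
    show "AE \<omega> in M. cmod (T \<omega> * complex_of_real (D l \<omega>)) \<le> norm (G \<omega> * D l \<omega>)"
      using G(2) by (intro AE_I2) (simp add: norm_mult abs_mult mult_right_mono)
  qed measurable
  have sq: "square_integrable M (\<lambda>\<omega>. Re (T \<omega>))" "square_integrable M (\<lambda>\<omega>. Im (T \<omega>))"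
    by (rule square_integrable_bound[OF G(1)], measurable, rule order_trans[OF abs_Re_le_cmod G(2)],
        rule square_integrable_bound[OF G(1)], measurable, rule order_trans[OF abs_Im_le_cmod G(2)])
  have "(LINT \<omega>|M. Re (T \<omega>) * D l \<omega>) = 0" "(LINT \<omega>|M. Im (T \<omega>) * D l \<omega>) = 0"
    using T sq by (auto intro!: martingale_diff_orthogonal[OF D])
  then show "(LINT \<omega>|M. T \<omega> * complex_of_real (D l \<omega>)) = 0"
    using integral_Re[OF int] integral_Im[OF int] by (simp add: complex_eq_iff)
qed

text \<open>McLeish's product argument for a single row: the stopped product has expectation one, and it
  is close to the complex exponential up to the factor \<open>exp (- s / 2)\<close> when the squares add up to
  nearly \<open>s\<close> and no increment is large.\<close>

lemma martingale_iexp_bound: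
  fixes D :: "nat \<Rightarrow> 'a \<Rightarrow> real" and s \<kappa> :: real and n :: nat
  assumes D: "martingale_diff D" and s: "0 \<le> s" and \<kappa>: "0 < \<kappa>" "\<kappa> \<le> 1"
  defines "m \<equiv> runmax D n"
  defines "B \<equiv> exp ((s + 1) / 2) * (1 + L2norm M m)"
  shows "cmod ((LINT \<omega>|M. iexp (\<Sum>l<n. D l \<omega>)) - of_real (exp (- s / 2)))
    \<le> (exp (2 * \<kappa> * (s + 1)) - 1 + \<kappa>) * B
      + (1 + B) * sqrt (prob {\<omega>\<in>space M. m \<omega> > \<kappa> \<or> \<bar>(\<Sum>l<n. (D l \<omega>)\<^sup>2) - s\<bar> > \<kappa>})"
proof -
  define A where "A l \<omega> = (of_bool ((\<Sum>j<l. (D j \<omega>)\<^sup>2) \<le> s + 1) :: real)" for l \<omega>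
  define D' where "D' l \<omega> = A l \<omega> * D l \<omega>" for l \<omega>
  define T where "T k \<omega> = (\<Prod>l<k. 1 + \<i> * complex_of_real (D' l \<omega>))" for k \<omega>
  \<comment> \<open>\<open>D'\<close> is the stopped difference, \<open>T\<close> the product of the factors \<open>1 + \<i> * D'\<close>, and \<open>G\<close> dominates
    \<open>cmod T\<close>.\<close>
  define G where "G \<omega> = exp ((s + 1) / 2) * (1 + m \<omega>)" for \<omega>
  let ?E = "exp (2 * \<kappa> * (s + 1)) - 1 + \<kappa>"
  let ?Bad = "{\<omega>\<in>space M. m \<omega> > \<kappa> \<or> \<bar>(\<Sum>l<n. (D l \<omega>)\<^sup>2) - s\<bar> > \<kappa>}"
  have Am: "A l \<in> borel_measurable (F l)" for l
  proof -
    have [measurable]: "D j \<in> borel_measurable (F l)" if "j < l" for j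
      by (rule measurable_F_mono[OF martingale_diffD(1)[OF D]]) (use that in simp)
    have [measurable]: "(\<lambda>\<omega>. \<Sum>j<l. (D j \<omega>)\<^sup>2) \<in> borel_measurable (F l)"
      by (rule borel_measurable_sum) simp
    show ?thesis unfolding A_def[abs_def] by measurable
  qed
  have D': "martingale_diff D'"
    unfolding D'_def[abs_def] by (rule martingale_diff_transform[OF D Am, of 1]) (simp add: A_def)
  have msq: "square_integrable M m"
    unfolding m_def by (rule runmax_square_integrable) (rule martingale_diffD(2)[OF D])
  have m0: "0 \<le> m \<omega>" for \<omega> by (simp add: m_def runmax_nonneg)
  have Gsq: "square_integrable M G"
    unfolding G_def[abs_def] by (intro square_integrable_cmult square_integrable_add square_integrable_const msq)
  have G0: "0 \<le> G \<omega>" for \<omega> using m0[of \<omega>] by (simp add: G_def)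
  have GB: "L2norm M G \<le> B"
  proof -
    have "L2norm M (\<lambda>\<omega>. 1 + m \<omega>) \<le> L2norm M (\<lambda>_. 1) + L2norm M m"
      by (intro L2norm_triangle square_integrable_const msq)
    moreover have "L2norm M (\<lambda>_. 1) = 1" by (simp add: L2norm_def prob_space)
    ultimately show ?thesis unfolding G_def[abs_def] L2norm_cmult B_def by simp
  qed
  have TG: "cmod (T k \<omega>) \<le> G \<omega>" if "k \<le> n" for k \<omega>
  proof (rule power2_le_imp_le[OF _ G0])
    have "(cmod (T k \<omega>))\<^sup>2 = (\<Prod>l<k. 1 + (D' l \<omega>)\<^sup>2)"
      unfolding T_def prod_norm[symmetric] cmod_one_plus_i prod_power_distrib by simp
    also have "\<dots> \<le> exp (s + 1) * (1 + (m \<omega>)\<^sup>2)"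
      unfolding D'_def A_def
      by (rule stopped_product_le) (use that s in \<open>auto simp: m_def intro: runmax_ge\<close>)
    also have "\<dots> \<le> (exp ((s + 1) / 2))\<^sup>2 * (1 + m \<omega>)\<^sup>2"
    proof (intro mult_mono)
      show "exp (s + 1) \<le> (exp ((s + 1) / 2))\<^sup>2" by (simp add: exp_double[symmetric])
      show "1 + (m \<omega>)\<^sup>2 \<le> (1 + m \<omega>)\<^sup>2" using m0[of \<omega>] by (simp add: power2_sum)
    qed auto
    finally show "(cmod (T k \<omega>))\<^sup>2 \<le> (G \<omega>)\<^sup>2" by (simp add: G_def power_mult_distrib)
  qed
  have Tm: "T k \<in> borel_measurable (F k)" for k
  proof -
    have [measurable]: "D' j \<in> borel_measurable (F k)" if "j < k" for j
      by (rule measurable_F_mono[OF martingale_diffD(1)[OF D']]) (use that in simp)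
    show ?thesis unfolding T_def[abs_def] by (rule borel_measurable_prod) simp
  qed
  have TmM[measurable]: "T k \<in> borel_measurable M" for k using measurable_from_subalg[OF subalg Tm] .
  have Tint: "integrable M (T k)" if "k \<le> n" for k
    by (rule Bochner_Integration.integrable_bound[OF square_integrable_integrable[OF Gsq] TmM])
       (use TG[OF that] G0 in simp)
  have ET: "(LINT \<omega>|M. T k \<omega>) = 1" if "k \<le> n" for k using that
  proof (induction k)
    case 0
    then show ?case by (simp add: T_def prob_space)
  next
    case (Suc k)
    have G': "cmod (T k \<omega>) \<le> \<bar>G \<omega>\<bar>" for \<omega> using TG[of k \<omega>] G0[of \<omega>] Suc.prems by simp
    note o = complex_martingale_diff_orthogonal[OF D' Tm[of k] Gsq G']
    have "T (Suc k) = (\<lambda>\<omega>. T k \<omega> + \<i> * (T k \<omega> * complex_of_real (D' k \<omega>)))"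
      by (rule ext) (simp add: T_def algebra_simps)
    then have "(LINT \<omega>|M. T (Suc k) \<omega>) = (LINT \<omega>|M. T k \<omega>) + \<i> * (LINT \<omega>|M. T k \<omega> * complex_of_real (D' k \<omega>))"
      using Tint[of k] o(1) Suc.prems by simp
    then show ?case using o(2) Suc by simp
  qed
  note [measurable] = martingale_diffD(4)[OF D] square_integrable_measurable[OF msq]
  let ?f = "\<lambda>\<omega>. iexp (\<Sum>l<n. D l \<omega>)" and ?g = "\<lambda>\<omega>. T n \<omega> * of_real (exp (- s / 2))"
  have fint: "integrable M ?f" by (rule integrable_iexp) measurable
  have gint: "integrable M ?g" using Tint[of n] by simp
  have Gint: "integrable M (\<lambda>\<omega>. ?E * G \<omega>)"
    by (rule integrable_mult_right[OF square_integrable_integrable[OF Gsq]])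
  have Hint: "integrable M (\<lambda>\<omega>. (1 + G \<omega>) * indicator ?Bad \<omega>)"
    by (rule integrable_real_mult_indicator)
       (measurable, intro square_integrable_integrable square_integrable_add square_integrable_const Gsq)
  have "(LINT \<omega>|M. ?f \<omega>) - of_real (exp (- s / 2)) = (LINT \<omega>|M. ?f \<omega> - ?g \<omega>)"
    using fint gint ET[of n] by simp
  also have "cmod \<dots> \<le> (LINT \<omega>|M. cmod (?f \<omega> - ?g \<omega>))" by (rule integral_norm_bound)
  also have "\<dots> \<le> (LINT \<omega>|M. ?E * G \<omega> + (1 + G \<omega>) * indicator ?Bad \<omega>)"
  proof (rule integral_mono)
    show "integrable M (\<lambda>\<omega>. cmod (?f \<omega> - ?g \<omega>))" using fint gint by simp
    show "integrable M (\<lambda>\<omega>. ?E * G \<omega> + (1 + G \<omega>) * indicator ?Bad \<omega>)"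
      by (rule Bochner_Integration.integrable_add[OF Gint Hint])
    fix \<omega> assume \<omega>: "\<omega> \<in> space M"
    have E0: "0 \<le> ?E" using \<kappa> s by simp
    show "cmod (?f \<omega> - ?g \<omega>) \<le> ?E * G \<omega> + (1 + G \<omega>) * indicator ?Bad \<omega>"
    proof (cases "\<omega> \<in> ?Bad")
      case True
      have "cmod (?f \<omega> - ?g \<omega>) \<le> cmod (?f \<omega>) + cmod (?g \<omega>)" by (rule norm_triangle_ineq4)
      also have "\<dots> \<le> 1 + G \<omega> * 1"
        unfolding norm_mult norm_of_real using TG[of n \<omega>] G0[of \<omega>] s by (intro add_mono mult_mono) auto
      also have "\<dots> \<le> ?E * G \<omega> + (1 + G \<omega>)" using mult_nonneg_nonneg[OF E0 G0[of \<omega>]] by simp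
      finally show ?thesis using True by simp
    next
      case False
      then have mk: "m \<omega> \<le> \<kappa>" and Q: "\<bar>(\<Sum>l<n. (D l \<omega>)\<^sup>2) - s\<bar> \<le> \<kappa>" using \<omega> by auto
      have Dk: "\<bar>D l \<omega>\<bar> \<le> \<kappa>" if "l < n" for l
        using mk that unfolding m_def runmax_le_iff by simp
      have "D' l \<omega> = D l \<omega>" if "l < n" for l
      proof -
        have "(\<Sum>j<l. (D j \<omega>)\<^sup>2) \<le> (\<Sum>j<n. (D j \<omega>)\<^sup>2)" using that by (intro sum_mono2) auto
        then have "(\<Sum>j<l. (D j \<omega>)\<^sup>2) \<le> s + 1" using Q \<kappa> by linarith
        then show ?thesis by (simp add: D'_def A_def)
      qed
      then have T: "T n \<omega> = (\<Prod>l<n. 1 + \<i> * of_real (D l \<omega>))" unfolding T_def by (intro prod.cong) auto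
      have "cmod (?f \<omega> - ?g \<omega>) \<le> cmod (T n \<omega>) * ?E"
        unfolding T by (rule cmod_iexp_sum_minus_prod_le[OF \<kappa>(2) Dk s Q])
      also have "\<dots> \<le> G \<omega> * ?E" by (intro mult_right_mono TG E0) simp
      finally show ?thesis using False by (simp add: mult.commute)
    qed
  qed
  also have "\<dots> = ?E * (LINT \<omega>|M. G \<omega>) + (LINT \<omega>|M. (1 + G \<omega>) * indicator ?Bad \<omega>)"
    using Bochner_Integration.integral_add[OF Gint Hint] by simp
  also have "\<dots> \<le> ?E * B + (1 + B) * sqrt (prob ?Bad)"
  proof (intro add_mono mult_left_mono)
    have "(LINT \<omega>|M. G \<omega>) \<le> (LINT \<omega>|M. \<bar>G \<omega>\<bar>)" using G0 by simp
    also have "\<dots> \<le> L2norm M G" by (rule integral_abs_le_L2norm[OF Gsq])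
    finally show "(LINT \<omega>|M. G \<omega>) \<le> B" using GB by simp
    have Bsq: "square_integrable M (indicator ?Bad)"
      by (rule square_integrable_bound[OF square_integrable_const[of 1]]) (auto simp: indicator_def)
    have B2: "L2norm M (indicator ?Bad) = sqrt (prob ?Bad)"
    proof -
      have "(\<lambda>\<omega>. (indicator ?Bad \<omega> :: real)\<^sup>2) = indicator ?Bad" by (rule ext) (simp add: indicator_def)
      then show ?thesis by (simp add: L2norm_def)
    qed
    have Csq: "square_integrable M (\<lambda>\<omega>. 1 + G \<omega>)" by (intro square_integrable_add square_integrable_const Gsq)
    have "(LINT \<omega>|M. (1 + G \<omega>) * indicator ?Bad \<omega>) \<le> (LINT \<omega>|M. \<bar>(1 + G \<omega>) * indicator ?Bad \<omega>\<bar>)"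
      using G0 by (intro order_trans[OF _ integral_abs_bound]) simp
    also have "\<dots> \<le> L2norm M (\<lambda>\<omega>. 1 + G \<omega>) * L2norm M (indicator ?Bad)"
      by (rule L2norm_Cauchy_Schwarz[OF Csq Bsq])
    also have "\<dots> \<le> (1 + B) * sqrt (prob ?Bad)"
      unfolding B2
    proof (rule mult_right_mono)
      have "L2norm M (\<lambda>\<omega>. 1 + G \<omega>) \<le> L2norm M (\<lambda>_. 1) + L2norm M G"
        by (intro L2norm_triangle square_integrable_const Gsq)
      then show "L2norm M (\<lambda>\<omega>. 1 + G \<omega>) \<le> 1 + B" using GB by (simp add: L2norm_def prob_space)
    qed simp
    finally show "(LINT \<omega>|M. (1 + G \<omega>) * indicator ?Bad \<omega>) \<le> (1 + B) * sqrt (prob ?Bad)" .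
  qed (use \<kappa> s in simp)
  finally show ?thesis .
qed

text \<open>Only convergence of characteristic functions is asserted.  Since the rows are arbitrary, weights
  that depend on the index are allowed, and so the theorem yields joint laws of several increments.\<close>

theorem martingale_array_CLT:
  fixes \<xi> :: "nat \<Rightarrow> nat \<Rightarrow> 'a \<Rightarrow> real"
  assumes D: "\<And>n. martingale_diff (\<xi> n)" and s: "0 \<le> s"
    and max: "(\<lambda>n. L2norm M (runmax (\<xi> n) n)) \<longlonglongrightarrow> 0"
    and qv: "\<And>\<epsilon>. \<epsilon> > 0 \<Longrightarrow> (\<lambda>n. prob {\<omega>\<in>space M. \<bar>(\<Sum>l<n. (\<xi> n l \<omega>)\<^sup>2) - s\<bar> > \<epsilon>}) \<longlonglongrightarrow> 0"
  shows "(\<lambda>n. LINT \<omega>|M. iexp (\<Sum>l<n. \<xi> n l \<omega>)) \<longlonglongrightarrow> of_real (exp (- s / 2))"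
proof (rule LIMSEQ_I)
  fix r :: real assume r: "r > 0"
  define B where "B = exp ((s + 1) / 2) * 2"
  have B: "B > 0" by (simp add: B_def)
  have "((\<lambda>\<kappa>. (exp (2 * \<kappa> * (s + 1)) - 1 + \<kappa>) * B) \<longlongrightarrow> (exp (2 * 0 * (s + 1)) - 1 + 0) * B) (at_right 0)"
    by (intro tendsto_intros)
  then have "((\<lambda>\<kappa>. (exp (2 * \<kappa> * (s + 1)) - 1 + \<kappa>) * B) \<longlongrightarrow> 0) (at_right 0)" by simp
  then have "\<forall>\<^sub>F \<kappa> in at_right 0. (exp (2 * \<kappa> * (s + 1)) - 1 + \<kappa>) * B < r / 2"
    by (rule order_tendstoD) (use r in simp)
  moreover have "\<forall>\<^sub>F \<kappa> in at_right (0::real). \<kappa> \<in> {0<..<1}" by (rule eventually_at_right_real) simp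
  ultimately have "\<forall>\<^sub>F \<kappa> in at_right (0::real). \<kappa> \<in> {0<..<1} \<and> (exp (2 * \<kappa> * (s + 1)) - 1 + \<kappa>) * B < r / 2"
    by eventually_elim simp
  then obtain \<kappa> :: real where \<kappa>: "0 < \<kappa>" "\<kappa> < 1" and \<kappa>r: "(exp (2 * \<kappa> * (s + 1)) - 1 + \<kappa>) * B < r / 2"
    using eventually_happens trivial_limit_at_right_real by (metis (no_types, lifting) greaterThanLessThan_iff)
  let ?Bad = "\<lambda>n. {\<omega>\<in>space M. runmax (\<xi> n) n \<omega> > \<kappa> \<or> \<bar>(\<Sum>l<n. (\<xi> n l \<omega>)\<^sup>2) - s\<bar> > \<kappa>}"
  let ?Q = "\<lambda>n. prob {\<omega>\<in>space M. \<bar>(\<Sum>l<n. (\<xi> n l \<omega>)\<^sup>2) - s\<bar> > \<kappa>}"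
  have msq: "square_integrable M (runmax (\<xi> n) n)" for n
    by (rule runmax_square_integrable) (rule martingale_diffD(2)[OF D])
  have [measurable]: "\<xi> n l \<in> borel_measurable M" for n l by (rule martingale_diffD(4)[OF D])
  note [measurable] = square_integrable_measurable[OF msq]
  have bad: "prob (?Bad n) \<le> (L2norm M (runmax (\<xi> n) n))\<^sup>2 / \<kappa>\<^sup>2 + ?Q n" for n
  proof -
    have "prob (?Bad n) \<le> prob ({\<omega>\<in>space M. \<bar>runmax (\<xi> n) n \<omega>\<bar> > \<kappa>} \<union> {\<omega>\<in>space M. \<bar>(\<Sum>l<n. (\<xi> n l \<omega>)\<^sup>2) - s\<bar> > \<kappa>})"
      by (rule finite_measure_mono) auto
    also have "\<dots> \<le> prob {\<omega>\<in>space M. \<bar>runmax (\<xi> n) n \<omega>\<bar> > \<kappa>} + ?Q n" by (rule measure_Un_le) auto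
    also have "prob {\<omega>\<in>space M. \<bar>runmax (\<xi> n) n \<omega>\<bar> > \<kappa>} \<le> (L2norm M (runmax (\<xi> n) n))\<^sup>2 / \<kappa>\<^sup>2"
      by (rule prob_L2_Markov[OF msq \<kappa>(1)])
    finally show ?thesis by simp
  qed
  have "(\<lambda>n. (1 + B) * sqrt ((L2norm M (runmax (\<xi> n) n))\<^sup>2 / \<kappa>\<^sup>2 + ?Q n)) \<longlonglongrightarrow> (1 + B) * sqrt (0\<^sup>2 / \<kappa>\<^sup>2 + 0)"
    by (intro tendsto_intros max qv \<kappa>) (use \<kappa> in simp)
  then have "(\<lambda>n. (1 + B) * sqrt ((L2norm M (runmax (\<xi> n) n))\<^sup>2 / \<kappa>\<^sup>2 + ?Q n)) \<longlonglongrightarrow> 0" by simp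
  then have "\<forall>\<^sub>F n in sequentially. (1 + B) * sqrt ((L2norm M (runmax (\<xi> n) n))\<^sup>2 / \<kappa>\<^sup>2 + ?Q n) < r / 2"
    by (rule order_tendstoD) (use r in simp)
  moreover have "\<forall>\<^sub>F n in sequentially. L2norm M (runmax (\<xi> n) n) < 1"
    by (rule order_tendstoD(2)[OF max]) simp
  ultimately have "\<forall>\<^sub>F n in sequentially. norm ((LINT \<omega>|M. iexp (\<Sum>l<n. \<xi> n l \<omega>)) - of_real (exp (- s / 2))) < r"
  proof eventually_elim
    case (elim n)
    let ?B = "exp ((s + 1) / 2) * (1 + L2norm M (runmax (\<xi> n) n))"
    have B': "?B \<le> B" "0 \<le> ?B" using elim(2) by (simp_all add: B_def)
    have "norm ((LINT \<omega>|M. iexp (\<Sum>l<n. \<xi> n l \<omega>)) - of_real (exp (- s / 2)))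
      \<le> (exp (2 * \<kappa> * (s + 1)) - 1 + \<kappa>) * ?B + (1 + ?B) * sqrt (prob (?Bad n))"
      by (rule martingale_iexp_bound[OF D s]) (use \<kappa> in simp_all)
    also have "\<dots> \<le> (exp (2 * \<kappa> * (s + 1)) - 1 + \<kappa>) * B
        + (1 + B) * sqrt ((L2norm M (runmax (\<xi> n) n))\<^sup>2 / \<kappa>\<^sup>2 + ?Q n)"
      using B' B \<kappa> s bad[of n] by (intro add_mono mult_mono real_sqrt_le_mono) auto
    finally show ?case using elim(1) \<kappa>r by linarith
  qed
  then show "\<exists>no. \<forall>n\<ge>no. norm ((LINT \<omega>|M. iexp (\<Sum>l<n. \<xi> n l \<omega>)) - of_real (exp (- s / 2))) < r"
    by (simp add: eventually_sequentially)
qed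

end

section \<open>From characteristic functions to finite-dimensional convergence\<close>

text \<open>The real trigonometric polynomials in the first \<open>K\<close> coordinates.  As \<open>K\<close> varies within the
  proof, vectors of length \<open>K\<close> are represented by sequences that vanish from index \<open>K\<close> on.\<close>

inductive_set trig :: "nat \<Rightarrow> ((nat \<Rightarrow> real) \<Rightarrow> real) set" for K where
  trig_cos: "(\<lambda>v. cos (\<Sum>i<K. u i * v i)) \<in> trig K"
| trig_sin: "(\<lambda>v. sin (\<Sum>i<K. u i * v i)) \<in> trig K"
| trig_add: "f \<in> trig K \<Longrightarrow> g \<in> trig K \<Longrightarrow> (\<lambda>v. f v + g v) \<in> trig K"
| trig_scale: "f \<in> trig K \<Longrightarrow> (\<lambda>v. a * f v) \<in> trig K"

lemma trig_const: "(\<lambda>_. a) \<in> trig K"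
  using trig_scale[OF trig_cos[of "\<lambda>_. 0"], of a] by simp

lemma trig_bounded: "f \<in> trig K \<Longrightarrow> \<exists>B. \<forall>v. \<bar>f v\<bar> \<le> B"
proof (induction rule: trig.induct)
  case (trig_add f g)
  then obtain A B where "\<And>v. \<bar>f v\<bar> \<le> A" "\<And>v. \<bar>g v\<bar> \<le> B" by blast
  then have "\<bar>f v + g v\<bar> \<le> A + B" for v using abs_triangle_ineq[of "f v" "g v"] add_mono order_trans by blast
  then show ?case by blast
next
  case (trig_scale f a)
  then obtain A where "\<And>v. \<bar>f v\<bar> \<le> A" by blast
  then have "\<bar>a * f v\<bar> \<le> \<bar>a\<bar> * A" for v by (simp add: abs_mult mult_left_mono)
  then show ?case by blast
qed (auto intro: exI[of _ 1])

lemma trig_continuous: "f \<in> trig K \<Longrightarrow> continuous_on S f"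
proof (induction rule: trig.induct)
  case (trig_cos u)
  then show ?case
    by (intro continuous_intros continuous_on_subset[OF continuous_on_product_coordinates]) auto
next
  case (trig_sin u)
  then show ?case
    by (intro continuous_intros continuous_on_subset[OF continuous_on_product_coordinates]) auto
qed (auto intro: continuous_intros)

lemma trig_mult_cos_sin:
  assumes "f \<in> trig K"
  shows "(\<lambda>v. f v * cos (\<Sum>i<K. w i * v i)) \<in> trig K \<and> (\<lambda>v. f v * sin (\<Sum>i<K. w i * v i)) \<in> trig K"
  using assms
proof (induction rule: trig.induct)
  case (trig_cos u)
  have a: "(\<Sum>i<K. (u i - w i) * v i) = (\<Sum>i<K. u i * v i) - (\<Sum>i<K. w i * v i)"
    "(\<Sum>i<K. (u i + w i) * v i) = (\<Sum>i<K. u i * v i) + (\<Sum>i<K. w i * v i)" for v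
    by (simp_all add: algebra_simps sum.distrib sum_subtractf)
  have 1: "cos (\<Sum>i<K. u i * v i) * cos (\<Sum>i<K. w i * v i)
      = 1 / 2 * cos (\<Sum>i<K. (u i - w i) * v i) + 1 / 2 * cos (\<Sum>i<K. (u i + w i) * v i)" for v
    unfolding a cos_add cos_diff by (simp add: algebra_simps)
  have 2: "cos (\<Sum>i<K. u i * v i) * sin (\<Sum>i<K. w i * v i)
      = 1 / 2 * sin (\<Sum>i<K. (u i + w i) * v i) + (- 1 / 2) * sin (\<Sum>i<K. (u i - w i) * v i)" for v
    unfolding a sin_add sin_diff by (simp add: algebra_simps)
  show ?case unfolding 1 2
    by (intro conjI trig.trig_add trig_scale trig.trig_cos trig_sin)
next
  case (trig_sin u)
  have a: "(\<Sum>i<K. (u i - w i) * v i) = (\<Sum>i<K. u i * v i) - (\<Sum>i<K. w i * v i)"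
    "(\<Sum>i<K. (u i + w i) * v i) = (\<Sum>i<K. u i * v i) + (\<Sum>i<K. w i * v i)" for v
    by (simp_all add: algebra_simps sum.distrib sum_subtractf)
  have 1: "sin (\<Sum>i<K. u i * v i) * cos (\<Sum>i<K. w i * v i)
      = 1 / 2 * sin (\<Sum>i<K. (u i + w i) * v i) + 1 / 2 * sin (\<Sum>i<K. (u i - w i) * v i)" for v
    unfolding a sin_add sin_diff by (simp add: algebra_simps)
  have 2: "sin (\<Sum>i<K. u i * v i) * sin (\<Sum>i<K. w i * v i)
      = 1 / 2 * cos (\<Sum>i<K. (u i - w i) * v i) + (- 1 / 2) * cos (\<Sum>i<K. (u i + w i) * v i)" for v
    unfolding a cos_add cos_diff by (simp add: algebra_simps)
  show ?case unfolding 1 2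
    by (intro conjI trig.trig_add trig_scale trig_cos trig.trig_sin)
next
  case (trig_add f g)
  then show ?case by (auto simp: distrib_right intro: trig.trig_add)
next
  case (trig_scale f a)
  then show ?case by (auto simp: mult.assoc intro: trig.trig_scale)
qed

lemma trig_mult:
  assumes f: "f \<in> trig K" and g: "g \<in> trig K"
  shows "(\<lambda>v. f v * g v) \<in> trig K"
  using g
proof (induction rule: trig.induct)
  case (trig_add g h)
  then show ?case by (auto simp: distrib_left intro: trig.trig_add)
next
  case (trig_scale g a)
  then show ?case using trig.trig_scale[of "\<lambda>v. f v * g v" K a] by (simp add: mult.left_commute)
qed (use trig_mult_cos_sin[OF f] in auto)

lemma trig_polynomial_compose:
  fixes p :: "real \<Rightarrow> real"
  assumes p: "real_polynomial_function p" and f: "f \<in> trig K"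
  shows "(\<lambda>v. p (f v)) \<in> trig K"
  using p
proof (induction rule: real_polynomial_function.induct)
  case (linear p)
  have "p (f v) = p 1 * f v" for v
    using linear_cmul[OF bounded_linear.linear[OF linear], of "f v" 1] by (simp add: mult.commute)
  then show ?case using trig_scale[OF f, of "p 1"] by simp
qed (auto intro: trig_const trig_add trig_mult)

definition cube :: "nat \<Rightarrow> real \<Rightarrow> (nat \<Rightarrow> real) set" where
  "cube K L = {v. (\<forall>i<K. \<bar>v i\<bar> \<le> L) \<and> (\<forall>i\<ge>K. v i = 0)}"

lemma compact_cube: "compact (cube K L)"
proof -
  have "cube K L = PiE UNIV (\<lambda>i. if i < K then {-L..L} else {0})"
  proof (rule set_eqI)
    fix v
    have "v \<in> PiE UNIV (\<lambda>i. if i < K then {-L..L} else {0}) \<longleftrightarrow> (\<forall>i. (i < K \<longrightarrow> \<bar>v i\<bar> \<le> L) \<and> (\<not> i < K \<longrightarrow> v i = 0))"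
      unfolding PiE_iff by (auto simp: abs_le_iff minus_le_iff)
    then show "v \<in> cube K L \<longleftrightarrow> v \<in> PiE UNIV (\<lambda>i. if i < K then {-L..L} else {0})"
      by (auto simp: cube_def not_less)
  qed
  moreover have "compactin (product_topology (\<lambda>_. euclidean) UNIV) (PiE UNIV (\<lambda>i::nat. if i < K then {-L..L} else {0::real}))"
    unfolding compactin_PiE by (auto simp: compactin_euclidean_iff)
  ultimately show ?thesis by (simp add: euclidean_product_topology compactin_euclidean_iff)
qed

text \<open>Composing with a polynomial that imitates truncation at level \<open>B\<close> makes the approximation
  bounded everywhere, not only on the cube.\<close>

lemma trig_approximation:
  fixes h :: "(nat \<Rightarrow> real) \<Rightarrow> real"
  assumes h: "continuous_on UNIV h" and B: "\<And>v. \<bar>h v\<bar> \<le> B" and \<epsilon>: "\<epsilon> > 0"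
  shows "\<exists>g\<in>trig K. (\<forall>v\<in>cube K L. \<bar>h v - g v\<bar> \<le> \<epsilon>) \<and> (\<forall>v. \<bar>g v\<bar> \<le> B + \<epsilon>)"
proof -
  interpret function_ring_on "trig K" "cube K L"
  proof
    fix x y assume xy: "x \<in> cube K L" "y \<in> cube K L" "x \<noteq> y"
    then obtain i where i: "x i \<noteq> y i" by auto
    then have iK: "i < K" using xy by (metis (mono_tags, lifting) cube_def mem_Collect_eq not_le)
    \<comment> \<open>This frequency maps the cube into a region where the sine is injective.\<close>
    define a where "a = 1 / (\<bar>L\<bar> + 1)"
    have a: "a > 0" by (simp add: a_def)
    let ?u = "\<lambda>j. if j = i then a else 0"
    have s: "(\<Sum>j<K. ?u j * v j) = a * v i" for v :: "nat \<Rightarrow> real"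
    proof -
      have "(\<Sum>j<K. ?u j * v j) = (\<Sum>j<K. if j = i then a * v i else 0)" by (intro sum.cong) auto
      then show ?thesis using iK by simp
    qed
    have "\<bar>a * z i\<bar> \<le> 1" if "z \<in> cube K L" for z
    proof -
      have "\<bar>z i\<bar> \<le> L" using that iK by (simp add: cube_def)
      then have "\<bar>z i\<bar> \<le> \<bar>L\<bar> + 1" by simp
      then show ?thesis by (simp add: a_def)
    qed
    from this[OF xy(1)] this[OF xy(2)] have "- (pi / 2) \<le> a * x i" "a * x i \<le> pi / 2" "- (pi / 2) \<le> a * y i" "a * y i \<le> pi / 2"
      using pi_gt3 by linarith+
    then have "sin (a * x i) = sin (a * y i) \<Longrightarrow> a * x i = a * y i" by (rule sin_inj_pi)
    then have "sin (a * x i) \<noteq> sin (a * y i)" using i a by auto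
    then show "\<exists>f\<in>trig K. f x \<noteq> f y"
      by (intro bexI[OF _ trig_sin[of ?u]]) (simp only: s not_False_eq_True)
  qed (auto intro: compact_cube trig_continuous trig_add trig_mult trig_const)
  have \<epsilon>2: "\<epsilon> / 2 > 0" using \<epsilon> by simp
  obtain f where f: "f \<in> trig K" "\<And>v. v \<in> cube K L \<Longrightarrow> \<bar>h v - f v\<bar> < \<epsilon> / 2"
    using Stone_Weierstrass_basic[OF continuous_on_subset[OF h subset_UNIV] \<epsilon>2] by blast
  obtain R where R: "\<And>v. \<bar>f v\<bar> \<le> R" using trig_bounded[OF f(1)] by blast
  define clip where "clip x = max (- B) (min B x)" for x :: real
  have B0: "0 \<le> B" using B[of undefined] by linarith
  have "continuous_on {- R..R} clip" unfolding clip_def[abs_def] by (intro continuous_intros)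
  then obtain p where p: "real_polynomial_function p" "\<And>x. x \<in> {- R..R} \<Longrightarrow> \<bar>clip x - p x\<bar> < \<epsilon> / 2"
    using Stone_Weierstrass_real_polynomial_function[OF compact_Icc _ \<epsilon>2] by metis
  have pf: "\<bar>clip (f v) - p (f v)\<bar> < \<epsilon> / 2" for v
    by (rule p(2)) (use R[of v] in auto)
  show ?thesis
  proof (intro bexI[OF _ trig_polynomial_compose[OF p(1) f(1)]] conjI ballI allI)
    fix v assume v: "v \<in> cube K L"
    have "\<bar>clip (f v) - h v\<bar> \<le> \<bar>f v - h v\<bar>" using B[of v] unfolding clip_def by auto
    then show "\<bar>h v - p (f v)\<bar> \<le> \<epsilon>" using f(2)[OF v] pf[of v] by linarith
  next
    fix v
    have "\<bar>clip (f v)\<bar> \<le> B" using B0 unfolding clip_def by auto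
    then show "\<bar>p (f v)\<bar> \<le> B + \<epsilon>" using pf[of v] \<epsilon> by linarith
  qed
qed

lemma (in prob_space) expectation_approx_on_cube:
  fixes V :: "'a \<Rightarrow> nat \<Rightarrow> real" and h g :: "(nat \<Rightarrow> real) \<Rightarrow> real"
  assumes V: "\<And>i. square_integrable M (\<lambda>\<omega>. V \<omega> i)" and V0: "\<And>\<omega> i. i \<ge> K \<Longrightarrow> V \<omega> i = 0"
    and b: "\<And>i. i < K \<Longrightarrow> L2norm M (\<lambda>\<omega>. V \<omega> i) \<le> b" and L: "L > 0"
    and h: "continuous_on UNIV h" "\<And>v. \<bar>h v\<bar> \<le> B" and g: "continuous_on UNIV g" "\<And>v. \<bar>g v\<bar> \<le> B + \<epsilon>"
    and hg: "\<And>v. v \<in> cube K L \<Longrightarrow> \<bar>h v - g v\<bar> \<le> \<epsilon>"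
  shows "\<bar>(LINT \<omega>|M. h (V \<omega>)) - (LINT \<omega>|M. g (V \<omega>))\<bar> \<le> \<epsilon> + (2 * B + \<epsilon>) * (real K * (b\<^sup>2 / L\<^sup>2))"
proof -
  have Vm: "V \<in> borel_measurable M"
    by (rule measurable_coordinatewise_then_product) (rule square_integrable_measurable[OF V])
  note hm = measurable_compose[OF Vm borel_measurable_continuous_onI[OF h(1)]]
  note gm = measurable_compose[OF Vm borel_measurable_continuous_onI[OF g(1)]]
  have hint: "integrable M (\<lambda>\<omega>. h (V \<omega>))" by (rule integrable_const_bound[of _ B]) (use h hm in auto)
  have gint: "integrable M (\<lambda>\<omega>. g (V \<omega>))" by (rule integrable_const_bound[of _ "B + \<epsilon>"]) (use g gm in auto)
  have B0: "0 \<le> 2 * B + \<epsilon>" using h(2)[of undefined] g(2)[of undefined] by linarith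
  let ?A = "\<lambda>i. {\<omega>\<in>space M. \<bar>V \<omega> i\<bar> > L}"
  have [measurable]: "(\<lambda>\<omega>. V \<omega> i) \<in> borel_measurable M" for i by (rule square_integrable_measurable[OF V])
  have Am: "?A i \<in> events" for i by measurable
  have i1: "integrable M (\<lambda>\<omega>. indicator (?A i) \<omega> :: real)" for i
    by (rule integrable_real_indicator[OF Am]) (simp add: emeasure_eq_measure)
  have "\<bar>(LINT \<omega>|M. h (V \<omega>)) - (LINT \<omega>|M. g (V \<omega>))\<bar> = \<bar>LINT \<omega>|M. h (V \<omega>) - g (V \<omega>)\<bar>"
    using hint gint by simp
  also have "\<dots> \<le> (LINT \<omega>|M. \<bar>h (V \<omega>) - g (V \<omega>)\<bar>)" by (rule integral_abs_bound)
  also have "\<dots> \<le> (LINT \<omega>|M. \<epsilon> + (2 * B + \<epsilon>) * (\<Sum>i<K. indicator (?A i) \<omega>))"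
  proof (rule integral_mono)
    show "integrable M (\<lambda>\<omega>. \<bar>h (V \<omega>) - g (V \<omega>)\<bar>)" using hint gint by simp
    show "integrable M (\<lambda>\<omega>. \<epsilon> + (2 * B + \<epsilon>) * (\<Sum>i<K. indicator (?A i) \<omega>))"
      by (intro Bochner_Integration.integrable_add integrable_mult_right Bochner_Integration.integrable_sum i1) simp
    fix \<omega> assume \<omega>: "\<omega> \<in> space M"
    have S0: "0 \<le> (\<Sum>i<K. indicator (?A i) \<omega> :: real)" by (intro sum_nonneg) simp
    show "\<bar>h (V \<omega>) - g (V \<omega>)\<bar> \<le> \<epsilon> + (2 * B + \<epsilon>) * (\<Sum>i<K. indicator (?A i) \<omega>)"
    proof (cases "V \<omega> \<in> cube K L")
      case True
      then show ?thesis using hg[OF True] mult_nonneg_nonneg[OF B0 S0] by linarith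
    next
      case False
      then obtain i where i: "i < K" "\<omega> \<in> ?A i" using V0 \<omega> by (force simp: cube_def)
      have "(1::real) = indicator (?A i) \<omega>" using i by simp
      also have "\<dots> \<le> (\<Sum>i<K. indicator (?A i) \<omega>)" by (rule member_le_sum) (use i in auto)
      finally have "(2 * B + \<epsilon>) * 1 \<le> (2 * B + \<epsilon>) * (\<Sum>i<K. indicator (?A i) \<omega>)" by (intro mult_left_mono B0)
      moreover have "0 \<le> \<epsilon>" using hg[of "\<lambda>_. 0"] L by (auto simp: cube_def intro: order_trans[OF abs_ge_zero])
      moreover have "\<bar>h (V \<omega>) - g (V \<omega>)\<bar> \<le> (2 * B + \<epsilon>) * 1"
        using order_trans[OF abs_triangle_ineq4 add_mono[OF h(2)[of "V \<omega>"] g(2)[of "V \<omega>"]]]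
        by (simp add: algebra_simps)
      ultimately show ?thesis by (meson add_increasing order_trans)
    qed
  qed
  also have "\<dots> = \<epsilon> + (2 * B + \<epsilon>) * (\<Sum>i<K. prob (?A i))"
    using i1 Am by (simp add: prob_space)
  also have "\<dots> \<le> \<epsilon> + (2 * B + \<epsilon>) * (\<Sum>i<K. b\<^sup>2 / L\<^sup>2)"
  proof (intro add_left_mono mult_left_mono sum_mono B0)
    fix i assume "i \<in> {..<K}"
    then have "(L2norm M (\<lambda>\<omega>. V \<omega> i))\<^sup>2 / L\<^sup>2 \<le> b\<^sup>2 / L\<^sup>2" using b[of i] by (intro divide_right_mono power_mono) auto
    then show "prob (?A i) \<le> b\<^sup>2 / L\<^sup>2" using prob_L2_Markov[OF V[of i] L] by linarith
  qed
  finally show ?thesis by simp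
qed

lemma trig_expectation_tendsto:
  fixes V :: "nat \<Rightarrow> 'a \<Rightarrow> nat \<Rightarrow> real" and V' :: "'b \<Rightarrow> nat \<Rightarrow> real"
  assumes M: "prob_space M" and N: "prob_space N"
    and V: "\<And>n i. (\<lambda>\<omega>. V n \<omega> i) \<in> borel_measurable M" and V': "\<And>i. (\<lambda>\<omega>. V' \<omega> i) \<in> borel_measurable N"
    and char: "\<And>u. (\<lambda>n. LINT \<omega>|M. iexp (\<Sum>i<K. u i * V n \<omega> i)) \<longlonglongrightarrow> (LINT \<omega>|N. iexp (\<Sum>i<K. u i * V' \<omega> i))"
    and g: "g \<in> trig K"
  shows "(\<lambda>n. LINT \<omega>|M. g (V n \<omega>)) \<longlonglongrightarrow> (LINT \<omega>|N. g (V' \<omega>))"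
  using g
proof (induction rule: trig.induct)
  interpret M: prob_space M by fact
  interpret N: prob_space N by fact
  note [measurable] = V V'
  have i: "integrable M (\<lambda>\<omega>. iexp (\<Sum>i<K. u i * V n \<omega> i))" "integrable N (\<lambda>\<omega>. iexp (\<Sum>i<K. u i * V' \<omega> i))" for u n
    by (rule M.integrable_iexp, measurable, rule N.integrable_iexp, measurable)
  have e: "Re (iexp x) = cos x" "Im (iexp x) = sin x" for x by (simp_all add: Re_exp Im_exp)
  { case (trig_cos u)
    show ?case using tendsto_Re[OF char[of u]]
      by (simp only: integral_Re[OF i(1)[of u], symmetric] integral_Re[OF i(2)[of u], symmetric] e) }
  { case (trig_sin u)
    show ?case using tendsto_Im[OF char[of u]]
      by (simp only: integral_Im[OF i(1)[of u], symmetric] integral_Im[OF i(2)[of u], symmetric] e) }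
  have Vm: "V n \<in> borel_measurable M" "V' \<in> borel_measurable N" for n
    by (rule measurable_coordinatewise_then_product, rule V, rule measurable_coordinatewise_then_product, rule V')
  have int: "integrable M (\<lambda>\<omega>. f (V n \<omega>))" "integrable N (\<lambda>\<omega>. f (V' \<omega>))" if f: "f \<in> trig K" for f n
  proof -
    obtain A where A: "\<And>v. \<bar>f v\<bar> \<le> A" using trig_bounded[OF f] by blast
    note fm = borel_measurable_continuous_onI[OF trig_continuous[OF f]]
    show "integrable M (\<lambda>\<omega>. f (V n \<omega>))"
      by (rule M.integrable_const_bound[of _ A]) (use A measurable_compose[OF Vm(1) fm] in auto)
    show "integrable N (\<lambda>\<omega>. f (V' \<omega>))"
      by (rule N.integrable_const_bound[of _ A]) (use A measurable_compose[OF Vm(2) fm] in auto)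
  qed
  { case (trig_add f g)
    then show ?case using int[OF trig_add(1)] int[OF trig_add(2)] by (auto intro: tendsto_add) }
  { case (trig_scale f a)
    then show ?case by (auto intro: tendsto_mult_left) }
qed

text \<open>Bounded second moments confine the vectors to a cube up to small probability.  There, a
  continuous function is uniformly close to a trigonometric polynomial, whose expectation is a linear
  combination of characteristic functions.\<close>

theorem finite_dimensional_convergence:
  fixes V :: "nat \<Rightarrow> 'a \<Rightarrow> nat \<Rightarrow> real" and V' :: "'b \<Rightarrow> nat \<Rightarrow> real" and h :: "(nat \<Rightarrow> real) \<Rightarrow> real"
  assumes M: "prob_space M" and N: "prob_space N"
    and V: "\<And>n i. square_integrable M (\<lambda>\<omega>. V n \<omega> i)" and V': "\<And>i. square_integrable N (\<lambda>\<omega>. V' \<omega> i)"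
    and V0: "\<And>n \<omega> i. i \<ge> K \<Longrightarrow> V n \<omega> i = 0" and V'0: "\<And>\<omega> i. i \<ge> K \<Longrightarrow> V' \<omega> i = 0"
    and b: "\<forall>\<^sub>F n in sequentially. \<forall>i<K. L2norm M (\<lambda>\<omega>. V n \<omega> i) \<le> b"
    and char: "\<And>u. (\<lambda>n. LINT \<omega>|M. iexp (\<Sum>i<K. u i * V n \<omega> i)) \<longlonglongrightarrow> (LINT \<omega>|N. iexp (\<Sum>i<K. u i * V' \<omega> i))"
    and h: "continuous_on UNIV h" "\<And>v. \<bar>h v\<bar> \<le> B"
  shows "(\<lambda>n. LINT \<omega>|M. h (V n \<omega>)) \<longlonglongrightarrow> (LINT \<omega>|N. h (V' \<omega>))"
proof (rule LIMSEQ_I)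
  fix r :: real assume r: "r > 0"
  interpret M: prob_space M by fact
  interpret N: prob_space N by fact
  define b' where "b' = max \<bar>b\<bar> (\<Sum>i<K. L2norm N (\<lambda>\<omega>. V' \<omega> i))"
  define \<epsilon> where "\<epsilon> = r / 6"
  have \<epsilon>: "\<epsilon> > 0" using r by (simp add: \<epsilon>_def)
  have bN: "L2norm N (\<lambda>\<omega>. V' \<omega> i) \<le> b'" if "i < K" for i
  proof -
    have "L2norm N (\<lambda>\<omega>. V' \<omega> i) \<le> (\<Sum>i<K. L2norm N (\<lambda>\<omega>. V' \<omega> i))" by (rule member_le_sum) (use that in auto)
    then show ?thesis unfolding b'_def by simp
  qed
  have "((\<lambda>L. (2 * B + \<epsilon>) * (real K * (b'\<^sup>2 / L\<^sup>2))) \<longlongrightarrow> (2 * B + \<epsilon>) * (real K * 0)) at_top"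
    by (intro tendsto_intros tendsto_divide_0[OF tendsto_const] filterlim_at_top_imp_at_infinity
        filterlim_pow_at_top filterlim_ident) simp
  then have "((\<lambda>L. (2 * B + \<epsilon>) * (real K * (b'\<^sup>2 / L\<^sup>2))) \<longlongrightarrow> 0) at_top" by simp
  then have "\<forall>\<^sub>F L in at_top. (2 * B + \<epsilon>) * (real K * (b'\<^sup>2 / L\<^sup>2)) < \<epsilon>" by (rule order_tendstoD) (rule \<epsilon>)
  then have "\<forall>\<^sub>F L in at_top. L > 0 \<and> (2 * B + \<epsilon>) * (real K * (b'\<^sup>2 / L\<^sup>2)) < \<epsilon>"
    using eventually_gt_at_top[of 0] by eventually_elim simp
  then obtain L where L: "L > 0" "(2 * B + \<epsilon>) * (real K * (b'\<^sup>2 / L\<^sup>2)) < \<epsilon>"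
    using eventually_happens trivial_limit_at_top_linorder by blast
  obtain g where g: "g \<in> trig K" "\<And>v. v \<in> cube K L \<Longrightarrow> \<bar>h v - g v\<bar> \<le> \<epsilon>" "\<And>v. \<bar>g v\<bar> \<le> B + \<epsilon>"
    using trig_approximation[OF h \<epsilon>] by blast
  note gc = trig_continuous[OF g(1), of UNIV]
  have 1: "\<bar>(LINT \<omega>|N. h (V' \<omega>)) - (LINT \<omega>|N. g (V' \<omega>))\<bar> \<le> \<epsilon> + (2 * B + \<epsilon>) * (real K * (b'\<^sup>2 / L\<^sup>2))"
    by (rule N.expectation_approx_on_cube[OF V' V'0 bN L(1) h gc g(3) g(2)])
  have "(\<lambda>n. LINT \<omega>|M. g (V n \<omega>)) \<longlonglongrightarrow> (LINT \<omega>|N. g (V' \<omega>))"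
    by (rule trig_expectation_tendsto[OF M N square_integrable_measurable[OF V] square_integrable_measurable[OF V'] char g(1)])
  then have "\<forall>\<^sub>F n in sequentially. dist (LINT \<omega>|M. g (V n \<omega>)) (LINT \<omega>|N. g (V' \<omega>)) < \<epsilon>"
    by (rule tendstoD) (rule \<epsilon>)
  then have "\<forall>\<^sub>F n in sequentially. norm ((LINT \<omega>|M. h (V n \<omega>)) - (LINT \<omega>|N. h (V' \<omega>))) < r" using b
  proof eventually_elim
    case (elim n)
    have "L2norm M (\<lambda>\<omega>. V n \<omega> i) \<le> b'" if "i < K" for i
      using elim(2) that unfolding b'_def by (meson abs_ge_self max.coboundedI1 order_trans)
    note bM = this
    have "\<bar>(LINT \<omega>|M. h (V n \<omega>)) - (LINT \<omega>|M. g (V n \<omega>))\<bar> \<le> \<epsilon> + (2 * B + \<epsilon>) * (real K * (b'\<^sup>2 / L\<^sup>2))"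
      by (rule M.expectation_approx_on_cube[OF V V0 bM L(1) h gc g(3) g(2)])
    then show ?case using 1 L(2) elim(1) unfolding \<epsilon>_def dist_real_def real_norm_def by linarith
  qed
  then show "\<exists>no. \<forall>n\<ge>no. norm ((LINT \<omega>|M. h (V n \<omega>)) - (LINT \<omega>|N. h (V' \<omega>))) < r"
    by (simp add: eventually_sequentially)
qed

section \<open>Increments of Brownian motion\<close>

text \<open>Rescaling to unit variance gives the known characteristic function.\<close>

lemma normal_iexp:
  assumes "prob_space N" and X: "distributed N lborel X (normal_density 0 \<sigma>)" and \<sigma>: "\<sigma> > 0"
  shows "(LINT \<omega>|N. iexp (a * X \<omega>)) = complex_of_real (exp (- (a\<^sup>2 * \<sigma>\<^sup>2) / 2))"
proof -
  interpret prob_space N by fact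
  have Z: "distributed N lborel (\<lambda>\<omega>. X \<omega> / \<sigma>) std_normal_density"
    using normal_standard_normal_convert[OF \<sigma>, of X 0] X by simp
  then have d: "distr N lborel (\<lambda>\<omega>. X \<omega> / \<sigma>) = std_normal_distribution" and m: "(\<lambda>\<omega>. X \<omega> / \<sigma>) \<in> measurable N lborel"
    by (simp_all add: distributed_def)
  have "complex_of_real (exp (- ((a * \<sigma>)\<^sup>2) / 2)) = char std_normal_distribution (a * \<sigma>)"
    by (simp add: char_std_normal_distribution)
  also have "\<dots> = (LINT x|distr N lborel (\<lambda>\<omega>. X \<omega> / \<sigma>). iexp (a * \<sigma> * x))"
    unfolding d char_def by simp
  also have "\<dots> = (LINT \<omega>|N. iexp (a * \<sigma> * (X \<omega> / \<sigma>)))"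
    by (rule integral_distr[OF m]) measurable
  also have "\<dots> = (LINT \<omega>|N. iexp (a * X \<omega>))" using \<sigma> by simp
  finally show ?thesis by (simp add: power_mult_distrib)
qed

lemma normal_square_integrable:
  assumes X: "distributed N lborel X (normal_density 0 \<sigma>)" and \<sigma>: "\<sigma> > 0"
  shows "square_integrable N X"
proof -
  have m: "X \<in> borel_measurable N" using X by (simp add: distributed_def)
  have i: "has_bochner_integral lborel (\<lambda>x. normal_density 0 \<sigma> x * x ^ 2) (\<sigma>\<^sup>2)"
    using normal_moment_even[OF \<sigma>, of 0 1] by simp
  show "square_integrable N X"
    unfolding square_integrable_def
    using m distributed_integrable[OF X, of "\<lambda>x. x ^ 2"] integrable.intros[OF i] by simp
qed

lemma normal_fourth_moment:
  assumes X: "distributed N lborel X (normal_density 0 \<sigma>)" and \<sigma>: "\<sigma> > 0"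
  shows "integrable N (\<lambda>\<omega>. X \<omega> ^ 4)" and "(LINT \<omega>|N. X \<omega> ^ 4) = 3 * \<sigma> ^ 4"
proof -
  have i: "has_bochner_integral lborel (\<lambda>x. normal_density 0 \<sigma> x * x ^ 4) (3 * \<sigma> ^ 4)"
    using normal_moment_even[OF \<sigma>, of 0 2]
    by (simp add: fact_numeral power_divide power4_eq_xxxx power2_eq_square mult.assoc)
  show "integrable N (\<lambda>\<omega>. X \<omega> ^ 4)"
    using distributed_integrable[OF X, of "\<lambda>x. x ^ 4"] integrable.intros[OF i] by simp
  show "(LINT \<omega>|N. X \<omega> ^ 4) = 3 * \<sigma> ^ 4"
    using distributed_integral[OF X, of "\<lambda>x. x ^ 4"] has_bochner_integral_integral_eq[OF i] by simp
qed

locale brownian =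
  fixes N :: "'b measure" and W :: "real \<Rightarrow> 'b \<Rightarrow> real"
  assumes BM: "standard_brownian_motion N W"
begin

sublocale prob_space N using BM by (simp add: standard_brownian_motion_def)

lemma W_0: "\<omega> \<in> space N \<Longrightarrow> W 0 \<omega> = 0"
  using BM by (simp add: standard_brownian_motion_def)

lemma W_continuous: "\<omega> \<in> space N \<Longrightarrow> continuous_on {0..1} (\<lambda>t. W t \<omega>)"
  using BM by (simp add: standard_brownian_motion_def)

definition dW :: "nat \<Rightarrow> nat \<Rightarrow> 'b \<Rightarrow> real" where
  "dW K i \<omega> = W (real (Suc i) / real K) \<omega> - W (real i / real K) \<omega>"

lemma dW_distributed:
  assumes "i < K" shows "distributed N lborel (dW K i) (normal_density 0 (sqrt (1 / real K)))"
proof -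
  have K: "real K > 0" using assms by simp
  have "real (Suc i) / real K - real i / real K = 1 / real K" by (simp add: diff_divide_distrib[symmetric])
  moreover have "0 \<le> real i / real K" "real i / real K < real (Suc i) / real K" "real (Suc i) / real K \<le> 1"
    using assms K by (simp_all add: divide_strict_right_mono)
  ultimately show ?thesis
    using BM unfolding standard_brownian_motion_def dW_def[abs_def] by metis
qed

lemma dW_indep: 
  assumes K: "K \<ge> 1" shows "indep_vars (\<lambda>_. borel) (dW K) {..<K}"
proof -
  let ?\<tau> = "\<lambda>i. real i / real K"
  have "?\<tau> \<in> {..K} \<rightarrow> {0..1} \<and> (\<forall>i<K. ?\<tau> i < ?\<tau> (Suc i))"
    using K by (auto simp: divide_le_eq_1 divide_strict_right_mono)
  then have "indep_vars (\<lambda>_. borel) (\<lambda>i \<omega>. W (?\<tau> (Suc i)) \<omega> - W (?\<tau> i) \<omega>) {..<K}"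
    using BM unfolding standard_brownian_motion_def by blast
  then show ?thesis by (simp add: dW_def[abs_def])
qed

lemma dW_measurable: "i < K \<Longrightarrow> dW K i \<in> borel_measurable N"
  using dW_distributed[of i K] by (simp add: distributed_def)

lemma dW_square_integrable: "i < K \<Longrightarrow> square_integrable N (dW K i)"
  by (rule normal_square_integrable[OF dW_distributed]) auto

text \<open>Independence of the increments factorises the characteristic function.\<close>

lemma dW_iexp:
  assumes K: "K \<ge> 1"
  shows "(LINT \<omega>|N. iexp (\<Sum>i<K. u i * (c * dW K i \<omega>)))
    = complex_of_real (exp (- (c\<^sup>2 / real K * (\<Sum>i<K. (u i)\<^sup>2)) / 2))"
proof -
  let ?X = "\<lambda>i \<omega>. u i * (c * dW K i \<omega>)"
  have ind: "indep_vars (\<lambda>_. borel) ?X {..<K}"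
    by (rule indep_vars_compose2[OF dW_indep[OF K], of "\<lambda>i x. u i * (c * x)" "\<lambda>_. borel"]) simp
  have m: "(\<lambda>\<omega>. \<Sum>i<K. ?X i \<omega>) \<in> borel_measurable N"
    using dW_measurable by (intro borel_measurable_sum) simp
  have "(LINT \<omega>|N. iexp (\<Sum>i<K. ?X i \<omega>)) = char (distr N borel (\<lambda>\<omega>. \<Sum>i<K. ?X i \<omega>)) 1"
    unfolding char_def by (subst integral_distr[OF m]) simp_all
  also have "\<dots> = (\<Prod>i<K. char (distr N borel (?X i)) 1)" by (rule char_distr_sum[OF ind])
  also have "\<dots> = (\<Prod>i<K. complex_of_real (exp (- (c\<^sup>2 / real K * (u i)\<^sup>2) / 2)))"
  proof (rule prod.cong[OF refl])
    fix i assume "i \<in> {..<K}"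
    then have i: "i < K" by simp
    have mi: "?X i \<in> borel_measurable N" using dW_measurable[OF i] by simp
    have "char (distr N borel (?X i)) 1 = (LINT \<omega>|N. iexp ((u i * c) * dW K i \<omega>))"
      unfolding char_def by (subst integral_distr[OF mi]) (simp_all add: mult.assoc)
    also have "\<dots> = complex_of_real (exp (- ((u i * c)\<^sup>2 * (sqrt (1 / real K))\<^sup>2) / 2))"
      by (rule normal_iexp[OF prob_space_axioms dW_distributed[OF i]]) (use K in simp)
    finally show "char (distr N borel (?X i)) 1 = complex_of_real (exp (- (c\<^sup>2 / real K * (u i)\<^sup>2) / 2))"
      by (simp add: power_mult_distrib mult.commute)
  qed
  also have "\<dots> = complex_of_real (exp (\<Sum>i<K. - (c\<^sup>2 / real K * (u i)\<^sup>2) / 2))"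
    by (simp add: exp_sum)
  also have "(\<Sum>i<K. - (c\<^sup>2 / real K * (u i)\<^sup>2) / 2) = - (c\<^sup>2 / real K * (\<Sum>i<K. (u i)\<^sup>2)) / 2"
    by (simp add: sum_distrib_left sum_divide_distrib flip: sum_negf)
  finally show ?thesis .
qed

text \<open>Fourth moments turn the tail of one increment into a bound of order \<open>1 / K\<^sup>2\<close>, which
  survives the summation over the \<open>K\<close> increments.\<close>

lemma dW_excess:
  assumes i: "i < K" and \<kappa>: "\<kappa> > 0"
  shows "(LINT \<omega>|N. max (\<bar>c * dW K i \<omega>\<bar> - \<kappa>) 0) \<le> 3 * c ^ 4 / (real K ^ 2 * \<kappa> ^ 3)"
proof -
  have s: "sqrt (1 / real K) > 0" using i by simp
  note f = normal_fourth_moment[OF dW_distributed[OF i] s]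
  have s4: "sqrt (1 / real K) ^ 4 = 1 / real K ^ 2"
  proof -
    have "sqrt (1 / real K) ^ 4 = ((sqrt (1 / real K))\<^sup>2)\<^sup>2"
      by (simp only: power4_eq_xxxx power2_eq_square mult.assoc)
    then show ?thesis by (simp add: power_divide)
  qed
  have "(LINT \<omega>|N. max (\<bar>c * dW K i \<omega>\<bar> - \<kappa>) 0) \<le> (LINT \<omega>|N. c ^ 4 / \<kappa> ^ 3 * dW K i \<omega> ^ 4)"
  proof (rule integral_mono)
    show "integrable N (\<lambda>\<omega>. max (\<bar>c * dW K i \<omega>\<bar> - \<kappa>) 0)"
      by (intro square_integrable_integrable square_integrable_max square_integrable_diff
          square_integrable_abs square_integrable_cmult dW_square_integrable i square_integrable_const)
    show "integrable N (\<lambda>\<omega>. c ^ 4 / \<kappa> ^ 3 * dW K i \<omega> ^ 4)" using f(1) by simp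
    fix \<omega>
    let ?x = "\<bar>c * dW K i \<omega>\<bar>"
    have e: "c ^ 4 / \<kappa> ^ 3 * dW K i \<omega> ^ 4 = ?x ^ 4 / \<kappa> ^ 3" by (simp add: power_mult_distrib)
    show "max (?x - \<kappa>) 0 \<le> c ^ 4 / \<kappa> ^ 3 * dW K i \<omega> ^ 4"
    proof (cases "?x \<le> \<kappa>")
      case True then show ?thesis unfolding e using \<kappa> by simp
    next
      case False
      then have "?x * \<kappa> ^ 3 \<le> ?x * ?x ^ 3" using \<kappa> by (intro mult_left_mono power_mono) auto
      also have "?x * ?x ^ 3 = ?x ^ 4" by (simp add: power4_eq_xxxx power3_eq_cube mult.assoc)
      finally have "?x \<le> ?x ^ 4 / \<kappa> ^ 3" using \<kappa> by (simp add: pos_le_divide_eq)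
      then show ?thesis unfolding e using False \<kappa> by simp
    qed
  qed
  also have "\<dots> = 3 * c ^ 4 / (real K ^ 2 * \<kappa> ^ 3)" using f(2) s4 by simp
  finally show ?thesis .
qed

text \<open>Padded with zeros, so that it is an element of the sequence space in which the
  finite-dimensional limits are taken.\<close>

definition scaled_dW :: "real \<Rightarrow> nat \<Rightarrow> 'b \<Rightarrow> nat \<Rightarrow> real" where
  "scaled_dW c K \<omega> i = (if i < K then c * dW K i \<omega> else 0)"

lemma scaled_dW_square_integrable: "square_integrable N (\<lambda>\<omega>. scaled_dW c K \<omega> i)"
  by (cases "i < K") (simp_all add: scaled_dW_def square_integrable_cmult dW_square_integrable)

lemma W_grid:
  assumes "\<omega> \<in> space N" "K \<ge> 1" shows "(\<Sum>i<j. dW K i \<omega>) = W (real j / real K) \<omega>"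
  unfolding dW_def using sum_lessThan_telescope[of "\<lambda>i. W (real i / real K) \<omega>" j] W_0[OF assms(1)] by simp

end

section \<open>Limits of the approximating martingales on a grid\<close>

text \<open>Here \<open>q\<close> is the required accuracy, \<open>p\<close> the level that achieves it for large \<open>n\<close>.  At \<open>n\<close> one
  takes the level of the largest accuracy whose threshold \<open>n\<close> has passed.\<close>

lemma diagonal_sequence:
  fixes P :: "nat \<Rightarrow> nat \<Rightarrow> nat \<Rightarrow> bool"
  assumes ex: "\<And>q. \<exists>p. \<forall>\<^sub>F n in sequentially. P q p n" and mono: "\<And>q p n. P (Suc q) p n \<Longrightarrow> P q p n"
  shows "\<exists>m. \<forall>q. \<forall>\<^sub>F n in sequentially. P q (m n) n"
proof -
  obtain p N where pN: "\<And>q n. n \<ge> N q \<Longrightarrow> P q (p q) n"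
    using ex unfolding eventually_sequentially by metis
  have mono': "P q' r n \<Longrightarrow> q \<le> q' \<Longrightarrow> P q r n" for q q' r n
    by (induction q' rule: nat.induct) (auto simp: le_Suc_eq dest: mono)
  define A where "A n = {q. q + N q \<le> n}" for n
  have fin: "finite (A n)" for n by (rule finite_subset[of _ "{..n}"]) (auto simp: A_def)
  have "P q (p (Max (A n))) n" if n: "n \<ge> q + N q" for q n
  proof -
    have "q \<in> A n" using n by (simp add: A_def)
    then have "Max (A n) \<in> A n" "q \<le> Max (A n)" using fin by (auto intro: Max_in)
    then show ?thesis using pN[of "Max (A n)" n] mono' by (auto simp: A_def)
  qed
  then have "\<forall>\<^sub>F n in sequentially. P q (p (Max (A n))) n" for q
    unfolding eventually_sequentially by (intro exI[of _ "q + N q"]) simp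
  then show ?thesis by (intro exI[of _ "\<lambda>n. p (Max (A n))"]) simp
qed

definition grid :: "nat \<Rightarrow> nat \<Rightarrow> nat \<Rightarrow> nat" where
  "grid K n i = nat \<lfloor>real n * (real i / real K)\<rfloor>"

lemma grid_0: "grid K n 0 = 0"
  by (simp add: grid_def)

lemma grid_last: "K \<ge> 1 \<Longrightarrow> grid K n K = n"
  by (simp add: grid_def)

lemma grid_mono: "i \<le> j \<Longrightarrow> grid K n i \<le> grid K n j"
  unfolding grid_def by (intro nat_mono floor_mono mult_left_mono divide_right_mono) auto

text \<open>Telescoping over consecutive blocks; some of them may be empty.\<close>

lemma sum_over_blocks:
  fixes a :: "nat \<Rightarrow> nat" and f :: "nat \<Rightarrow> real"
  assumes a: "mono a" "a 0 = 0"
  shows "(\<Sum>l<a K. f l) = (\<Sum>i<K. \<Sum>l\<in>{a i..<a (Suc i)}. f l)"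
proof (induction K)
  case (Suc K)
  have "(\<Sum>l<a (Suc K). f l) = (\<Sum>l\<in>{0..<a K}. f l) + (\<Sum>l\<in>{a K..<a (Suc K)}. f l)"
    using sum.atLeastLessThan_concat[of 0 "a K" "a (Suc K)" f] monoD[OF a(1), of K "Suc K"]
    by (simp add: atLeast0LessThan)
  then show ?case using Suc by (simp add: atLeast0LessThan)
qed (simp add: a)

text \<open>The step function on the index set that takes the value \<open>u i\<close> on the block \<open>i\<close>.\<close>

definition step_weight :: "nat \<Rightarrow> (nat \<Rightarrow> real) \<Rightarrow> (nat \<Rightarrow> nat) \<Rightarrow> nat \<Rightarrow> real" where
  "step_weight K u a l = (\<Sum>i<K. u i * of_bool (a i \<le> l \<and> l < a (Suc i)))"

lemma step_weight_eq:
  assumes a: "mono a" and i: "i < K" and l: "l \<in> {a i..<a (Suc i)}"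
  shows "step_weight K u a l = u i"
proof -
  have "a j \<le> l \<and> l < a (Suc j) \<longleftrightarrow> j = i" for j
  proof
    assume j: "a j \<le> l \<and> l < a (Suc j)"
    show "j = i"
    proof (rule ccontr)
      assume "j \<noteq> i"
      then consider "Suc j \<le> i" | "Suc i \<le> j" by linarith
      then show False using j l monoD[OF a, of "Suc j" i] monoD[OF a, of "Suc i" j] by cases auto
    qed
  qed (use l in auto)
  then have "step_weight K u a l = (\<Sum>j<K. if j = i then u i else 0)"
    unfolding step_weight_def by (intro sum.cong) auto
  then show ?thesis using i by simp
qed

lemma step_weight_abs_le: "\<bar>step_weight K u a l\<bar> \<le> (\<Sum>i<K. \<bar>u i\<bar>)"
  unfolding step_weight_def by (rule order_trans[OF sum_abs sum_mono]) (simp add: abs_mult)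

lemma sum_step_weight:
  fixes x :: "nat \<Rightarrow> real"
  assumes a: "mono a" "a 0 = 0"
  shows "(\<Sum>l<a K. g (step_weight K u a l) * x l) = (\<Sum>i<K. g (u i) * ((\<Sum>l<a (Suc i). x l) - (\<Sum>l<a i. x l)))"
proof -
  have "(\<Sum>l<a K. g (step_weight K u a l) * x l) = (\<Sum>i<K. \<Sum>l\<in>{a i..<a (Suc i)}. g (step_weight K u a l) * x l)"
    by (rule sum_over_blocks[OF a])
  also have "\<dots> = (\<Sum>i<K. g (u i) * (\<Sum>l\<in>{a i..<a (Suc i)}. x l))"
    by (intro sum.cong refl) (simp add: step_weight_eq[OF a(1)] sum_distrib_left)
  also have "\<dots> = (\<Sum>i<K. g (u i) * ((\<Sum>l<a (Suc i). x l) - (\<Sum>l<a i. x l)))"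
  proof (intro sum.cong refl)
    fix i
    show "g (u i) * (\<Sum>l\<in>{a i..<a (Suc i)}. x l) = g (u i) * ((\<Sum>l<a (Suc i). x l) - (\<Sum>l<a i. x l))"
      using sum.atLeastLessThan_concat[of 0 "a i" "a (Suc i)" x] monoD[OF a(1), of i "Suc i"]
      by (simp add: atLeast0LessThan)
  qed
  finally show ?thesis .
qed

text \<open>Asymptotic linearity is assumed along the levels \<open>p\<close> of the approximation, that is, for window
  lengths that are powers of two.\<close>

locale maxwell_woodroofe_qv = maxwell_woodroofe M F Z e C for M :: "'a measure" and F Z e C +
  fixes c :: real
  assumes qv: "\<And>t \<epsilon>. 0 \<le> t \<Longrightarrow> t \<le> 1 \<Longrightarrow> \<epsilon> > 0 \<Longrightarrow>
    (\<lambda>p. limsup (\<lambda>n. ereal (prob {\<omega>\<in>space M. \<bar>1 / real n *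
      (\<Sum>l<nat \<lfloor>real n * t\<rfloor>. (Z l \<omega>)\<^sup>2 + 2 * Z l \<omega> * th p (Suc l) \<omega>) - t * c\<^sup>2\<bar> > \<epsilon>}))) \<longlonglongrightarrow> 0"
begin

lemma qv_martingale:
  assumes t: "0 \<le> t" "t \<le> 1" and \<epsilon>: "\<epsilon> > 0" and \<eta>: "\<eta> > 0"
  shows "\<forall>\<^sub>F p in sequentially. \<forall>\<^sub>F n in sequentially.
    prob {\<omega>\<in>space M. \<bar>1 / real n * (\<Sum>l<nat \<lfloor>real n * t\<rfloor>. (D p l \<omega>)\<^sup>2) - t * c\<^sup>2\<bar> > \<epsilon>} \<le> \<eta>"
proof -
  let ?k = "\<lambda>n. nat \<lfloor>real n * t\<rfloor>"
  let ?G = "\<lambda>p n \<omega>. \<Sum>l<?k n. (Z l \<omega>)\<^sup>2 + 2 * Z l \<omega> * th p (Suc l) \<omega>"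
  let ?Q = "\<lambda>p n \<omega>. \<Sum>l<?k n. (D p l \<omega>)\<^sup>2"
  have k: "?k n \<le> n" for n
  proof -
    have "real n * t \<le> real n * 1" using t by (intro mult_left_mono) auto
    then show ?thesis by linarith
  qed
  have "\<forall>\<^sub>F p in sequentially. limsup (\<lambda>n. ereal (prob {\<omega>\<in>space M. \<bar>1 / real n * ?G p n \<omega> - t * c\<^sup>2\<bar> > \<epsilon> / 2})) < ereal (\<eta> / 2)"
    by (rule order_tendstoD(2)[OF qv[OF t]]) (use \<epsilon> \<eta> in \<open>simp_all add: zero_ereal_def\<close>)
  moreover have "(\<lambda>p. cross_bound p / (\<epsilon> / 6)) \<longlonglongrightarrow> 0 / (\<epsilon> / 6)"
    by (intro tendsto_intros cross_bound_tendsto_0) (use \<epsilon> in simp)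
  then have "(\<lambda>p. cross_bound p / (\<epsilon> / 6)) \<longlonglongrightarrow> 0" by simp
  then have "\<forall>\<^sub>F p in sequentially. cross_bound p / (\<epsilon> / 6) < \<eta> / 4"
    by (rule order_tendstoD) (use \<eta> in simp)
  ultimately show ?thesis
  proof eventually_elim
    case (elim p)
    have "\<forall>\<^sub>F n in sequentially. ereal (prob {\<omega>\<in>space M. \<bar>1 / real n * ?G p n \<omega> - t * c\<^sup>2\<bar> > \<epsilon> / 2}) < ereal (\<eta> / 2)"
      by (rule Limsup_lessD[OF elim(1)])
    moreover have "\<forall>\<^sub>F n in sequentially. \<forall>k\<le>n. prob {\<omega>\<in>space M.
      \<bar>(\<Sum>l<k. (D p l \<omega>)\<^sup>2) - (\<Sum>l<k. (Z l \<omega>)\<^sup>2 + 2 * Z l \<omega> * th p (Suc l) \<omega>)\<bar> > 3 * (\<epsilon> / 6) * real n}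
        \<le> cross_bound p / (\<epsilon> / 6) + \<eta> / 4"
      by (rule quadratic_variation) (use \<epsilon> \<eta> in simp_all)
    ultimately show ?case using eventually_ge_at_top[of 1]
    proof eventually_elim
      case (elim n)
      note [measurable] = square_integrable_measurable[OF D_square_integrable]
        square_integrable_measurable[OF Z_square_integrable] square_integrable_measurable[OF th_square_integrable]
      have n: "real n > 0" using elim(3) by simp
      have "prob {\<omega>\<in>space M. \<bar>1 / real n * ?Q p n \<omega> - t * c\<^sup>2\<bar> > \<epsilon>}
          \<le> prob {\<omega>\<in>space M. \<bar>?Q p n \<omega> - ?G p n \<omega>\<bar> > 3 * (\<epsilon> / 6) * real n}
            + prob {\<omega>\<in>space M. \<bar>1 / real n * ?G p n \<omega> - t * c\<^sup>2\<bar> > \<epsilon> / 2} + prob {\<omega>\<in>space M. \<bar>0\<bar> > (0::real)}"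
      proof (rule prob_le_add3)
        fix \<omega> assume a: "\<epsilon> < \<bar>1 / real n * ?Q p n \<omega> - t * c\<^sup>2\<bar>"
        have "1 / real n * ?Q p n \<omega> = (?Q p n \<omega> - ?G p n \<omega>) / real n + 1 / real n * ?G p n \<omega>"
          by (simp add: diff_divide_distrib)
        then have "\<epsilon> < \<bar>(?Q p n \<omega> - ?G p n \<omega>) / real n\<bar> + \<bar>1 / real n * ?G p n \<omega> - t * c\<^sup>2\<bar>"
          using a by linarith
        then have "\<epsilon> / 2 < \<bar>(?Q p n \<omega> - ?G p n \<omega>) / real n\<bar> \<or> \<epsilon> / 2 < \<bar>1 / real n * ?G p n \<omega> - t * c\<^sup>2\<bar>"
          by linarith
        moreover have "\<epsilon> / 2 < \<bar>(?Q p n \<omega> - ?G p n \<omega>) / real n\<bar> \<longleftrightarrow> 3 * (\<epsilon> / 6) * real n < \<bar>?Q p n \<omega> - ?G p n \<omega>\<bar>"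
          using n by (simp add: abs_divide pos_less_divide_eq)
        ultimately show "3 * (\<epsilon> / 6) * real n < \<bar>?Q p n \<omega> - ?G p n \<omega>\<bar>
            \<or> \<epsilon> / 2 < \<bar>1 / real n * ?G p n \<omega> - t * c\<^sup>2\<bar> \<or> 0 < \<bar>0 :: real\<bar>" by blast
      qed measurable
      moreover have "prob {\<omega>\<in>space M. \<bar>?Q p n \<omega> - ?G p n \<omega>\<bar> > 3 * (\<epsilon> / 6) * real n} \<le> cross_bound p / (\<epsilon> / 6) + \<eta> / 4"
        using elim(2) k by blast
      moreover have "prob {\<omega>\<in>space M. \<bar>1 / real n * ?G p n \<omega> - t * c\<^sup>2\<bar> > \<epsilon> / 2} < \<eta> / 2" using elim(1) by simp
      ultimately show ?case using \<open>cross_bound p / (\<epsilon> / 6) < \<eta> / 4\<close> by simp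
    qed
  qed
qed

text \<open>All that the limit theorem needs to know about level \<open>p\<close> at time \<open>n\<close>, with accuracy
  \<open>1 / Suc q\<close>: the martingale is near the process, its increments are small, and its quadratic
  variation is nearly linear at the grid points.\<close>

definition good :: "nat \<Rightarrow> nat \<Rightarrow> nat \<Rightarrow> nat \<Rightarrow> bool" where
  "good K q p n \<longleftrightarrow>
    L2norm M (runmax (\<lambda>k \<omega>. S k \<omega> - (\<Sum>l<k. D p l \<omega>)) n) / sqrt (real n) \<le> 1 / real (Suc q) \<and>
    L2norm M (runmax (D p) n) / sqrt (real n) \<le> 1 / real (Suc q) \<and>
    (\<forall>i\<le>K. prob {\<omega>\<in>space M. \<bar>1 / real n * (\<Sum>l<grid K n i. (D p l \<omega>)\<^sup>2) - real i / real K * c\<^sup>2\<bar>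
       > 1 / real (Suc q)} \<le> 1 / real (Suc q))"

lemma good_exists: "\<exists>p. \<forall>\<^sub>F n in sequentially. good K q p n"
proof -
  let ?e = "1 / real (Suc q)"
  have "\<forall>\<^sub>F p in sequentially. remainder_bound p < ?e / 4" by (rule order_tendstoD(2)[OF remainder_bound_tendsto_0]) simp
  moreover have "\<forall>\<^sub>F p in sequentially. \<forall>i\<in>{..K}. \<forall>\<^sub>F n in sequentially.
    prob {\<omega>\<in>space M. \<bar>1 / real n * (\<Sum>l<grid K n i. (D p l \<omega>)\<^sup>2) - real i / real K * c\<^sup>2\<bar> > ?e} \<le> ?e"
    unfolding grid_def
    by (intro eventually_ball_finite ballI qv_martingale) (auto simp: divide_le_eq_1)
  ultimately obtain p where p: "remainder_bound p < ?e / 4" "\<forall>i\<in>{..K}. \<forall>\<^sub>F n in sequentially.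
    prob {\<omega>\<in>space M. \<bar>1 / real n * (\<Sum>l<grid K n i. (D p l \<omega>)\<^sup>2) - real i / real K * c\<^sup>2\<bar> > ?e} \<le> ?e"
    using eventually_happens[OF eventually_conj] trivial_limit_sequentially by blast
  have "\<forall>\<^sub>F n in sequentially. \<forall>i\<in>{..K}.
    prob {\<omega>\<in>space M. \<bar>1 / real n * (\<Sum>l<grid K n i. (D p l \<omega>)\<^sup>2) - real i / real K * c\<^sup>2\<bar> > ?e} \<le> ?e"
    using p(2) by (intro eventually_ball_finite) auto
  moreover have "\<forall>\<^sub>F n in sequentially. L2norm M (runmax (D p) n) / sqrt (real n) < ?e"
    by (rule order_tendstoD(2)[OF negligible_max_tendsto[OF negligible_max_D]]) simp
  moreover have "\<forall>\<^sub>F n in sequentially.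
      L2norm M (runmax (\<lambda>k \<omega>. S k \<omega> - (\<Sum>l<k. D p l \<omega>)) n) / sqrt (real n) \<le> 2 * remainder_bound p + ?e / 2"
    by (rule martingale_approximation) simp
  ultimately have "\<forall>\<^sub>F n in sequentially. good K q p n"
    unfolding good_def
  proof eventually_elim
    case (elim n)
    have "L2norm M (runmax (\<lambda>k \<omega>. S k \<omega> - (\<Sum>l<k. D p l \<omega>)) n) / sqrt (real n) \<le> ?e"
    proof -
      have "x \<le> 2 * y + d / 2 \<Longrightarrow> y < d / 4 \<Longrightarrow> x \<le> d" for x y d :: real by linarith
      then show ?thesis using elim(3) p(1) by blast
    qed
    moreover have "L2norm M (runmax (D p) n) / sqrt (real n) \<le> ?e" using elim(2) by (rule less_imp_le)
    ultimately show ?case using elim(1) by simp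
  qed
  then show ?thesis by blast
qed

lemma good_Suc: "good K (Suc q) p n \<Longrightarrow> good K q p n"
proof -
  assume g: "good K (Suc q) p n"
  have e: "1 / real (Suc (Suc q)) \<le> 1 / real (Suc q)" by (intro divide_left_mono) auto
  note [measurable] = square_integrable_measurable[OF D_square_integrable]
  show "good K q p n" unfolding good_def
  proof (intro conjI allI impI)
    fix i assume i: "i \<le> K"
    have "prob {\<omega>\<in>space M. \<bar>1 / real n * (\<Sum>l<grid K n i. (D p l \<omega>)\<^sup>2) - real i / real K * c\<^sup>2\<bar> > 1 / real (Suc q)}
      \<le> prob {\<omega>\<in>space M. \<bar>1 / real n * (\<Sum>l<grid K n i. (D p l \<omega>)\<^sup>2) - real i / real K * c\<^sup>2\<bar> > 1 / real (Suc (Suc q))}"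
    proof (rule finite_measure_mono)
      show "{\<omega>\<in>space M. \<bar>1 / real n * (\<Sum>l<grid K n i. (D p l \<omega>)\<^sup>2) - real i / real K * c\<^sup>2\<bar> > 1 / real (Suc q)}
        \<subseteq> {\<omega>\<in>space M. \<bar>1 / real n * (\<Sum>l<grid K n i. (D p l \<omega>)\<^sup>2) - real i / real K * c\<^sup>2\<bar> > 1 / real (Suc (Suc q))}"
        by (intro Collect_mono impI conjI; elim conjE; (assumption | rule le_less_trans[OF e]))
    qed measurable
    also have "\<dots> \<le> 1 / real (Suc (Suc q))" using g i unfolding good_def by blast
    finally show "prob {\<omega>\<in>space M. \<bar>1 / real n * (\<Sum>l<grid K n i. (D p l \<omega>)\<^sup>2) - real i / real K * c\<^sup>2\<bar> > 1 / real (Suc q)}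
      \<le> 1 / real (Suc q)" using e by (rule order_trans)
  qed (use g e in \<open>auto simp: good_def intro: order_trans\<close>)
qed

lemma good_sequence: "\<exists>m. \<forall>q. \<forall>\<^sub>F n in sequentially. good K q (m n) n"
  by (rule diagonal_sequence[OF good_exists good_Suc])

end

lemma tendsto_zero_le_inverse_Suc:
  fixes f :: "nat \<Rightarrow> real"
  assumes "\<And>n. 0 \<le> f n" "\<And>q. \<forall>\<^sub>F n in sequentially. f n \<le> 1 / real (Suc q)"
  shows "f \<longlonglongrightarrow> 0"
proof (rule LIMSEQ_I)
  fix r :: real assume "r > 0"
  then obtain q where q: "1 / real (Suc q) < r" by (rule nat_approx_posE)
  have "\<forall>\<^sub>F n in sequentially. norm (f n - 0) < r"
    using assms(2)[of q] by eventually_elim (use q assms(1) in auto)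
  then show "\<exists>no. \<forall>n\<ge>no. norm (f n - 0) < r" by (simp add: eventually_sequentially)
qed

text \<open>A fixed grid with \<open>K\<close> cells, together with approximation levels \<open>m n\<close> for which all errors
  vanish along the diagonal.\<close>

locale grid_approximation = maxwell_woodroofe_qv M F Z e C c + BM: brownian N W
  for M :: "'a measure" and F Z e C c and N :: "'b measure" and W +
  fixes K :: nat and m :: "nat \<Rightarrow> nat"
  assumes K: "K \<ge> 1" and m: "\<And>q. \<forall>\<^sub>F n in sequentially. good K q (m n) n"
begin

abbreviation a :: "nat \<Rightarrow> nat \<Rightarrow> nat" where "a n i \<equiv> grid K n i"

lemma a_mono: "mono (a n)"
  by (rule monoI) (rule grid_mono)

lemma a_le: "i \<le> K \<Longrightarrow> a n i \<le> n"
  using grid_mono[of i K K n] grid_last[OF K] by simp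

text \<open>The martingale with the chosen level, its distance \<open>err\<close> to the process, and its normalised
  increments \<open>V\<close> over the cells of the grid.\<close>

definition T :: "nat \<Rightarrow> nat \<Rightarrow> 'a \<Rightarrow> real" where
  "T n k \<omega> = (\<Sum>l<k. D (m n) l \<omega>)"

definition err :: "nat \<Rightarrow> 'a \<Rightarrow> real" where
  "err n \<omega> = runmax (\<lambda>k \<omega>. S k \<omega> - T n k \<omega>) n \<omega> / sqrt (real n)"

definition V :: "nat \<Rightarrow> 'a \<Rightarrow> nat \<Rightarrow> real" where
  "V n \<omega> i = (if i < K then (T n (a n (Suc i)) \<omega> - T n (a n i) \<omega>) / sqrt (real n) else 0)"

abbreviation V' :: "'b \<Rightarrow> nat \<Rightarrow> real" where
  "V' \<equiv> BM.scaled_dW c K"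

lemma T_square_integrable: "square_integrable M (T n k)"
  unfolding T_def[abs_def] by (intro square_integrable_sum D_square_integrable)

lemma err_square_integrable: "square_integrable M (err n)"
proof -
  have "err n = (\<lambda>\<omega>. 1 / sqrt (real n) * runmax (\<lambda>k \<omega>. S k \<omega> - T n k \<omega>) n \<omega>)" by (rule ext) (simp add: err_def)
  then show ?thesis
    by (simp only:) (intro square_integrable_cmult runmax_square_integrable square_integrable_diff S_square_integrable T_square_integrable)
qed

lemma err_tendsto: "(\<lambda>n. L2norm M (err n)) \<longlonglongrightarrow> 0"
proof (rule tendsto_zero_le_inverse_Suc)
  fix q
  have e: "L2norm M (err n) = L2norm M (runmax (\<lambda>k \<omega>. S k \<omega> - (\<Sum>l<k. D (m n) l \<omega>)) n) / sqrt (real n)" for n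
  proof -
    have "err n = (\<lambda>\<omega>. 1 / sqrt (real n) * runmax (\<lambda>k \<omega>. S k \<omega> - (\<Sum>l<k. D (m n) l \<omega>)) n \<omega>)"
      by (rule ext) (simp add: err_def T_def[abs_def])
    then show ?thesis by (simp only: L2norm_cmult) simp
  qed
  show "\<forall>\<^sub>F n in sequentially. L2norm M (err n) \<le> 1 / real (Suc q)"
    using m[of q] by eventually_elim (simp add: e good_def)
qed simp

lemma V_square_integrable: "square_integrable M (\<lambda>\<omega>. V n \<omega> i)"
proof (cases "i < K")
  case True
  then have "(\<lambda>\<omega>. V n \<omega> i) = (\<lambda>\<omega>. 1 / sqrt (real n) * (T n (a n (Suc i)) \<omega> - T n (a n i) \<omega>))"
    by (intro ext) (simp add: V_def)
  then show ?thesis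
    by (simp only:) (intro square_integrable_cmult square_integrable_diff T_square_integrable)
qed (simp add: V_def)

text \<open>A linear combination of the increments over the cells is one sum of a martingale array with
  step weights.  Its quadratic variation is a combination of the quadratic variations at the grid
  points, so their convergence there is enough.\<close>

lemma V_iexp_tendsto:
  "(\<lambda>n. LINT \<omega>|M. iexp (\<Sum>i<K. u i * V n \<omega> i)) \<longlonglongrightarrow> (LINT \<omega>|N. iexp (\<Sum>i<K. u i * V' \<omega> i))"
proof -
  define U where "U = (\<Sum>i<K. \<bar>u i\<bar>)"
  define U2 where "U2 = (\<Sum>i<K. (u i)\<^sup>2)"
  define s where "s = c\<^sup>2 / real K * U2"
  define \<xi> where "\<xi> n l \<omega> = step_weight K u (a n) l / sqrt (real n) * D (m n) l \<omega>" for n l \<omega>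
  have U2: "0 \<le> U2" unfolding U2_def by (intro sum_nonneg) simp
  have aK: "a n K = n" for n by (rule grid_last[OF K])
  have md: "martingale_diff (\<xi> n)" for n
    unfolding \<xi>_def[abs_def]
  proof (rule martingale_diff_transform[OF D_martingale])
    show "\<bar>step_weight K u (a n) l / sqrt (real n)\<bar> \<le> U / sqrt (real n)" for l
      using step_weight_abs_le[of K u "a n" l] by (simp add: U_def divide_right_mono)
  qed simp
  have max: "(\<lambda>n. L2norm M (runmax (\<xi> n) n)) \<longlonglongrightarrow> 0"
  proof (rule tendsto_sandwich[OF _ _ tendsto_const])
    have "(\<lambda>n. L2norm M (runmax (D (m n)) n) / sqrt (real n)) \<longlonglongrightarrow> 0"
    proof (rule tendsto_zero_le_inverse_Suc)
      fix q show "\<forall>\<^sub>F n in sequentially. L2norm M (runmax (D (m n)) n) / sqrt (real n) \<le> 1 / real (Suc q)"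
        using m[of q] by eventually_elim (simp add: good_def)
    qed simp
    then show "(\<lambda>n. U * (L2norm M (runmax (D (m n)) n) / sqrt (real n))) \<longlonglongrightarrow> 0" by (rule tendsto_mult_right_zero)
    have "L2norm M (runmax (\<xi> n) n) \<le> U * (L2norm M (runmax (D (m n)) n) / sqrt (real n))" for n
    proof -
      have U0: "0 \<le> U" unfolding U_def by (intro sum_nonneg) simp
      have "L2norm M (runmax (\<xi> n) n) \<le> L2norm M (\<lambda>\<omega>. U / sqrt (real n) * runmax (D (m n)) n \<omega>)"
      proof (rule L2norm_mono)
        show "square_integrable M (\<lambda>\<omega>. U / sqrt (real n) * runmax (D (m n)) n \<omega>)"
          by (intro square_integrable_cmult runmax_square_integrable D_square_integrable)
        show "runmax (\<xi> n) n \<in> borel_measurable M"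
          by (intro runmax_measurable martingale_diffD(4)[OF md])
        fix \<omega>
        have "runmax (\<xi> n) n \<omega> \<le> U / sqrt (real n) * runmax (D (m n)) n \<omega>"
        proof (rule runmax_least)
          fix k assume k: "k \<le> n"
          have "\<bar>\<xi> n k \<omega>\<bar> = \<bar>step_weight K u (a n) k\<bar> / sqrt (real n) * \<bar>D (m n) k \<omega>\<bar>"
            by (simp add: \<xi>_def abs_mult)
          also have "\<dots> \<le> U / sqrt (real n) * runmax (D (m n)) n \<omega>"
            using step_weight_abs_le[of K u "a n" k] U0 unfolding U_def[symmetric]
            by (intro mult_mono divide_right_mono runmax_ge k) auto
          finally show "\<bar>\<xi> n k \<omega>\<bar> \<le> U / sqrt (real n) * runmax (D (m n)) n \<omega>" .
        qed
        then show "\<bar>runmax (\<xi> n) n \<omega>\<bar> \<le> \<bar>U / sqrt (real n) * runmax (D (m n)) n \<omega>\<bar>"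
          by (simp only: abs_of_nonneg[OF runmax_nonneg] order_trans[OF _ abs_ge_self])
      qed
      then show ?thesis using U0 by (simp only: L2norm_cmult) simp
    qed
    then show "\<forall>\<^sub>F n in sequentially. L2norm M (runmax (\<xi> n) n) \<le> U * (L2norm M (runmax (D (m n)) n) / sqrt (real n))"
      by simp
  qed simp
  let ?R = "\<lambda>n i \<omega>. 1 / real n * (\<Sum>l<a n i. (D (m n) l \<omega>)\<^sup>2) - real i / real K * c\<^sup>2"
  have QR: "\<bar>(\<Sum>l<n. (\<xi> n l \<omega>)\<^sup>2) - s\<bar> \<le> 2 * U2 * \<delta>"
    if "\<And>i. i \<le> K \<Longrightarrow> \<bar>?R n i \<omega>\<bar> \<le> \<delta>" for n \<omega> \<delta>
  proof -
    have "(\<Sum>l<n. (\<xi> n l \<omega>)\<^sup>2) = (\<Sum>l<a n K. (step_weight K u (a n) l)\<^sup>2 * ((D (m n) l \<omega>)\<^sup>2 / real n))"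
      unfolding aK by (intro sum.cong) (auto simp: \<xi>_def power_mult_distrib power_divide)
    also have "\<dots> = (\<Sum>i<K. (u i)\<^sup>2 * ((\<Sum>l<a n (Suc i). (D (m n) l \<omega>)\<^sup>2 / real n) - (\<Sum>l<a n i. (D (m n) l \<omega>)\<^sup>2 / real n)))"
      by (rule sum_step_weight[OF a_mono grid_0])
    also have "\<dots> = (\<Sum>i<K. (u i)\<^sup>2 * (?R n (Suc i) \<omega> - ?R n i \<omega>) + c\<^sup>2 / real K * (u i)\<^sup>2)"
    proof (intro sum.cong refl)
      fix i
      have "real (Suc i) / real K * c\<^sup>2 = real i / real K * c\<^sup>2 + c\<^sup>2 / real K"
        by (simp add: add_divide_distrib distrib_right)
      then show "(u i)\<^sup>2 * ((\<Sum>l<a n (Suc i). (D (m n) l \<omega>)\<^sup>2 / real n) - (\<Sum>l<a n i. (D (m n) l \<omega>)\<^sup>2 / real n))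
        = (u i)\<^sup>2 * (?R n (Suc i) \<omega> - ?R n i \<omega>) + c\<^sup>2 / real K * (u i)\<^sup>2"
        by (simp add: sum_divide_distrib[symmetric] algebra_simps)
    qed
    also have "\<dots> = (\<Sum>i<K. (u i)\<^sup>2 * (?R n (Suc i) \<omega> - ?R n i \<omega>)) + s"
      by (simp add: sum.distrib s_def U2_def sum_distrib_left)
    finally have "\<bar>(\<Sum>l<n. (\<xi> n l \<omega>)\<^sup>2) - s\<bar> = \<bar>\<Sum>i<K. (u i)\<^sup>2 * (?R n (Suc i) \<omega> - ?R n i \<omega>)\<bar>" by simp
    also have "\<dots> \<le> (\<Sum>i<K. (u i)\<^sup>2 * (2 * \<delta>))"
    proof (rule order_trans[OF sum_abs sum_mono])
      fix i assume "i \<in> {..<K}"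
      then have "\<bar>?R n (Suc i) \<omega> - ?R n i \<omega>\<bar> \<le> \<delta> + \<delta>"
        by (intro order_trans[OF abs_triangle_ineq4 add_mono[OF that[of "Suc i"] that[of i]]]) simp_all
      then have "\<bar>?R n (Suc i) \<omega> - ?R n i \<omega>\<bar> \<le> 2 * \<delta>" by simp
      then show "\<bar>(u i)\<^sup>2 * (?R n (Suc i) \<omega> - ?R n i \<omega>)\<bar> \<le> (u i)\<^sup>2 * (2 * \<delta>)"
        unfolding abs_mult abs_power2 by (intro mult_left_mono) simp_all
    qed
    also have "\<dots> = U2 * (2 * \<delta>)" unfolding U2_def by (rule sum_distrib_right[symmetric])
    also have "\<dots> = 2 * U2 * \<delta>" by simp
    finally show ?thesis .
  qed
  have [measurable]: "D p l \<in> borel_measurable M" for p l by (rule square_integrable_measurable[OF D_square_integrable])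
  have qv: "(\<lambda>n. prob {\<omega>\<in>space M. \<bar>(\<Sum>l<n. (\<xi> n l \<omega>)\<^sup>2) - s\<bar> > \<epsilon>}) \<longlonglongrightarrow> 0" if \<epsilon>: "\<epsilon> > 0" for \<epsilon>
  proof (rule LIMSEQ_I)
    fix r :: real assume r: "r > 0"
    have "min (\<epsilon> / (2 * U2 + 1)) (r / (real K + 1)) > 0" using \<epsilon> r U2 by simp
    then obtain q where q: "1 / real (Suc q) < min (\<epsilon> / (2 * U2 + 1)) (r / (real K + 1))" by (rule nat_approx_posE)
    let ?e = "1 / real (Suc q)"
    have q1: "2 * U2 * ?e \<le> \<epsilon>"
    proof -
      have "2 * U2 * ?e \<le> (2 * U2 + 1) * (\<epsilon> / (2 * U2 + 1))" using q U2 by (intro mult_mono) auto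
      then show ?thesis using U2 by simp
    qed
    have q2: "real (Suc K) * ?e < r"
    proof -
      have "real (Suc K) * ?e < real (Suc K) * (r / (real K + 1))"
        using q by (intro mult_strict_left_mono) auto
      also have "\<dots> = r" by (simp add: add.commute field_simps)
      finally show ?thesis .
    qed
    have "\<forall>\<^sub>F n in sequentially. norm (prob {\<omega>\<in>space M. \<bar>(\<Sum>l<n. (\<xi> n l \<omega>)\<^sup>2) - s\<bar> > \<epsilon>} - 0) < r"
      using m[of q]
    proof eventually_elim
      case (elim n)
      have "prob {\<omega>\<in>space M. \<bar>(\<Sum>l<n. (\<xi> n l \<omega>)\<^sup>2) - s\<bar> > \<epsilon>} \<le> prob (\<Union>i\<in>{..K}. {\<omega>\<in>space M. \<bar>?R n i \<omega>\<bar> > ?e})"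
      proof (rule finite_measure_mono)
        show "{\<omega>\<in>space M. \<bar>(\<Sum>l<n. (\<xi> n l \<omega>)\<^sup>2) - s\<bar> > \<epsilon>} \<subseteq> (\<Union>i\<in>{..K}. {\<omega>\<in>space M. \<bar>?R n i \<omega>\<bar> > ?e})"
        proof (rule subsetI, rule ccontr)
          fix \<omega> assume 1: "\<omega> \<in> {\<omega>\<in>space M. \<bar>(\<Sum>l<n. (\<xi> n l \<omega>)\<^sup>2) - s\<bar> > \<epsilon>}"
            and 2: "\<omega> \<notin> (\<Union>i\<in>{..K}. {\<omega>\<in>space M. \<bar>?R n i \<omega>\<bar> > ?e})"
          then have "\<And>i. i \<le> K \<Longrightarrow> \<bar>?R n i \<omega>\<bar> \<le> ?e" by (simp add: not_less)
          from QR[OF this] q1 1 show False by simp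
        qed
        show "(\<Union>i\<in>{..K}. {\<omega>\<in>space M. \<bar>?R n i \<omega>\<bar> > ?e}) \<in> events" by measurable
      qed
      also have "\<dots> \<le> (\<Sum>i\<in>{..K}. prob {\<omega>\<in>space M. \<bar>?R n i \<omega>\<bar> > ?e})"
        by (rule finite_measure_subadditive_finite) auto
      also have "\<dots> \<le> (\<Sum>i\<in>{..K}. ?e)" using elim unfolding good_def by (intro sum_mono) auto
      also have "\<dots> = real (Suc K) * ?e" by simp
      finally show ?case using q2 by simp
    qed
    then show "\<exists>no. \<forall>n\<ge>no. norm (prob {\<omega>\<in>space M. \<bar>(\<Sum>l<n. (\<xi> n l \<omega>)\<^sup>2) - s\<bar> > \<epsilon>} - 0) < r"
      by (simp add: eventually_sequentially)
  qed
  have s: "0 \<le> s" using U2 by (simp add: s_def)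
  have "(\<lambda>n. LINT \<omega>|M. iexp (\<Sum>l<n. \<xi> n l \<omega>)) \<longlonglongrightarrow> of_real (exp (- s / 2))"
    by (rule martingale_array_CLT[OF md s max qv])
  moreover have "(\<Sum>l<n. \<xi> n l \<omega>) = (\<Sum>i<K. u i * V n \<omega> i)" for n \<omega>
  proof -
    have "(\<Sum>l<n. \<xi> n l \<omega>) = (\<Sum>l<a n K. step_weight K u (a n) l * (D (m n) l \<omega> / sqrt (real n)))"
      unfolding aK by (simp add: \<xi>_def)
    also have "\<dots> = (\<Sum>i<K. u i * ((\<Sum>l<a n (Suc i). D (m n) l \<omega> / sqrt (real n)) - (\<Sum>l<a n i. D (m n) l \<omega> / sqrt (real n))))"
      by (rule sum_step_weight[OF a_mono grid_0, where g="\<lambda>x. x"])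
    also have "\<dots> = (\<Sum>i<K. u i * V n \<omega> i)"
      by (intro sum.cong) (auto simp: V_def T_def sum_divide_distrib diff_divide_distrib)
    finally show ?thesis .
  qed
  moreover have "(LINT \<omega>|N. iexp (\<Sum>i<K. u i * V' \<omega> i)) = of_real (exp (- s / 2))"
  proof -
    have "(\<Sum>i<K. u i * V' \<omega> i) = (\<Sum>i<K. u i * (c * BM.dW K i \<omega>))" for \<omega>
      by (intro sum.cong) (auto simp: BM.scaled_dW_def)
    then show ?thesis using BM.dW_iexp[OF K, of u c] by (simp only: s_def U2_def)
  qed
  ultimately show ?thesis by simp
qed

end

section \<open>Step functions in the path space\<close>

text \<open>The path that jumps by \<open>v i\<close> at time \<open>(i + 1) / K\<close>.\<close>

definition step_path :: "nat \<Rightarrow> (nat \<Rightarrow> real) \<Rightarrow> D01" where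
  "step_path K v = to_D01 (\<lambda>t. \<Sum>i<nat \<lfloor>real K * t\<rfloor>. v i)"

lemma eval_step_path: "0 \<le> t \<Longrightarrow> t \<le> 1 \<Longrightarrow> eval_D01 (step_path K v) t = (\<Sum>i<nat \<lfloor>real K * t\<rfloor>. v i)"
  unfolding step_path_def by (rule eval_to_D01[OF cadlag_floor[of "\<lambda>j. \<Sum>i<j. v i" K]])

lemma dist_D01_le: "(\<And>t. 0 \<le> t \<Longrightarrow> t \<le> 1 \<Longrightarrow> \<bar>eval_D01 x t - eval_D01 y t\<bar> \<le> b) \<Longrightarrow> dist x y \<le> b"
  unfolding dist_D01_def by (rule cSUP_least) auto

lemma nat_floor_mult_le: "0 \<le> t \<Longrightarrow> t \<le> 1 \<Longrightarrow> nat \<lfloor>real K * t\<rfloor> \<le> K"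
proof -
  assume "0 \<le> t" "t \<le> 1"
  then have "real K * t \<le> real K * 1" by (intro mult_left_mono) auto
  then show ?thesis by linarith
qed

lemma dist_step_path_le: "dist (step_path K v) (step_path K w) \<le> (\<Sum>i<K. \<bar>v i - w i\<bar>)"
proof (rule dist_D01_le)
  fix t :: real assume t: "0 \<le> t" "t \<le> 1"
  have "\<bar>eval_D01 (step_path K v) t - eval_D01 (step_path K w) t\<bar> = \<bar>\<Sum>i<nat \<lfloor>real K * t\<rfloor>. v i - w i\<bar>"
    by (simp add: eval_step_path[OF t] sum_subtractf)
  also have "\<dots> \<le> (\<Sum>i<nat \<lfloor>real K * t\<rfloor>. \<bar>v i - w i\<bar>)" by (rule sum_abs)
  also have "\<dots> \<le> (\<Sum>i<K. \<bar>v i - w i\<bar>)" using nat_floor_mult_le[OF t] by (intro sum_mono2) auto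
  finally show "\<bar>eval_D01 (step_path K v) t - eval_D01 (step_path K w) t\<bar> \<le> (\<Sum>i<K. \<bar>v i - w i\<bar>)" .
qed

lemma step_path_continuous: "continuous_on UNIV (step_path K)"
  unfolding continuous_on_def
proof
  fix w :: "nat \<Rightarrow> real"
  have "continuous_on UNIV (\<lambda>v :: nat \<Rightarrow> real. \<Sum>i<K. \<bar>v i - w i\<bar>)"
    by (intro continuous_intros continuous_on_product_coordinates)
  then have "((\<lambda>v. \<Sum>i<K. \<bar>v i - w i\<bar>) \<longlongrightarrow> (\<Sum>i<K. \<bar>w i - w i\<bar>)) (at w within UNIV)"
    unfolding continuous_on_def by blast
  then have 0: "((\<lambda>v. \<Sum>i<K. \<bar>v i - w i\<bar>) \<longlongrightarrow> 0) (at w within UNIV)" by simp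
  have "((\<lambda>v. dist (step_path K v) (step_path K w)) \<longlongrightarrow> 0) (at w within UNIV)"
    by (rule tendsto_sandwich[OF always_eventually[OF allI] always_eventually[OF allI] tendsto_const 0])
       (rule zero_le_dist, rule dist_step_path_le)
  then show "(step_path K \<longlongrightarrow> step_path K w) (at w within UNIV)" by (rule tendsto_dist_iff[THEN iffD2])
qed

lemma step_path_measurable:
  assumes "\<And>i. (\<lambda>\<omega>. V \<omega> i) \<in> borel_measurable M"
  shows "(\<lambda>\<omega>. step_path K (V \<omega>)) \<in> borel_measurable M"
  by (rule measurable_compose[OF measurable_coordinatewise_then_product[OF assms] borel_measurable_continuous_onI[OF step_path_continuous]])

context brownian
begin

text \<open>Uniform continuity of a path of Brownian motion on the unit interval.  As the step paths are
  measurable, this also gives measurability of the limit with respect to the Borel sets of the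
  non-separable space.\<close>

lemma step_path_scaled_dW_tendsto:
  assumes \<omega>: "\<omega> \<in> space N"
  shows "(\<lambda>K. step_path K (scaled_dW c K \<omega>)) \<longlonglongrightarrow> scaled_process c W \<omega>"
proof (rule tendsto_dist_iff[THEN iffD2], rule LIMSEQ_I)
  fix r :: real assume r: "r > 0"
  have "continuous_on {0..1} (\<lambda>t. c * W t \<omega>)" by (intro continuous_intros W_continuous[OF \<omega>])
  then have "uniformly_continuous_on {0..1} (\<lambda>t. c * W t \<omega>)" by (rule compact_uniformly_continuous) simp
  then obtain d where d: "d > 0" "\<And>s t. s \<in> {0..1} \<Longrightarrow> t \<in> {0..1} \<Longrightarrow> dist t s < d \<Longrightarrow> dist (c * W t \<omega>) (c * W s \<omega>) < r / 2"
    unfolding uniformly_continuous_on_def using r by (meson half_gt_zero)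
  obtain K0 where K0: "1 / real (Suc K0) < d" using d(1) by (rule nat_approx_posE)
  show "\<exists>no. \<forall>K\<ge>no. norm (dist (step_path K (scaled_dW c K \<omega>)) (scaled_process c W \<omega>) - 0) < r"
  proof (intro exI[of _ "Suc K0"] allI impI)
    fix K assume K: "K \<ge> Suc K0"
    then have Kp: "real K > 0" "K \<ge> 1" by simp_all
    have "1 / real K \<le> 1 / real (Suc K0)" using K by (intro divide_left_mono) auto
    then have Kd: "1 / real K < d" using K0 by linarith
    have "dist (step_path K (scaled_dW c K \<omega>)) (scaled_process c W \<omega>) \<le> r / 2"
    proof (rule dist_D01_le)
      fix t :: real assume t: "0 \<le> t" "t \<le> 1"
      let ?j = "nat \<lfloor>real K * t\<rfloor>"
      have j: "?j \<le> K" by (rule nat_floor_mult_le[OF t])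
      have "(\<Sum>i<?j. scaled_dW c K \<omega> i) = (\<Sum>i<?j. c * dW K i \<omega>)" using j by (intro sum.cong) (auto simp: scaled_dW_def)
      also have "\<dots> = c * W (real ?j / real K) \<omega>"
        by (simp add: sum_distrib_left[symmetric] W_grid[OF \<omega> Kp(2)])
      finally have 1: "eval_D01 (step_path K (scaled_dW c K \<omega>)) t = c * W (real ?j / real K) \<omega>" by (simp add: eval_step_path[OF t])
      have "real ?j \<le> real K * t" "real K * t < real ?j + 1" using t by (auto simp: of_nat_nat)
      then have "\<bar>real ?j - real K * t\<bar> < 1" by linarith
      moreover have "real K * (real ?j / real K - t) = real ?j - real K * t" using Kp by (simp add: right_diff_distrib)
      ultimately have "\<bar>real K * (real ?j / real K - t)\<bar> < 1" by (simp only:)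
      then have "\<bar>real ?j / real K - t\<bar> < 1 / real K" using Kp by (simp add: abs_mult pos_less_divide_eq mult.commute)
      then have "dist (real ?j / real K) t < d" using Kd by (simp add: dist_real_def)
      then have "dist (c * W (real ?j / real K) \<omega>) (c * W t \<omega>) < r / 2"
        using t j Kp by (intro d(2)) auto
      then show "\<bar>eval_D01 (step_path K (scaled_dW c K \<omega>)) t - eval_D01 (scaled_process c W \<omega>) t\<bar> \<le> r / 2"
        unfolding 1 eval_scaled_process[OF BM \<omega> t] by (simp add: dist_real_def)
    qed
    then show "norm (dist (step_path K (scaled_dW c K \<omega>)) (scaled_process c W \<omega>) - 0) < r" using r by simp
  qed
qed

lemma step_path_scaled_dW_measurable: "(\<lambda>\<omega>. step_path K (scaled_dW c K \<omega>)) \<in> borel_measurable N"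
  by (rule step_path_measurable) (rule square_integrable_measurable[OF scaled_dW_square_integrable])

lemma scaled_process_measurable: "scaled_process c W \<in> borel_measurable N"
  by (rule borel_measurable_LIMSEQ_metric[OF step_path_scaled_dW_measurable step_path_scaled_dW_tendsto])

lemma step_path_expectation_tendsto:
  fixes h :: "D01 \<Rightarrow> real"
  assumes h: "continuous_on UNIV h" "\<And>x. \<bar>h x\<bar> \<le> B"
  shows "(\<lambda>K. LINT \<omega>|N. h (step_path K (scaled_dW c K \<omega>))) \<longlonglongrightarrow> (LINT \<omega>|N. h (scaled_process c W \<omega>))"
proof (rule integral_dominated_convergence)
  note hm = borel_measurable_continuous_onI[OF h(1)]
  show "(\<lambda>\<omega>. h (scaled_process c W \<omega>)) \<in> borel_measurable N"
    by (rule measurable_compose[OF scaled_process_measurable hm])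
  show "(\<lambda>\<omega>. h (step_path K (scaled_dW c K \<omega>))) \<in> borel_measurable N" for K
    by (rule measurable_compose[OF step_path_scaled_dW_measurable hm])
  show "integrable N (\<lambda>_. B)" by simp
  show "AE \<omega> in N. (\<lambda>K. h (step_path K (scaled_dW c K \<omega>))) \<longlonglongrightarrow> h (scaled_process c W \<omega>)"
    using step_path_scaled_dW_tendsto h(1) by (intro AE_I2 continuous_on_tendsto_compose[OF h(1)]) auto
qed (use h(2) in simp)

end

section \<open>Tightness\<close>

context grid_approximation
begin

definition Vbound :: real where
  "Vbound = 2 * (sqrt 2 * (2 * sqrt C + 3 * etotal) + 1)"

lemma Vbound_pos: "Vbound > 0"
  unfolding Vbound_def using C_nonneg etotal_nonneg by (simp add: add_nonneg_pos)

text \<open>The second moments of the single martingale differences need not be bounded along the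
  diagonal, but the martingale is close to the process, whose maximum is controlled by the dyadic
  maximal inequality.\<close>

lemma V_L2norm: "\<forall>\<^sub>F n in sequentially. \<forall>i<K. L2norm M (\<lambda>\<omega>. V n \<omega> i) \<le> Vbound"
proof -
  have "\<forall>\<^sub>F n in sequentially. L2norm M (err n) < 1" by (rule order_tendstoD(2)[OF err_tendsto]) simp
  then show ?thesis using eventually_ge_at_top[of 1]
  proof eventually_elim
    case (elim n)
    then have n: "sqrt (real n) > 0" "n \<ge> 1" by simp_all
    show ?case
    proof (intro allI impI)
      fix i assume i: "i < K"
      let ?G = "\<lambda>\<omega>. 1 / sqrt (real n) * runmax S n \<omega> + err n \<omega>"
      have sq: "square_integrable M (\<lambda>\<omega>. 1 / sqrt (real n) * runmax S n \<omega>)"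
        by (intro square_integrable_cmult runmax_square_integrable S_square_integrable)
      have "L2norm M (\<lambda>\<omega>. V n \<omega> i) \<le> L2norm M (\<lambda>\<omega>. 2 * ?G \<omega>)"
      proof (rule L2norm_mono)
        show "square_integrable M (\<lambda>\<omega>. 2 * ?G \<omega>)"
          by (intro square_integrable_cmult square_integrable_add sq err_square_integrable)
        show "(\<lambda>\<omega>. V n \<omega> i) \<in> borel_measurable M" by (rule square_integrable_measurable[OF V_square_integrable])
        fix \<omega>
        have T: "\<bar>T n k \<omega>\<bar> / sqrt (real n) \<le> ?G \<omega>" if "k \<le> n" for k
        proof -
          have "\<bar>T n k \<omega>\<bar> \<le> runmax S n \<omega> + runmax (\<lambda>k \<omega>. S k \<omega> - T n k \<omega>) n \<omega>"
            using runmax_ge[OF that, of S \<omega>] runmax_ge[OF that, of "\<lambda>k \<omega>. S k \<omega> - T n k \<omega>" \<omega>] by linarith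
          then show ?thesis using n by (simp add: err_def divide_right_mono add_divide_distrib[symmetric])
        qed
        have "\<bar>V n \<omega> i\<bar> \<le> \<bar>T n (a n (Suc i)) \<omega>\<bar> / sqrt (real n) + \<bar>T n (a n i) \<omega>\<bar> / sqrt (real n)"
          using i n by (simp add: V_def add_divide_distrib[symmetric] divide_right_mono abs_triangle_ineq4)
        also have "\<dots> \<le> ?G \<omega> + ?G \<omega>" by (intro add_mono T a_le) (use i in auto)
        finally show "\<bar>V n \<omega> i\<bar> \<le> \<bar>2 * ?G \<omega>\<bar>" by simp
      qed
      also have "\<dots> = 2 * L2norm M ?G" by (simp only: L2norm_cmult abs_numeral)
      also have "\<dots> \<le> 2 * (L2norm M (\<lambda>\<omega>. 1 / sqrt (real n) * runmax S n \<omega>) + L2norm M (err n))"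
        by (intro mult_left_mono L2norm_triangle sq err_square_integrable) simp
      also have "L2norm M (\<lambda>\<omega>. 1 / sqrt (real n) * runmax S n \<omega>) = L2norm M (runmax S n) / sqrt (real n)"
        by (simp only: L2norm_cmult) simp
      also have "\<dots> \<le> sqrt 2 * (2 * sqrt C + 3 * etotal)"
        using S_maximal[OF n(2)] n by (simp add: pos_divide_le_eq real_sqrt_mult mult_ac)
      finally show "L2norm M (\<lambda>\<omega>. V n \<omega> i) \<le> Vbound" using elim(1) by (simp add: Vbound_def)
    qed
  qed
qed

lemma V_expectation_tendsto:
  fixes h :: "(nat \<Rightarrow> real) \<Rightarrow> real"
  assumes "continuous_on UNIV h" "\<And>v. \<bar>h v\<bar> \<le> B"
  shows "(\<lambda>n. LINT \<omega>|M. h (V n \<omega>)) \<longlonglongrightarrow> (LINT \<omega>|N. h (V' \<omega>))"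
  by (rule finite_dimensional_convergence[OF prob_space_axioms BM.prob_space_axioms V_square_integrable
        BM.scaled_dW_square_integrable _ _ V_L2norm V_iexp_tendsto assms]) (simp_all add: V_def BM.scaled_dW_def)

text \<open>Truncation at a level \<open>B\<close> costs at most a multiple of \<open>1 / B\<close> because second moments are
  bounded, so convergence extends to a function of linear growth.\<close>

lemma V_excess:
  assumes i: "i < K" and \<kappa>: "\<kappa> > 0" and \<eta>: "\<eta> > 0"
  shows "\<forall>\<^sub>F n in sequentially. (LINT \<omega>|M. max (\<bar>V n \<omega> i\<bar> - \<kappa>) 0) \<le> 3 * c ^ 4 / (real K ^ 2 * \<kappa> ^ 3) + \<eta>"
proof -
  \<comment> \<open>With this level of truncation \<open>Vbound\<^sup>2 / B = \<eta> / 2\<close>.\<close>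
  define B where "B = 2 * Vbound\<^sup>2 / \<eta>"
  have B: "B > 0" using Vbound_pos \<eta> by (simp add: B_def)
  let ?g = "\<lambda>v :: nat \<Rightarrow> real. min (max (\<bar>v i\<bar> - \<kappa>) 0) B"
  have gc: "continuous_on UNIV ?g" by (intro continuous_intros continuous_on_product_coordinates)
  have gb: "\<bar>?g v\<bar> \<le> B" for v using B by simp
  have sqx: "square_integrable M (\<lambda>\<omega>. max (\<bar>V n \<omega> i\<bar> - \<kappa>) 0)" for n
    by (intro square_integrable_max square_integrable_diff square_integrable_abs V_square_integrable square_integrable_const)
  have sqx': "square_integrable N (\<lambda>\<omega>. max (\<bar>V' \<omega> i\<bar> - \<kappa>) 0)"
    by (intro square_integrable_max square_integrable_diff square_integrable_abs BM.scaled_dW_square_integrable BM.square_integrable_const)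
  have gi: "integrable M (\<lambda>\<omega>. ?g (V n \<omega>))" for n
    by (rule Bochner_Integration.integrable_bound[OF square_integrable_integrable[OF sqx[of n]]])
       (use square_integrable_measurable[OF sqx[of n]] B in auto)
  have gi': "integrable N (\<lambda>\<omega>. ?g (V' \<omega>))"
    by (rule Bochner_Integration.integrable_bound[OF BM.square_integrable_integrable[OF sqx']])
       (use square_integrable_measurable[OF sqx'] B in auto)
  have "(LINT \<omega>|N. ?g (V' \<omega>)) \<le> (LINT \<omega>|N. max (\<bar>V' \<omega> i\<bar> - \<kappa>) 0)"
    by (rule integral_mono[OF gi' BM.square_integrable_integrable[OF sqx']]) simp
  also have "\<dots> \<le> 3 * c ^ 4 / (real K ^ 2 * \<kappa> ^ 3)"
    using BM.dW_excess[OF i \<kappa>, of c] i by (simp add: BM.scaled_dW_def)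
  finally have lim: "(LINT \<omega>|N. ?g (V' \<omega>)) \<le> 3 * c ^ 4 / (real K ^ 2 * \<kappa> ^ 3)" .
  have "\<forall>\<^sub>F n in sequentially. (LINT \<omega>|M. ?g (V n \<omega>)) < (LINT \<omega>|N. ?g (V' \<omega>)) + \<eta> / 2"
  proof (rule order_tendstoD(2))
    show "(\<lambda>n. LINT \<omega>|M. ?g (V n \<omega>)) \<longlonglongrightarrow> (LINT \<omega>|N. ?g (V' \<omega>))"
      by (rule V_expectation_tendsto[where B=B, OF gc]) (rule gb)
  qed (use \<eta> in simp)
  then show ?thesis using V_L2norm
  proof eventually_elim
    case (elim n)
    have sq2: "integrable M (\<lambda>\<omega>. (V n \<omega> i)\<^sup>2 / B)"
      using square_integrable_integrable_power2[OF V_square_integrable] by simp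
    have "(LINT \<omega>|M. max (\<bar>V n \<omega> i\<bar> - \<kappa>) 0) \<le> (LINT \<omega>|M. ?g (V n \<omega>) + (V n \<omega> i)\<^sup>2 / B)"
    proof (rule integral_mono)
      show "integrable M (\<lambda>\<omega>. max (\<bar>V n \<omega> i\<bar> - \<kappa>) 0)" by (rule square_integrable_integrable[OF sqx])
      show "integrable M (\<lambda>\<omega>. ?g (V n \<omega>) + (V n \<omega> i)\<^sup>2 / B)" by (rule Bochner_Integration.integrable_add[OF gi sq2])
      fix \<omega>
      let ?x = "\<bar>V n \<omega> i\<bar>"
      show "max (?x - \<kappa>) 0 \<le> ?g (V n \<omega>) + (V n \<omega> i)\<^sup>2 / B"
      proof (cases "max (?x - \<kappa>) 0 \<le> B")
        case True then show ?thesis using B by simp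
      next
        case False
        then have "B \<le> ?x" "\<not> ?x - \<kappa> \<le> 0" using \<kappa> B by (auto simp: max_def split: if_splits)
        then have "?x * B \<le> ?x * ?x" by (intro mult_left_mono) auto
        then have "?x \<le> (V n \<omega> i)\<^sup>2 / B" using B by (simp add: pos_le_divide_eq power2_eq_square flip: abs_mult)
        moreover have "max (?x - \<kappa>) 0 \<le> ?x" using \<kappa> by simp
        moreover have "0 \<le> ?g (V n \<omega>)" using B by simp
        ultimately show ?thesis by linarith
      qed
    qed
    also have "\<dots> = (LINT \<omega>|M. ?g (V n \<omega>)) + (L2norm M (\<lambda>\<omega>. V n \<omega> i))\<^sup>2 / B"
      using gi sq2 by (simp add: L2norm_power2)
    also have "(L2norm M (\<lambda>\<omega>. V n \<omega> i))\<^sup>2 / B \<le> Vbound\<^sup>2 / B"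
      using elim(2) i B by (intro divide_right_mono power_mono) auto
    also have "Vbound\<^sup>2 / B = \<eta> / 2" using Vbound_pos \<eta> by (simp add: B_def)
    finally show ?case using elim(1) lim by linarith
  qed
qed

text \<open>The largest excursion of the martingale from its value at the start of a cell.\<close>

definition osc :: "nat \<Rightarrow> nat \<Rightarrow> 'a \<Rightarrow> real" where
  "osc n i = runmax (\<lambda>k \<omega>. \<Sum>l<k. D (m n) (a n i + l) \<omega>) (a n (Suc i) - a n i)"

lemma T_diff: "a n i \<le> k \<Longrightarrow> T n k \<omega> - T n (a n i) \<omega> = (\<Sum>l<k - a n i. D (m n) (a n i + l) \<omega>)"
proof -
  assume k: "a n i \<le> k"
  then obtain d where d: "k = a n i + d" using le_Suc_ex by blast
  have "T n (a n i + d) \<omega> = T n (a n i) \<omega> + (\<Sum>l<d. D (m n) (a n i + l) \<omega>)"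
    by (induction d) (simp_all add: T_def)
  then show ?thesis by (simp add: d)
qed

lemma osc_measurable: "osc n i \<in> borel_measurable M"
  unfolding osc_def
  by (intro runmax_measurable borel_measurable_sum square_integrable_measurable[OF D_square_integrable])

lemma osc_prob:
  assumes i: "i < K" and \<kappa>: "\<kappa> > 0" and n: "n \<ge> 1"
  shows "prob {\<omega>\<in>space M. osc n i \<omega> \<ge> 2 * \<kappa> * sqrt (real n)} \<le> (LINT \<omega>|M. max (\<bar>V n \<omega> i\<bar> - \<kappa>) 0) / \<kappa>"
proof -
  let ?r = "sqrt (real n)"
  have r: "?r > 0" using n by simp
  interpret G: filtration_space M "\<lambda>l. F (a n i + l)" by (rule martingale_diff_shift(1)[OF D_martingale])
  have md: "G.martingale_diff (\<lambda>l. D (m n) (a n i + l))" by (rule martingale_diff_shift(2)[OF D_martingale])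
  have "prob {\<omega>\<in>space M. osc n i \<omega> \<ge> 2 * (\<kappa> * ?r)}
      \<le> (LINT \<omega>|M. max (\<bar>\<Sum>l<a n (Suc i) - a n i. D (m n) (a n i + l) \<omega>\<bar> - \<kappa> * ?r) 0) / (\<kappa> * ?r)"
    unfolding osc_def by (rule G.Doob_weak_type[OF md]) (use \<kappa> r in simp)
  also have "(\<lambda>\<omega>. max (\<bar>\<Sum>l<a n (Suc i) - a n i. D (m n) (a n i + l) \<omega>\<bar> - \<kappa> * ?r) 0)
      = (\<lambda>\<omega>. ?r * max (\<bar>V n \<omega> i\<bar> - \<kappa>) 0)"
  proof
    fix \<omega>
    have "(\<Sum>l<a n (Suc i) - a n i. D (m n) (a n i + l) \<omega>) = T n (a n (Suc i)) \<omega> - T n (a n i) \<omega>"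
      by (rule T_diff[symmetric]) (rule grid_mono, simp)
    also have "\<dots> = ?r * V n \<omega> i" using i r by (simp add: V_def)
    finally show "max (\<bar>\<Sum>l<a n (Suc i) - a n i. D (m n) (a n i + l) \<omega>\<bar> - \<kappa> * ?r) 0 = ?r * max (\<bar>V n \<omega> i\<bar> - \<kappa>) 0"
      using r by (simp add: abs_mult max_mult_distrib_left right_diff_distrib mult.commute)
  qed
  also have "(LINT \<omega>|M. ?r * max (\<bar>V n \<omega> i\<bar> - \<kappa>) 0) / (\<kappa> * ?r) = (LINT \<omega>|M. max (\<bar>V n \<omega> i\<bar> - \<kappa>) 0) / \<kappa>"
    using r by simp
  finally show ?thesis by (simp add: mult.assoc)
qed

text \<open>The bound for one cell is of order \<open>1 / K\<^sup>2\<close>, so the union bound over all cells leaves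
  \<open>1 / K\<close>.\<close>

lemma far_prob:
  assumes \<kappa>: "\<kappa> > 0" and \<eta>: "\<eta> > 0"
  shows "\<forall>\<^sub>F n in sequentially. prob ({\<omega>\<in>space M. \<bar>err n \<omega>\<bar> > \<kappa>} \<union> (\<Union>i<K. {\<omega>\<in>space M. osc n i \<omega> \<ge> 2 * \<kappa> * sqrt (real n)}))
    \<le> 3 * c ^ 4 / (real K * \<kappa> ^ 4) + \<eta>"
proof -
  define \<eta>' where "\<eta>' = \<eta> * \<kappa> / (2 * real K)"
  have \<eta>': "\<eta>' > 0" using \<kappa> \<eta> K by (simp add: \<eta>'_def)
  have "(\<lambda>n. (L2norm M (err n))\<^sup>2 / \<kappa>\<^sup>2) \<longlonglongrightarrow> 0\<^sup>2 / \<kappa>\<^sup>2"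
    by (intro tendsto_intros err_tendsto) (use \<kappa> in simp)
  then have "(\<lambda>n. (L2norm M (err n))\<^sup>2 / \<kappa>\<^sup>2) \<longlonglongrightarrow> 0" by simp
  then have "\<forall>\<^sub>F n in sequentially. (L2norm M (err n))\<^sup>2 / \<kappa>\<^sup>2 < \<eta> / 2" by (rule order_tendstoD) (use \<eta> in simp)
  moreover have "\<forall>\<^sub>F n in sequentially. \<forall>i\<in>{..<K}. (LINT \<omega>|M. max (\<bar>V n \<omega> i\<bar> - \<kappa>) 0) \<le> 3 * c ^ 4 / (real K ^ 2 * \<kappa> ^ 3) + \<eta>'"
    by (intro eventually_ball_finite ballI V_excess \<kappa> \<eta>') auto
  ultimately show ?thesis using eventually_ge_at_top[of 1]
  proof eventually_elim
    case (elim n)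
    let ?A = "{\<omega>\<in>space M. \<bar>err n \<omega>\<bar> > \<kappa>}" and ?B = "\<lambda>i. {\<omega>\<in>space M. osc n i \<omega> \<ge> 2 * \<kappa> * sqrt (real n)}"
    note [measurable] = osc_measurable square_integrable_measurable[OF err_square_integrable]
    have "prob (?A \<union> (\<Union>i<K. ?B i)) \<le> prob ?A + prob (\<Union>i<K. ?B i)" by (rule measure_Un_le) auto
    also have "prob (\<Union>i<K. ?B i) \<le> (\<Sum>i<K. prob (?B i))"
      by (rule finite_measure_subadditive_finite) auto
    also have "\<dots> \<le> (\<Sum>i<K. (3 * c ^ 4 / (real K ^ 2 * \<kappa> ^ 3) + \<eta>') / \<kappa>)"
    proof (rule sum_mono)
      fix i assume "i \<in> {..<K}"
      then have "prob (?B i) \<le> (LINT \<omega>|M. max (\<bar>V n \<omega> i\<bar> - \<kappa>) 0) / \<kappa>"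
        by (intro osc_prob \<kappa> elim) simp
      also have "\<dots> \<le> (3 * c ^ 4 / (real K ^ 2 * \<kappa> ^ 3) + \<eta>') / \<kappa>"
        using elim(2) \<open>i \<in> {..<K}\<close> \<kappa> by (intro divide_right_mono) auto
      finally show "prob (?B i) \<le> (3 * c ^ 4 / (real K ^ 2 * \<kappa> ^ 3) + \<eta>') / \<kappa>" .
    qed
    also have "\<dots> = real K * ((3 * c ^ 4 / (real K ^ 2 * \<kappa> ^ 3) + \<eta>') / \<kappa>)" by simp
    also have "\<dots> = 3 * c ^ 4 / (real K * \<kappa> ^ 4) + \<eta> / 2"
      using K \<kappa> by (simp add: \<eta>'_def field_simps power2_eq_square power3_eq_cube power4_eq_xxxx)
    also have "prob ?A \<le> (L2norm M (err n))\<^sup>2 / \<kappa>\<^sup>2" by (rule prob_L2_Markov[OF err_square_integrable \<kappa>])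
    finally show ?case using elim(1) by linarith
  qed
qed

text \<open>Within a cell the process deviates from the step path by the excursion of the martingale and
  by the approximation error.\<close>

lemma path_near_step:
  assumes n: "n \<ge> 1" and err: "\<bar>err n \<omega>\<bar> \<le> \<kappa>" and osc: "\<And>i. i < K \<Longrightarrow> osc n i \<omega> \<le> 2 * \<kappa> * sqrt (real n)"
  shows "dist (to_D01 (\<lambda>t. 1 / sqrt (real n) * S (nat \<lfloor>real n * t\<rfloor>) \<omega>)) (step_path K (V n \<omega>)) \<le> 3 * \<kappa>"
proof (rule dist_D01_le)
  fix t :: real assume t: "0 \<le> t" "t \<le> 1"
  let ?r = "sqrt (real n)"
  have r: "?r > 0" using n by simp
  let ?k = "nat \<lfloor>real n * t\<rfloor>" and ?j = "nat \<lfloor>real K * t\<rfloor>"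
  have k: "?k \<le> n" and j: "?j \<le> K" by (rule nat_floor_mult_le[OF t])+
  have 1: "eval_D01 (to_D01 (\<lambda>t. 1 / ?r * S (nat \<lfloor>real n * t\<rfloor>) \<omega>)) t = 1 / ?r * S ?k \<omega>"
    by (rule eval_to_D01[OF cadlag_floor[of "\<lambda>k. 1 / ?r * S k \<omega>" n] t])
  have "(\<Sum>i<j. V n \<omega> i) = T n (a n j) \<omega> / ?r" if "j \<le> K" for j using that
    by (induction j) (simp_all add: V_def T_def grid_0 diff_divide_distrib)
  then have 2: "eval_D01 (step_path K (V n \<omega>)) t = T n (a n ?j) \<omega> / ?r" using j by (simp add: eval_step_path[OF t])
  have 3: "\<bar>S ?k \<omega> - T n ?k \<omega>\<bar> \<le> \<kappa> * ?r"
  proof -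
    have "\<bar>S ?k \<omega> - T n ?k \<omega>\<bar> \<le> runmax (\<lambda>k \<omega>. S k \<omega> - T n k \<omega>) n \<omega>"
      using runmax_ge[OF k, of "\<lambda>k \<omega>. S k \<omega> - T n k \<omega>" \<omega>] by simp
    also have "\<dots> = err n \<omega> * ?r" using r by (simp add: err_def)
    also have "\<dots> \<le> \<kappa> * ?r" using err r by (intro mult_right_mono) auto
    finally show ?thesis .
  qed
  have \<kappa>: "0 \<le> \<kappa>" using err by linarith
  have 4: "\<bar>T n ?k \<omega> - T n (a n ?j) \<omega>\<bar> \<le> 2 * \<kappa> * ?r"
  proof (cases "?j = K")
    case True
    have "real ?j \<le> real K * t" using t by (auto simp: of_nat_nat)
    then have "real K \<le> real K * t" unfolding True .
    then have "t = 1" using t K by simp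
    then have "?k = n" by simp
    then show ?thesis using True grid_last[OF K, of n] \<kappa> r by simp
  next
    case False
    then have jK: "?j < K" using j by simp
    have Kp: "real K > 0" using K by simp
    have "real ?j \<le> real K * t" "real K * t < real ?j + 1" using t by (auto simp: of_nat_nat)
    then have "real ?j \<le> real K * t" "real K * t < real (Suc ?j)" unfolding of_nat_Suc by linarith+
    then have jt: "real ?j / real K \<le> t" "t \<le> real (Suc ?j) / real K"
      using Kp by (simp_all add: pos_divide_le_eq pos_le_divide_eq mult.commute)
    have ak: "a n ?j \<le> ?k" "?k \<le> a n (Suc ?j)"
      unfolding grid_def by (intro nat_mono floor_mono mult_left_mono jt of_nat_0_le_iff)+
    have "\<bar>T n ?k \<omega> - T n (a n ?j) \<omega>\<bar> \<le> osc n ?j \<omega>"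
      unfolding T_diff[OF ak(1)] osc_def
      by (rule runmax_ge[of _ _ "\<lambda>k \<omega>. \<Sum>l<k. D (m n) (a n ?j + l) \<omega>"]) (rule diff_le_mono[OF ak(2)])
    then show ?thesis using osc[OF jK] by linarith
  qed
  have "\<bar>1 / ?r * S ?k \<omega> - T n (a n ?j) \<omega> / ?r\<bar> = \<bar>S ?k \<omega> - T n (a n ?j) \<omega>\<bar> / ?r"
    using r by (simp add: diff_divide_distrib[symmetric] abs_divide)
  also have "\<dots> \<le> (3 * \<kappa> * ?r) / ?r" using 3 4 r by (intro divide_right_mono) linarith+
  also have "\<dots> = 3 * \<kappa>" using r by simp
  finally show "\<bar>eval_D01 (to_D01 (\<lambda>t. 1 / ?r * S (nat \<lfloor>real n * t\<rfloor>) \<omega>)) t - eval_D01 (step_path K (V n \<omega>)) t\<bar> \<le> 3 * \<kappa>"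
    unfolding 1 2 .
qed

end

section \<open>Lipschitz test functions suffice\<close>

text \<open>A bounded continuous function is the limit from below of the Lipschitz functions obtained from
  it by inf-convolution with multiples of the distance.\<close>

definition infconv :: "('c::metric_space \<Rightarrow> real) \<Rightarrow> nat \<Rightarrow> 'c \<Rightarrow> real" where
  "infconv h k x = (INF y. h y + real k * dist x y)"

lemma infconv_bdd_below:
  assumes "\<And>x. \<bar>h x\<bar> \<le> B" shows "bdd_below (range (\<lambda>y. h y + real k * dist x y))"
proof (rule bdd_belowI2)
  fix y show "- B \<le> h y + real k * dist x y"
    using assms[of y] by (intro order_trans[OF _ add_increasing2[OF _ order_refl]]) auto
qed

lemma infconv_le:
  assumes "\<And>x. \<bar>h x\<bar> \<le> B" shows "infconv h k x \<le> h x"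
proof -
  have "infconv h k x \<le> h x + real k * dist x x"
    unfolding infconv_def by (rule cINF_lower[OF infconv_bdd_below[where h=h, OF assms]]) simp
  then show ?thesis by simp
qed

lemma infconv_ge:
  assumes "\<And>y. b \<le> h y + real k * dist x y" shows "b \<le> infconv h k x"
  unfolding infconv_def by (rule cINF_greatest) (use assms in auto)

lemma infconv_bounded:
  assumes B: "\<And>x. \<bar>h x\<bar> \<le> B" shows "\<bar>infconv h k x\<bar> \<le> B"
proof -
  have "- B \<le> h y + real k * dist x y" for y
    using B[of y] by (intro order_trans[OF _ add_increasing2[OF _ order_refl]]) auto
  then have "- B \<le> infconv h k x" by (rule infconv_ge)
  moreover have "infconv h k x \<le> B" using infconv_le[where h=h and k=k and x=x, OF B] B[of x] by linarith
  ultimately show ?thesis by linarith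
qed

lemma infconv_lipschitz:
  assumes B: "\<And>x. \<bar>h x\<bar> \<le> B" shows "\<bar>infconv h k x - infconv h k y\<bar> \<le> real k * dist x y"
proof -
  have *: "infconv h k x - real k * dist x y \<le> infconv h k y" for x y
  proof (rule infconv_ge)
    fix z
    have "infconv h k x \<le> h z + real k * dist x z"
      unfolding infconv_def by (rule cINF_lower[OF infconv_bdd_below[where h=h, OF B]]) simp
    moreover have "real k * dist x z \<le> real k * dist x y + real k * dist y z"
      unfolding distrib_left[symmetric] by (intro mult_left_mono dist_triangle) simp
    ultimately show "infconv h k x - real k * dist x y \<le> h z + real k * dist y z" by linarith
  qed
  show ?thesis using *[of x y] *[of y x] by (simp add: abs_le_iff dist_commute)
qed

lemma infconv_tendsto:
  assumes h: "continuous_on UNIV h" and B: "\<And>x. \<bar>h x\<bar> \<le> B"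
  shows "(\<lambda>k. infconv h k x) \<longlonglongrightarrow> h x"
proof (rule LIMSEQ_I)
  fix r :: real assume r: "r > 0"
  have "isCont h x" using h by (simp add: continuous_on_eq_continuous_at)
  then obtain d where d: "d > 0" "\<And>y. dist y x < d \<Longrightarrow> dist (h y) (h x) < r / 2"
    unfolding continuous_at_eps_delta using r by (meson half_gt_zero)
  \<comment> \<open>Beyond distance \<open>d\<close> the penalty exceeds the oscillation \<open>2 * B\<close> of \<open>h\<close>.\<close>
  obtain k0 :: nat where k0: "2 * B / d < real k0" using reals_Archimedean2 by blast
  show "\<exists>no. \<forall>k\<ge>no. norm (infconv h k x - h x) < r"
  proof (intro exI[of _ k0] allI impI)
    fix k assume k: "k \<ge> k0"
    have "h x - r / 2 \<le> infconv h k x"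
    proof (rule infconv_ge)
      fix y
      show "h x - r / 2 \<le> h y + real k * dist x y"
      proof (cases "dist y x < d")
        case True
        then have "h x - r / 2 \<le> h y" using d(2)[OF True] unfolding dist_real_def by linarith
        then show ?thesis by (simp add: add_increasing2)
      next
        case False
        have "2 * B < real k0 * d" using k0 d(1) by (simp add: pos_divide_less_eq)
        also have "\<dots> \<le> real k * dist x y" using k False d(1) by (intro mult_mono) (auto simp: dist_commute)
        finally have "2 * B \<le> real k * dist x y" by simp
        then show ?thesis using B[of x] B[of y] r unfolding abs_le_iff by linarith
      qed
    qed
    then show "norm (infconv h k x - h x) < r" using infconv_le[where h=h and k=k and x=x, OF B] r by (simp add: abs_less_iff)
  qed
qed

text \<open>Inf-convolution approximates a bounded continuous test function from below by Lipschitz ones,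
  which gives a lower bound for the limit; the negative of the function gives the upper bound.\<close>

lemma converges_in_distribution_Lipschitz:
  fixes Y :: "nat \<Rightarrow> 'a \<Rightarrow> 'c::metric_space" and Z :: "'b \<Rightarrow> 'c"
  assumes M: "prob_space M" and N: "prob_space N"
    and Y: "\<And>n. Y n \<in> borel_measurable M" and Z: "Z \<in> borel_measurable N"
    and lip: "\<And>(h :: 'c \<Rightarrow> real) B L. (\<And>x. \<bar>h x\<bar> \<le> B) \<Longrightarrow> (\<And>x y. \<bar>h x - h y\<bar> \<le> L * dist x y) \<Longrightarrow>
      (\<lambda>n. LINT \<omega>|M. h (Y n \<omega>)) \<longlonglongrightarrow> (LINT \<omega>|N. h (Z \<omega>))"
  shows "converges_in_distribution M Y N Z"
  unfolding converges_in_distribution_def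
proof (intro conjI allI impI Y Z)
  interpret M: prob_space M by fact
  interpret N: prob_space N by fact
  fix h0 :: "'c \<Rightarrow> real" assume h0: "continuous_on UNIV h0 \<and> bounded (range h0)"
  then obtain B where B0: "\<And>x. \<bar>h0 x\<bar> \<le> B" by (auto simp: bounded_iff)
  have int: "integrable M (\<lambda>\<omega>. h (Y n \<omega>))" "integrable N (\<lambda>\<omega>. h (Z \<omega>))"
    if "continuous_on UNIV h" "\<And>x. \<bar>h x\<bar> \<le> B" for h :: "'c \<Rightarrow> real" and n
  proof -
    note hm = borel_measurable_continuous_onI[OF that(1)]
    show "integrable M (\<lambda>\<omega>. h (Y n \<omega>))"
      by (rule M.integrable_const_bound[of _ B]) (use that(2) measurable_compose[OF Y hm] in auto)
    show "integrable N (\<lambda>\<omega>. h (Z \<omega>))"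
      by (rule N.integrable_const_bound[of _ B]) (use that(2) measurable_compose[OF Z hm] in auto)
  qed
  have lower: "\<forall>\<^sub>F n in sequentially. (LINT \<omega>|N. h (Z \<omega>)) - r < (LINT \<omega>|M. h (Y n \<omega>))"
    if hc: "continuous_on UNIV h" and hB: "\<And>x. \<bar>h x\<bar> \<le> B" and r: "r > 0" for h :: "'c \<Rightarrow> real" and r
  proof -
    have ic: "continuous_on UNIV (infconv h k)" for k
    proof (rule lipschitz_on_continuous_on[of "real k"])
      show "lipschitz_on (real k) UNIV (infconv h k)"
        by (rule lipschitz_onI) (use infconv_lipschitz[where h=h, OF hB] in \<open>auto simp: dist_real_def\<close>)
    qed
    have "(\<lambda>k. LINT \<omega>|N. infconv h k (Z \<omega>)) \<longlonglongrightarrow> (LINT \<omega>|N. h (Z \<omega>))"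
    proof (rule integral_dominated_convergence)
      show "(\<lambda>\<omega>. h (Z \<omega>)) \<in> borel_measurable N" using int(2)[OF hc hB] by simp
      show "(\<lambda>\<omega>. infconv h k (Z \<omega>)) \<in> borel_measurable N" for k
        using int(2)[OF ic infconv_bounded[where h=h, OF hB]] by simp
      show "AE \<omega> in N. (\<lambda>k. infconv h k (Z \<omega>)) \<longlonglongrightarrow> h (Z \<omega>)" using infconv_tendsto[where h=h, OF hc hB] by simp
      show "AE \<omega> in N. norm (infconv h k (Z \<omega>)) \<le> B" for k using infconv_bounded[where h=h, OF hB] by simp
    qed simp
    then have "\<forall>\<^sub>F k in sequentially. (LINT \<omega>|N. h (Z \<omega>)) - r / 2 < (LINT \<omega>|N. infconv h k (Z \<omega>))"
      by (rule order_tendstoD(1)) (use r in simp)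
    then obtain k where k: "(LINT \<omega>|N. h (Z \<omega>)) - r / 2 < (LINT \<omega>|N. infconv h k (Z \<omega>))"
      using eventually_happens trivial_limit_sequentially by blast
    have "(\<lambda>n. LINT \<omega>|M. infconv h k (Y n \<omega>)) \<longlonglongrightarrow> (LINT \<omega>|N. infconv h k (Z \<omega>))"
      by (rule lip[OF infconv_bounded[where h=h, OF hB] infconv_lipschitz[where h=h, OF hB]])
    then have "\<forall>\<^sub>F n in sequentially. (LINT \<omega>|N. infconv h k (Z \<omega>)) - r / 2 < (LINT \<omega>|M. infconv h k (Y n \<omega>))"
      by (rule order_tendstoD(1)) (use r in simp)
    then show ?thesis
    proof eventually_elim
      case (elim n)
      have "(LINT \<omega>|M. infconv h k (Y n \<omega>)) \<le> (LINT \<omega>|M. h (Y n \<omega>))"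
        by (rule integral_mono[OF int(1)[OF ic infconv_bounded[where h=h, OF hB]] int(1)[OF hc hB]]) (rule infconv_le[where h=h, OF hB])
      then show ?case using elim k by linarith
    qed
  qed
  show "(\<lambda>n. LINT \<omega>|M. h0 (Y n \<omega>)) \<longlonglongrightarrow> (LINT \<omega>|N. h0 (Z \<omega>))"
  proof (rule LIMSEQ_I)
    fix r :: real assume r: "r > 0"
    have c: "continuous_on UNIV h0" "continuous_on UNIV (\<lambda>x. - h0 x)" using h0 by (auto intro: continuous_intros)
    have "\<forall>\<^sub>F n in sequentially. (LINT \<omega>|N. h0 (Z \<omega>)) - r < (LINT \<omega>|M. h0 (Y n \<omega>))"
      by (rule lower[OF c(1) B0 r])
    moreover have "\<forall>\<^sub>F n in sequentially. (LINT \<omega>|N. - h0 (Z \<omega>)) - r < (LINT \<omega>|M. - h0 (Y n \<omega>))"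
      by (rule lower[OF c(2) _ r]) (simp add: B0)
    ultimately have "\<forall>\<^sub>F n in sequentially. norm ((LINT \<omega>|M. h0 (Y n \<omega>)) - (LINT \<omega>|N. h0 (Z \<omega>))) < r"
      by eventually_elim (simp add: abs_less_iff)
    then show "\<exists>no. \<forall>n\<ge>no. norm ((LINT \<omega>|M. h0 (Y n \<omega>)) - (LINT \<omega>|N. h0 (Z \<omega>))) < r"
      by (simp add: eventually_sequentially)
  qed
qed

section \<open>The invariance principle\<close>

context maxwell_woodroofe_qv
begin

definition sum_path :: "nat \<Rightarrow> 'a \<Rightarrow> D01" where
  "sum_path n \<omega> = to_D01 (\<lambda>t. 1 / sqrt (real n) * S (nat \<lfloor>real n * t\<rfloor>) \<omega>)"

text \<open>The path is the image of finitely many random variables under a continuous map, so that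
  measurability holds although the space is not separable.\<close>

lemma sum_path_measurable: "sum_path n \<in> borel_measurable M"
proof -
  have "sum_path n \<omega> = step_path n (\<lambda>i. Z i \<omega> / sqrt (real n))" for \<omega>
    by (simp add: sum_path_def step_path_def S_def sum_divide_distrib)
  then have "sum_path n = (\<lambda>\<omega>. step_path n (\<lambda>i. Z i \<omega> / sqrt (real n)))" by (rule ext)
  moreover have "(\<lambda>\<omega>. step_path n (\<lambda>i. Z i \<omega> / sqrt (real n))) \<in> borel_measurable M"
    using square_integrable_measurable[OF Z_square_integrable] by (intro step_path_measurable) simp
  ultimately show ?thesis by simp
qed

text \<open>The path is uniformly close to the step path of the grid increments of the martingale, these
  increments converge jointly in distribution to those of the Brownian motion, and the step path of the
  latter is uniformly close to the Brownian path.  The three errors vanish in the order in which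
  first \<open>n\<close> and then \<open>K\<close> tend to infinity.\<close>

theorem invariance_principle:
  assumes BM: "brownian N W"
  shows "converges_in_distribution M sum_path N (scaled_process c W)"
proof -
  interpret BM: brownian N W by (rule BM)
  show ?thesis
  proof (rule converges_in_distribution_Lipschitz[OF prob_space_axioms BM.prob_space_axioms sum_path_measurable
        BM.scaled_process_measurable], rule LIMSEQ_I)
    fix h :: "D01 \<Rightarrow> real" and B L r :: real
    assume hB: "\<And>x. \<bar>h x\<bar> \<le> B" and hL: "\<And>x y. \<bar>h x - h y\<bar> \<le> L * dist x y" and r: "r > 0"
    define L' where "L' = \<bar>L\<bar> + 1"
    have L': "L' > 0" by (simp add: L'_def)
    have hL': "\<bar>h x - h y\<bar> \<le> L' * dist x y" for x y
    proof -
      have "L * dist x y \<le> L' * dist x y" unfolding L'_def by (intro mult_right_mono) auto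
      then show ?thesis using hL[of x y] by linarith
    qed
    have hc: "continuous_on UNIV h"
    proof (rule lipschitz_on_continuous_on[of L'])
      show "lipschitz_on L' UNIV h"
        by (rule lipschitz_onI) (use hL' L' in \<open>auto simp: dist_real_def\<close>)
    qed
    have B0: "0 \<le> B" using hB[of undefined] by linarith
    define \<kappa> where "\<kappa> = r / (12 * L')"
    have \<kappa>: "\<kappa> > 0" using r L' by (simp add: \<kappa>_def)
    define \<eta> where "\<eta> = r / (16 * (B + 1))"
    have \<eta>: "\<eta> > 0" using r B0 by (simp add: \<eta>_def)
    \<comment> \<open>The number of cells is fixed first; it controls both the tightness bound and the
      discretisation of the limit.\<close>
    have "(\<lambda>K. 3 * c ^ 4 / \<kappa> ^ 4 / real K) \<longlonglongrightarrow> 0" by (rule lim_const_over_n)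
    then have "\<forall>\<^sub>F K in sequentially. 3 * c ^ 4 / \<kappa> ^ 4 / real K < \<eta>" by (rule order_tendstoD) (rule \<eta>)
    moreover have "\<forall>\<^sub>F K in sequentially. dist (LINT \<omega>|N. h (step_path K (BM.scaled_dW c K \<omega>))) (LINT \<omega>|N. h (scaled_process c W \<omega>)) < r / 4"
      by (rule tendstoD[OF BM.step_path_expectation_tendsto[OF hc hB]]) (use r in simp)
    ultimately have "\<forall>\<^sub>F K in sequentially. 3 * c ^ 4 / \<kappa> ^ 4 / real K < \<eta> \<and>
        dist (LINT \<omega>|N. h (step_path K (BM.scaled_dW c K \<omega>))) (LINT \<omega>|N. h (scaled_process c W \<omega>)) < r / 4 \<and> K \<ge> 1"
      using eventually_ge_at_top[of 1] by eventually_elim simp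
    then obtain K where K: "3 * c ^ 4 / \<kappa> ^ 4 / real K < \<eta>" "K \<ge> 1"
        "dist (LINT \<omega>|N. h (step_path K (BM.scaled_dW c K \<omega>))) (LINT \<omega>|N. h (scaled_process c W \<omega>)) < r / 4"
      using eventually_happens trivial_limit_sequentially by blast
    obtain m where m: "\<And>q. \<forall>\<^sub>F n in sequentially. good K q (m n) n" using good_sequence by blast
    interpret A: grid_approximation M F Z e C c N W K m
      by unfold_locales (rule K(2), rule m)
    have Pc: "continuous_on UNIV (\<lambda>v. h (step_path K v))"
      by (rule continuous_on_compose2[OF hc step_path_continuous]) simp
    have "(\<lambda>n. LINT \<omega>|M. h (step_path K (A.V n \<omega>))) \<longlonglongrightarrow> (LINT \<omega>|N. h (step_path K (BM.scaled_dW c K \<omega>)))"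
      by (rule A.V_expectation_tendsto[OF Pc]) (rule hB)
    then have "\<forall>\<^sub>F n in sequentially. dist (LINT \<omega>|M. h (step_path K (A.V n \<omega>))) (LINT \<omega>|N. h (step_path K (BM.scaled_dW c K \<omega>))) < r / 4"
      by (rule tendstoD) (use r in simp)
    then have "\<forall>\<^sub>F n in sequentially. norm ((LINT \<omega>|M. h (sum_path n \<omega>)) - (LINT \<omega>|N. h (scaled_process c W \<omega>))) < r"
      using A.far_prob[OF \<kappa> \<eta>] eventually_ge_at_top[of 1]
    proof eventually_elim
      case (elim n)
      let ?Far = "{\<omega>\<in>space M. \<bar>A.err n \<omega>\<bar> > \<kappa>} \<union> (\<Union>i<K. {\<omega>\<in>space M. A.osc n i \<omega> \<ge> 2 * \<kappa> * sqrt (real n)})"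
      note [measurable] = A.osc_measurable square_integrable_measurable[OF A.err_square_integrable]
      have Far: "?Far \<in> events" by measurable
      have "3 * c ^ 4 / (real K * \<kappa> ^ 4) = 3 * c ^ 4 / \<kappa> ^ 4 / real K" by (simp add: mult.commute)
      then have PF: "prob ?Far \<le> 2 * \<eta>" using elim(2) K(1) by linarith
      note hm = borel_measurable_continuous_onI[OF hc]
      have i1: "integrable M (\<lambda>\<omega>. h (sum_path n \<omega>))"
        by (rule integrable_const_bound[of _ B]) (use hB measurable_compose[OF sum_path_measurable hm] in auto)
      have Vm: "(\<lambda>\<omega>. step_path K (A.V n \<omega>)) \<in> borel_measurable M"
        by (rule step_path_measurable) (rule square_integrable_measurable[OF A.V_square_integrable])
      have i2: "integrable M (\<lambda>\<omega>. h (step_path K (A.V n \<omega>)))"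
        by (rule integrable_const_bound[of _ B]) (use hB measurable_compose[OF Vm hm] in auto)
      have i3: "integrable M (\<lambda>\<omega>. indicator ?Far \<omega> :: real)"
        by (rule integrable_real_indicator[OF Far]) (simp add: emeasure_eq_measure)
      have "\<bar>(LINT \<omega>|M. h (sum_path n \<omega>)) - (LINT \<omega>|M. h (step_path K (A.V n \<omega>)))\<bar> = \<bar>LINT \<omega>|M. h (sum_path n \<omega>) - h (step_path K (A.V n \<omega>))\<bar>"
        using i1 i2 by simp
      also have "\<dots> \<le> (LINT \<omega>|M. \<bar>h (sum_path n \<omega>) - h (step_path K (A.V n \<omega>))\<bar>)" by (rule integral_abs_bound)
      also have "\<dots> \<le> (LINT \<omega>|M. L' * (3 * \<kappa>) + 2 * B * indicator ?Far \<omega>)"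
      proof (rule integral_mono)
        show "integrable M (\<lambda>\<omega>. \<bar>h (sum_path n \<omega>) - h (step_path K (A.V n \<omega>))\<bar>)" using i1 i2 by simp
        show "integrable M (\<lambda>\<omega>. L' * (3 * \<kappa>) + 2 * B * indicator ?Far \<omega>)"
          by (intro Bochner_Integration.integrable_add integrable_mult_right i3) simp
        fix \<omega> assume \<omega>: "\<omega> \<in> space M"
        show "\<bar>h (sum_path n \<omega>) - h (step_path K (A.V n \<omega>))\<bar> \<le> L' * (3 * \<kappa>) + 2 * B * indicator ?Far \<omega>"
        proof (cases "\<omega> \<in> ?Far")
          case True
          have "\<bar>h (sum_path n \<omega>) - h (step_path K (A.V n \<omega>))\<bar> \<le> B + B"
            by (rule order_trans[OF abs_triangle_ineq4 add_mono[OF hB hB]])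
          moreover have "0 \<le> L' * (3 * \<kappa>)" using L' \<kappa> by simp
          ultimately show ?thesis using True by simp
        next
          case False
          then have "\<bar>A.err n \<omega>\<bar> \<le> \<kappa>" "\<And>i. i < K \<Longrightarrow> A.osc n i \<omega> \<le> 2 * \<kappa> * sqrt (real n)"
            using \<omega> by (force simp: not_less not_le)+
          then have "dist (sum_path n \<omega>) (step_path K (A.V n \<omega>)) \<le> 3 * \<kappa>"
            unfolding sum_path_def by (rule A.path_near_step[OF elim(3)])
          then have "L' * dist (sum_path n \<omega>) (step_path K (A.V n \<omega>)) \<le> L' * (3 * \<kappa>)" using L' by (intro mult_left_mono) auto
          then show ?thesis using hL'[of "sum_path n \<omega>" "step_path K (A.V n \<omega>)"] False by simp
        qed
      qed
      also have "\<dots> = L' * (3 * \<kappa>) + 2 * B * prob ?Far"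
        using i3 Far by (simp add: prob_space)
      also have "\<dots> \<le> r / 4 + r / 4"
      proof (rule add_mono)
        show "L' * (3 * \<kappa>) \<le> r / 4" using L' by (simp add: \<kappa>_def)
        have "2 * B * prob ?Far \<le> 2 * B * (2 * \<eta>)" using PF B0 by (intro mult_left_mono) auto
        also have "\<dots> = (B / (B + 1)) * (r / 4)" using B0 by (simp add: \<eta>_def field_simps)
        also have "\<dots> \<le> 1 * (r / 4)" using B0 r by (intro mult_right_mono) auto
        finally show "2 * B * prob ?Far \<le> r / 4" by simp
      qed
      finally have "\<bar>(LINT \<omega>|M. h (sum_path n \<omega>)) - (LINT \<omega>|M. h (step_path K (A.V n \<omega>)))\<bar> \<le> r / 4 + r / 4" .
      then show ?case using elim(1) K(3) unfolding dist_real_def real_norm_def by linarith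
    qed
    then show "\<exists>no. \<forall>n\<ge>no. norm ((LINT \<omega>|M. h (sum_path n \<omega>)) - (LINT \<omega>|N. h (scaled_process c W \<omega>))) < r"
      by (simp add: eventually_sequentially)
  qed
qed

end

theorem theorem2p1:
  fixes M :: "'a measure" and F :: "nat \<Rightarrow> 'a measure" and X :: "nat \<Rightarrow> 'a \<Rightarrow> real"
    and N :: "'b measure" and W :: "real \<Rightarrow> 'b \<Rightarrow> real"
    and C c :: real
  assumes "prob_space M"
    and "\<And>k. k \<ge> 1 \<Longrightarrow> X k \<in> borel_measurable M"
    and "\<And>k. k \<ge> 1 \<Longrightarrow> integrable M (\<lambda>\<omega>. (X k \<omega>)\<^sup>2)"
    and "\<And>k. k \<ge> 1 \<Longrightarrow> (LINT \<omega>|M. X k \<omega>) = 0"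
    and "\<And>i. subalgebra M (F i)"
    and "\<And>i j. i \<le> j \<Longrightarrow> sets (F i) \<subseteq> sets (F j)"
    and "\<And>i. i \<ge> 1 \<Longrightarrow> X i \<in> borel_measurable (F i)"
    and i_bound: "\<And>n. n \<ge> 1 \<Longrightarrow> 1 / real n * (\<Sum>j=1..n. LINT \<omega>|M. (X j \<omega>)\<^sup>2) \<le> C"
    and i_lindeberg: "\<And>\<epsilon>. \<epsilon> > 0 \<Longrightarrow>
      (\<lambda>n. 1 / real n *
         (\<Sum>k=1..n. LINT \<omega>|M. (X k \<omega>)\<^sup>2 * indicator {\<omega>. \<bar>X k \<omega>\<bar> > \<epsilon> * sqrt (real n)} \<omega>)) \<longlonglongrightarrow> 0"
    and ii: "(\<Sum>k. ennreal (2 powr (- real k / 2)) * delta M F X (2 ^ k)) < \<infinity>"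
    and "c \<ge> 0"
    and iii: "\<And>t \<epsilon>. 0 \<le> t \<Longrightarrow> t \<le> 1 \<Longrightarrow> \<epsilon> > 0 \<Longrightarrow>
      (\<lambda>m. limsup (\<lambda>n. ereal (measure M {\<omega> \<in> space M.
         \<bar>1 / real n * (\<Sum>k=1..nat \<lfloor>real n * t\<rfloor>. (X k \<omega>)\<^sup>2 + 2 * X k \<omega> * theta M F X m k \<omega>)
            - t * c\<^sup>2\<bar> > \<epsilon>}))) \<longlonglongrightarrow> 0"
    and "standard_brownian_motion N W"
  shows "converges_in_distribution M (partial_sum_process X) N (scaled_process c W)"
proof -
  \<comment> \<open>Summands are numbered from zero, so that \<open>Z l\<close> is revealed at time \<open>Suc l\<close>.\<close>
  define Z where "Z l = X (Suc l)" for l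
  define e where "e j = enn2real (delta M F X (2 ^ j))" for j
  have psum: "psum X k \<omega> = (\<Sum>l<k. Z l \<omega>)" for k \<omega>
    by (simp add: psum_def Z_def sum.atLeast1_atMost_eq)
  have pw: "2 powr (- real k / 2) = 1 / sqrt 2 ^ k" for k
  proof -
    have "sqrt 2 ^ k = (2 powr (1 / 2)) ^ k" by (simp add: powr_half_sqrt)
    also have "\<dots> = (2 powr (1 / 2)) powr real k" by (rule powr_realpow[symmetric]) simp
    also have "\<dots> = 2 powr (real k / 2)" by (simp add: powr_powr)
    finally show ?thesis using powr_minus_divide[of 2 "real k / 2"] by simp
  qed
  have top: "delta M F X (2 ^ k) \<noteq> \<top>" for k
  proof
    assume "delta M F X (2 ^ k) = \<top>"
    then have "ennreal (2 powr (- real k / 2)) * delta M F X (2 ^ k) = \<top>" by (simp add: ennreal_mult_top)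
    moreover have "ennreal (2 powr (- real k / 2)) * delta M F X (2 ^ k)
        \<le> (\<Sum>k. ennreal (2 powr (- real k / 2)) * delta M F X (2 ^ k))"
      using sum_le_suminf[of "\<lambda>k. ennreal (2 powr (- real k / 2)) * delta M F X (2 ^ k)" "{k}"] by simp
    ultimately show False using ii by (simp add: top_unique)
  qed
  have de: "delta M F X (2 ^ k) = ennreal (e k)" for k
    using top[of k] by (simp add: e_def less_top)
  have incr: "(\<lambda>\<omega>. \<Sum>l\<in>{i..<i + k}. Z l \<omega>) = (\<lambda>\<omega>. psum X (k + i) \<omega> - psum X i \<omega>)" for i k
  proof
    fix \<omega>
    show "(\<Sum>l\<in>{i..<i + k}. Z l \<omega>) = psum X (k + i) \<omega> - psum X i \<omega>"
      using sum.atLeastLessThan_concat[of 0 i "i + k" "\<lambda>l. Z l \<omega>"]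
      by (simp add: psum atLeast0LessThan add.commute)
  qed
  interpret P: prob_space M by fact
  interpret maxwell_woodroofe M F Z e C
  proof unfold_locales
    show "subalgebra M (F i)" for i by fact
    show "sets (F i) \<subseteq> sets (F j)" if "i \<le> j" for i j using assms(6)[OF that] .
    show "Z l \<in> borel_measurable (F (Suc l))" for l using assms(7)[of "Suc l"] by (simp add: Z_def)
    show sq: "square_integrable M (Z l)" for l
      using assms(2,3)[of "Suc l"] by (simp add: Z_def square_integrable_def)
    show "L2norm M (real_cond_exp M (F i) (\<lambda>\<omega>. \<Sum>l\<in>{i..<i + 2 ^ j}. Z l \<omega>)) \<le> e j" for i j
    proof -
      have "ennreal (L2norm M (real_cond_exp M (F i) (\<lambda>\<omega>. \<Sum>l\<in>{i..<i + 2 ^ j}. Z l \<omega>))) \<le> delta M F X (2 ^ j)"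
        unfolding incr delta_def by (rule SUP_upper) simp
      then show ?thesis unfolding de by (subst (asm) ennreal_le_iff) (simp_all add: e_def)
    qed
    show "summable (\<lambda>j. e j / sqrt 2 ^ j)"
    proof (rule summable_suminf_not_top)
      show "0 \<le> e j / sqrt 2 ^ j" for j by (simp add: e_def)
      have "ennreal (2 powr (- real k / 2)) * delta M F X (2 ^ k) = ennreal (e k / sqrt 2 ^ k)" for k
        unfolding de pw by (subst ennreal_mult[symmetric]) (simp_all add: e_def)
      then show "(\<Sum>j. ennreal (e j / sqrt 2 ^ j)) \<noteq> \<top>" using ii by (simp add: less_top)
    qed
    show "(\<Sum>l<n. (L2norm M (Z l))\<^sup>2) \<le> C * real n" if "n \<ge> 1" for n
      using i_bound[OF that] that
      by (simp add: L2norm_power2 Z_def sum.atLeast1_atMost_eq pos_divide_le_eq)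
    show "(\<lambda>n. 1 / real n *
        (\<Sum>l<n. LINT \<omega>|M. (Z l \<omega>)\<^sup>2 * indicator {\<omega>. \<bar>Z l \<omega>\<bar> > \<epsilon> * sqrt (real n)} \<omega>)) \<longlonglongrightarrow> 0"
      if "\<epsilon> > 0" for \<epsilon>
      using i_lindeberg[OF that] by (simp add: Z_def sum.atLeast1_atMost_eq)
  qed
  have S: "S k \<omega> = psum X k \<omega>" for k \<omega> by (simp add: S_def psum)
  have th: "th p k \<omega> = theta M F X (2 ^ p) k \<omega>" for p k \<omega>
    by (simp add: th_def theta_def S)
  interpret maxwell_woodroofe_qv M F Z e C c
  proof unfold_locales
    fix t \<epsilon> :: real assume t: "0 \<le> t" "t \<le> 1" and \<epsilon>: "\<epsilon> > 0"
    \<comment> \<open>Level \<open>p\<close> of the approximation has windows of length \<open>2 ^ p\<close>.\<close>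
    have "(\<lambda>p. limsup (\<lambda>n. ereal (measure M {\<omega> \<in> space M.
         \<bar>1 / real n * (\<Sum>k=1..nat \<lfloor>real n * t\<rfloor>. (X k \<omega>)\<^sup>2 + 2 * X k \<omega> * theta M F X (2 ^ p) k \<omega>)
            - t * c\<^sup>2\<bar> > \<epsilon>}))) \<longlonglongrightarrow> 0"
      by (rule filterlim_compose[OF iii[OF t \<epsilon>]])
         (intro filterlim_subseq strict_monoI power_strict_increasing; simp)
    then show "(\<lambda>p. limsup (\<lambda>n. ereal (measure M {\<omega> \<in> space M. \<bar>1 / real n *
      (\<Sum>l<nat \<lfloor>real n * t\<rfloor>. (Z l \<omega>)\<^sup>2 + 2 * Z l \<omega> * th p (Suc l) \<omega>) - t * c\<^sup>2\<bar> > \<epsilon>}))) \<longlonglongrightarrow> 0"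
      by (simp add: Z_def th sum.atLeast1_atMost_eq)
  qed
  have "sum_path = partial_sum_process X"
    by (intro ext) (simp add: sum_path_def partial_sum_process_def S psum_def)
  moreover have "brownian N W" by unfold_locales fact
  ultimately show ?thesis using invariance_principle[of N W] by simp
qed

end
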